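(* Let $h,\nu\in\mathbb{R}_{>0}$, let $r\in\mathbb{Z}_{\ge 0}$, let $\mu,\delta,\lambda,a,b,f_1,\dots,f_r\in\mathbb{C}$ with $\Re(\mu)>0$ and no $f_j$ or $\mu$ a non-positive integer, and let $m_1,\dots,m_r\in\mathbb{Z}_{\geq 0}$, $m:=m_1+\cdots+m_r$. Let $\mathcal{I}$ and $\mathcal{J}$ be the fractional integral operators of the first and second kind with these parameters, and let $\mathfrak{c}_2(\lambda)$, $\mathfrak{p}_k$, $A_k$ $(0\le k\le m)$ be the associated quantities (all defined in the context). Assume $$\Re(\mathfrak{c}_2(\lambda))>-\min[0,\Re(\mathfrak{p}_m)].$$ Let $\varphi:\mathbb{R}_{>0}\to\mathbb{C}$ be such that $x^{\lambda-\delta}\varphi(x)\in L^1(\mathbb{R}_{>0})$. Then, for every $s\in\mathbb{C}$ with $\Re(s)>0$, $$\mathcal{L}[x^\lambda\,\mathcal{I}\varphi](s)=\int_{0}^{\infty}K_{\mathcal{I}}(s,x)\,\varphi(x)\,\mathrm{d}x,$$ where, for $x>0$, $K_{\mathcal{I}}(s,x)$ is the value at the point $x$ of the operator $\mathcal{J}$ applied to the function $t\mapsto t^\lambda \mathrm{e}^{-st}$, and $$K_{\mathcal{I}}(s,x)=x^{\lambda-\delta}\sum_{k=0}^{m}\frac{A_k}{A_0}(a)_k(b)_k\; H_{2,3}^{3,0}\left[sx\left|\begin{matrix}(\mathfrak{c}_2(\lambda)+\mu-a,1/\nu),\ (\mathfrak{c}_2(\lambda)+\mu-b,1/\nu)\\(0,1),\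 (\mathfrak{c}_2(\lambda),1/\nu),\ (\mathfrak{c}_2(\lambda)+\mathfrak{p}_k,1/\nu)\end{matrix}\right.\right].$$
   Context: Notation. $\mathbb{R}_{>0}=(0,\infty)$; $\mathbb{Z}_{\ge 0}$ is the set of non-negative integers. The Pochhammer symbol is $(a)_0=1$, $(a)_k=a(a+1)\cdots(a+k-1)$ for $k\geq 1$. Empty products equal $1$. $L^1(\mathbb{R}_{>0})$ is the space of Lebesgue measurable functions $g:\mathbb{R}_{>0}\to\mathbb{C}$ with $\int_0^\infty|g(t)|\,\mathrm{d}t<\infty$. The Laplace transform is $\mathcal{L}[g](s)=\int_0^\infty \mathrm{e}^{-st}g(t)\,\mathrm{d}t$; $\mathcal{L}[x^\lambda\mathcal{I}\varphi](s)$ means the Laplace transform of the function $x\mapsto x^\lambda(\mathcal{I}\varphi)(x)$. Hypergeometric function. For $|z|<1$, $${}_{r+2}F_{r+1}\left[\begin{matrix}a,b,(f_r+m_r)\\ \mu,(f_r)\end{matrix};z\right]=\sum_{k=0}^\infty\frac{(a)_k(b)_k\prod_{j=1}^r(f_j+m_j)_k}{(\mu)_k\prod_{j=1}^r(f_j)_k}\frac{z^k}{k!},$$ where $(f_r+m_r)$ abbreviates the list $f_1+m_1,\dots,f_r+m_r$ and $(f_r)$ the list $f_1,\dots,f_r$. Operators. For $x>0$ and a complex-valued function $\varphi$ on $\mathbb{R}_{>0}$ for which the integrals exist, $$(\mathcal{I}\varphi)(x)=\frac{\nu x^{-\delta-\nu(\mu+h)}}{\Gamma(\mu)}\int_0^x(x^\nu-t^\nu)^{\mu-1}\,{}_{r+2}F_{r+1}\left[\begin{matrix}a,b,(f_r+m_r)\\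 \mu,(f_r)\end{matrix};1-\frac{t^\nu}{x^\nu}\right]\varphi(t)\,t^{\nu h+\nu-1}\,\mathrm{d}t,$$ $$(\mathcal{J}\varphi)(x)=\frac{\nu x^{\nu h+\nu-1}}{\Gamma(\mu)}\int_x^\infty(t^\nu-x^\nu)^{\mu-1}\,{}_{r+2}F_{r+1}\left[\begin{matrix}a,b,(f_r+m_r)\\ \mu,(f_r)\end{matrix};1-\frac{x^\nu}{t^\nu}\right]\varphi(t)\,t^{-\delta-\nu(\mu+h)}\,\mathrm{d}t.$$ Auxiliary quantities. $\mathfrak{c}_1(t):=1+h+\frac{t}{\nu}$, $\mathfrak{c}_2(t):=\mathfrak{c}_1(\delta-1)-\frac{t}{\nu}=1+h+\frac{\delta-1-t}{\nu}$, and $\mathfrak{p}_k:=\mu-a-b-k$ for $k\in\mathbb{Z}_{\ge0}$. The numbers $\sigma_0,\dots,\sigma_m$ are defined by the polynomial identity $(f_1+x)_{m_1}\cdots(f_r+x)_{m_r}=\sum_{j=0}^m\sigma_{m-j}x^j$, and $$A_k=\sum_{j=k}^m{j\brace k}\sigma_{m-j}\quad(0\le k\le m),$$ where ${j\brace k}$ are the Stirling numbers of the second kind; in particular $A_0=(f_1)_{m_1}\cdots(f_r)_{m_r}$ and $A_m=1$. Fox $H$-function. For integers $0\le M\le q$, $0\le N\le p$, $a_i,b_j\in\mathbb{C}$, $A'_i,B_j\ge0$, $$H_{p,q}^{M,N}\left[z\left|\begin{matrix}(a_1,A'_1),\dots,(a_p,A'_p)\\(b_1,B_1),\dots,(b_q,B_q)\end{matrix}\right.\right]=\frac{1}{2\pi\mathrm{i}}\int_L\frac{\prod_{k=1}^M\Gamma(B_kw+b_k)\prod_{i=1}^N\Gamma(1-a_i-A'_iw)}{\prod_{k=M+1}^q\Gamma(1-b_k-B_kw)\prod_{i=N+1}^p\Gamma(A'_iw+a_i)}z^{-w}\,\mathrm{d}w,$$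 where $L$ is a contour from $c-\mathrm{i}\infty$ to $c+\mathrm{i}\infty$ ($c\in\mathbb{R}$) separating the poles of the $\Gamma(B_kw+b_k)$, $1\le k\le M$ (lying to the left of $L$), from the poles of the $\Gamma(1-a_i-A'_iw)$, $1\le i\le N$ (lying to the right). Here $z^{-w}$ is taken with the principal branch of the logarithm. *)

theory Defs
  imports "HOL-Analysis.Analysis" "HOL-Combinatorics.Stirling"
begin

section \<open>Hypergeometric function and fractional integral operators\<close>

text \<open>The parameters \<open>f\<^sub>1, \<dots>, f\<^sub>r\<close> and \<open>m\<^sub>1, \<dots>, m\<^sub>r\<close> are functions on
  \<open>nat\<close> of which only the values at \<open>1, \<dots>, r\<close> are used.\<close>

definition hypergeo ::
  "nat \<Rightarrow> (nat \<Rightarrow> complex) \<Rightarrow> (nat \<Rightarrow> nat) \<Rightarrow> complex \<Rightarrow> complex \<Rightarrow> complex \<Rightarrow> complex \<Rightarrow> complex" where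
  "hypergeo r f m \<mu> a b z =
     (\<Sum>k. pochhammer a k * pochhammer b k * (\<Prod>j=1..r. pochhammer (f j + of_nat (m j)) k)
           / (pochhammer \<mu> k * (\<Prod>j=1..r. pochhammer (f j) k)) * (z ^ k / fact k))"

definition I_integrand ::
  "real \<Rightarrow> real \<Rightarrow> complex \<Rightarrow> complex \<Rightarrow> complex \<Rightarrow> nat \<Rightarrow> (nat \<Rightarrow> complex) \<Rightarrow> (nat \<Rightarrow> nat)
     \<Rightarrow> (real \<Rightarrow> complex) \<Rightarrow> real \<Rightarrow> real \<Rightarrow> complex" where
  "I_integrand h \<nu> \<mu> a b r f m \<phi> x t =
     of_real (x powr \<nu> - t powr \<nu>) powr (\<mu> - 1)
     * hypergeo r f m \<mu> a b (of_real (1 - t powr \<nu> / x powr \<nu>))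
     * \<phi> t * of_real (t powr (\<nu> * h + \<nu> - 1))"

definition frac_I ::
  "real \<Rightarrow> real \<Rightarrow> complex \<Rightarrow> complex \<Rightarrow> complex \<Rightarrow> complex \<Rightarrow> nat \<Rightarrow> (nat \<Rightarrow> complex) \<Rightarrow> (nat \<Rightarrow> nat)
     \<Rightarrow> (real \<Rightarrow> complex) \<Rightarrow> real \<Rightarrow> complex" where
  "frac_I h \<nu> \<mu> \<delta> a b r f m \<phi> x =
     of_real \<nu> * of_real x powr (- \<delta> - of_real \<nu> * (\<mu> + of_real h)) / Gamma \<mu>
     * (LINT t:{0<..<x}|lebesgue. I_integrand h \<nu> \<mu> a b r f m \<phi> x t)"

definition J_integrand ::
  "real \<Rightarrow> real \<Rightarrow> complex \<Rightarrow> complex \<Rightarrow> complex \<Rightarrow> complex \<Rightarrow> nat \<Rightarrow> (nat \<Rightarrow> complex) \<Rightarrow> (nat \<Rightarrow> nat)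
     \<Rightarrow> (real \<Rightarrow> complex) \<Rightarrow> real \<Rightarrow> real \<Rightarrow> complex" where
  "J_integrand h \<nu> \<mu> \<delta> a b r f m \<phi> x t =
     of_real (t powr \<nu> - x powr \<nu>) powr (\<mu> - 1)
     * hypergeo r f m \<mu> a b (of_real (1 - x powr \<nu> / t powr \<nu>))
     * \<phi> t * of_real t powr (- \<delta> - of_real \<nu> * (\<mu> + of_real h))"

definition frac_J ::
  "real \<Rightarrow> real \<Rightarrow> complex \<Rightarrow> complex \<Rightarrow> complex \<Rightarrow> complex \<Rightarrow> nat \<Rightarrow> (nat \<Rightarrow> complex) \<Rightarrow> (nat \<Rightarrow> nat)
     \<Rightarrow> (real \<Rightarrow> complex) \<Rightarrow> real \<Rightarrow> complex" where
  "frac_J h \<nu> \<mu> \<delta> a b r f m \<phi> x =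
     of_real \<nu> * of_real (x powr (\<nu> * h + \<nu> - 1)) / Gamma \<mu>
     * (LINT t:{x<..}|lebesgue. J_integrand h \<nu> \<mu> \<delta> a b r f m \<phi> x t)"

definition laplace_integrand :: "(real \<Rightarrow> complex) \<Rightarrow> complex \<Rightarrow> real \<Rightarrow> complex" where
  "laplace_integrand g s t = exp (- s * of_real t) * g t"

definition laplace :: "(real \<Rightarrow> complex) \<Rightarrow> complex \<Rightarrow> complex" where
  "laplace g s = (LINT t:{0<..}|lebesgue. laplace_integrand g s t)"

definition pow_exp :: "complex \<Rightarrow> complex \<Rightarrow> real \<Rightarrow> complex" where
  "pow_exp l s t = of_real t powr l * exp (- s * of_real t)"


section \<open>Auxiliary quantities\<close>

definition frak_c1 :: "real \<Rightarrow> real \<Rightarrow> complex \<Rightarrow> complex" where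
  "frak_c1 h \<nu> t = 1 + of_real h + t / of_real \<nu>"

definition frak_c2 :: "real \<Rightarrow> real \<Rightarrow> complex \<Rightarrow> complex \<Rightarrow> complex" where
  "frak_c2 h \<nu> \<delta> t = frak_c1 h \<nu> (\<delta> - 1) - t / of_real \<nu>"

definition frak_p :: "complex \<Rightarrow> complex \<Rightarrow> complex \<Rightarrow> nat \<Rightarrow> complex" where
  "frak_p \<mu> a b k = \<mu> - a - b - of_nat k"

definition msum :: "nat \<Rightarrow> (nat \<Rightarrow> nat) \<Rightarrow> nat" where
  "msum r m = (\<Sum>j=1..r. m j)"

definition sigma_poly :: "nat \<Rightarrow> (nat \<Rightarrow> complex) \<Rightarrow> (nat \<Rightarrow> nat) \<Rightarrow> complex poly" where
  "sigma_poly r f m = (\<Prod>j=1..r. pochhammer [:f j, 1:] (m j))"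

definition sigma :: "nat \<Rightarrow> (nat \<Rightarrow> complex) \<Rightarrow> (nat \<Rightarrow> nat) \<Rightarrow> nat \<Rightarrow> complex" where
  "sigma r f m i = coeff (sigma_poly r f m) (msum r m - i)"

definition A_coeff :: "nat \<Rightarrow> (nat \<Rightarrow> complex) \<Rightarrow> (nat \<Rightarrow> nat) \<Rightarrow> nat \<Rightarrow> complex" where
  "A_coeff r f m k = (\<Sum>j=k..msum r m. of_nat (Stirling j k) * sigma r f m (msum r m - j))"

lemma poly_pochhammer_linear: "poly (pochhammer [:c, 1:] n) x = pochhammer (c + x :: complex) n"
  by (simp add: pochhammer_prod poly_prod of_nat_poly algebra_simps)

lemma degree_sigma_poly: "degree (sigma_poly r f m) \<le> msum r m"
proof -
  have lin: "degree (pochhammer [:c, 1:] n) \<le> n" for c :: complex and n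
  proof -
    have "degree (pochhammer [:c, 1:] n) \<le> (\<Sum>i\<in>{0..<n}. degree ([:c, 1:] + of_nat i :: complex poly))"
      unfolding pochhammer_prod
      by (rule degree_prod_sum_le[unfolded comp_def]) simp
    also have "\<dots> \<le> (\<Sum>i\<in>{0..<n}. 1)"
      by (intro sum_mono) (simp add: of_nat_poly)
    finally show ?thesis by simp
  qed
  have "degree (sigma_poly r f m) \<le> (\<Sum>j=1..r. degree (pochhammer [:f j, 1:] (m j)))"
    unfolding sigma_poly_def by (rule degree_prod_sum_le[unfolded comp_def]) simp
  also have "\<dots> \<le> msum r m"
    unfolding msum_def by (intro sum_mono lin)
  finally show ?thesis .
qed

text \<open>The defining polynomial identity of the numbers \<open>\<sigma>\<^sub>0, \<dots>, \<sigma>\<^sub>m\<close>.\<close>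

lemma sigma_identity:
  "(\<Prod>j=1..r. pochhammer (f j + x) (m j)) = (\<Sum>j\<le>msum r m. sigma r f m (msum r m - j) * x ^ j)"
proof -
  have "(\<Prod>j=1..r. pochhammer (f j + x) (m j)) = poly (sigma_poly r f m) x"
    by (simp add: sigma_poly_def poly_prod poly_pochhammer_linear)
  also have "\<dots> = (\<Sum>j\<le>msum r m. coeff (sigma_poly r f m) j * x ^ j)"
    unfolding poly_altdef using degree_sigma_poly[of r f m]
    by (intro sum.mono_neutral_left) (auto simp: coeff_eq_0)
  also have "\<dots> = (\<Sum>j\<le>msum r m. sigma r f m (msum r m - j) * x ^ j)"
    by (intro sum.cong) (auto simp: sigma_def)
  finally show ?thesis .
qed


section \<open>Fox H-function\<close>

text \<open>\<open>up\<close> and \<open>lo\<close> are the lists of the pairs \<open>(a\<^sub>i, A\<^sub>i)\<close> and \<open>(b\<^sub>k, B\<^sub>k)\<close>, so that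
  \<open>p\<close> and \<open>q\<close> are their lengths.\<close>

definition foxH_integrand ::
  "nat \<Rightarrow> nat \<Rightarrow> (complex \<times> real) list \<Rightarrow> (complex \<times> real) list \<Rightarrow> complex \<Rightarrow> complex \<Rightarrow> complex" where
  "foxH_integrand M N up lo z w =
     ((\<Prod>(b, B)\<leftarrow>take M lo. Gamma (of_real B * w + b))
      * (\<Prod>(a, A)\<leftarrow>take N up. Gamma (1 - a - of_real A * w)))
     / ((\<Prod>(b, B)\<leftarrow>drop M lo. Gamma (1 - b - of_real B * w))
      * (\<Prod>(a, A)\<leftarrow>drop N up. Gamma (of_real A * w + a)))
     * z powr (- w)"

text \<open>A contour from \<open>c - \<i>\<infinity>\<close> to \<open>c + \<i>\<infinity>\<close>: a piecewise smooth curve that coincides with the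
  upward line \<open>Re w = c\<close> outside a compact part.\<close>

definition vertical_contour :: "real \<Rightarrow> (real \<Rightarrow> complex) \<Rightarrow> bool" where
  "vertical_contour c \<gamma> \<longleftrightarrow>
     (\<exists>T\<ge>0. \<gamma> piecewise_C1_differentiable_on {-T..T} \<and> (\<forall>t. T \<le> \<bar>t\<bar> \<longrightarrow> \<gamma> t = Complex c t))"

text \<open>The points to the left (right) of such a curve are those that can be joined, inside its
  complement, to the real numbers near \<open>-\<infinity>\<close> (\<open>+\<infinity>\<close>).\<close>

definition left_of :: "(real \<Rightarrow> complex) \<Rightarrow> complex set" where
  "left_of \<gamma> = {p. \<forall>\<^sub>F x in at_bot. connected_component (- range \<gamma>) p (of_real x)}"

definition right_of :: "(real \<Rightarrow> complex) \<Rightarrow> complex set" where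
  "right_of \<gamma> = {p. \<forall>\<^sub>F x in at_top. connected_component (- range \<gamma>) p (of_real x)}"

definition foxH_contour ::
  "nat \<Rightarrow> nat \<Rightarrow> (complex \<times> real) list \<Rightarrow> (complex \<times> real) list \<Rightarrow> (real \<Rightarrow> complex) \<Rightarrow> bool" where
  "foxH_contour M N up lo \<gamma> \<longleftrightarrow>
     (\<exists>c. vertical_contour c \<gamma>) \<and>
     (\<forall>(b, B)\<in>set (take M lo). {w. of_real B * w + b \<in> \<int>\<^sub>\<le>\<^sub>0} \<subseteq> left_of \<gamma>) \<and>
     (\<forall>(a, A)\<in>set (take N up). {w. 1 - a - of_real A * w \<in> \<int>\<^sub>\<le>\<^sub>0} \<subseteq> right_of \<gamma>)"

text \<open>The Henstock--Kurzweil integral over the whole line includes convergent improper integrals.\<close>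

definition has_foxH ::
  "nat \<Rightarrow> nat \<Rightarrow> (complex \<times> real) list \<Rightarrow> (complex \<times> real) list \<Rightarrow> complex \<Rightarrow> complex \<Rightarrow> bool" where
  "has_foxH M N up lo z v \<longleftrightarrow>
     (\<exists>\<gamma> I. foxH_contour M N up lo \<gamma> \<and>
        ((\<lambda>t. foxH_integrand M N up lo z (\<gamma> t) * vector_derivative \<gamma> (at t)) has_integral I) UNIV \<and>
        v = I / (2 * of_real pi * \<i>))"

text \<open>The definite description requires that all admissible contours give the same value.\<close>

definition foxH ::
  "nat \<Rightarrow> nat \<Rightarrow> (complex \<times> real) list \<Rightarrow> (complex \<times> real) list \<Rightarrow> complex \<Rightarrow> complex" where
  "foxH M N up lo z = (THE v. has_foxH M N up lo z v)"

end

theory Submission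
  imports Defs "HOL-Complex_Analysis.Complex_Analysis" "HOL-Real_Asymp.Real_Asymp"
begin

text \<open>Inserting the definition of the operator \<open>I\<close> into the Laplace integral gives a double integral
  over \<open>0 < t < x\<close>, and exchanging the order of integration produces the operator \<open>J\<close> applied to
  \<open>x\<^sup>l e\<^bsup>-sx\<^esup>\<close>. The exchange is legitimate because, by the substitution \<open>x = t u\<^bsup>-1/\<nu>\<^esup>\<close>, the inner
  integral of absolute values is at most a constant times \<open>\<bar>t\<^bsup>l-\<delta>\<^esup> \<phi>(t)\<bar>\<close>, the constant
  being, up to the factor \<open>1 / \<bar>\<Gamma>(\<mu>)\<bar>\<close>, the absolute Mellin moment at the exponent \<open>Re c\<^sub>2\<close> of
  \<open>\<Phi>(u) = (1 - u)\<^bsup>\<mu>-1\<^esup> F(1 - u)\<close> on \<open>(0, 1)\<close>. The hypothesis on \<open>c\<^sub>2\<close> makes this moment finite.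

  The same substitution writes the kernel \<open>J\<close> as \<open>x\<^bsup>l-\<delta>\<^esup> / \<Gamma>(\<mu>)\<close> times the integral over \<open>(0, 1)\<close> of
  \<open>\<Phi>(u) u\<^bsup>c\<^sub>2-1\<^esup> exp(- s x u\<^bsup>-1/\<nu>\<^esup>)\<close>. Replacing the exponential by its Cahen--Mellin integral
  \<open>e\<^bsup>-z\<^esup> = (2\<pi>i)\<^bsup>-1\<^esup> \<integral> \<Gamma>(w) z\<^bsup>-w\<^esup> dw\<close> and exchanging once more leaves the Mellin transform of \<open>\<Phi>\<close> at
  \<open>c\<^sub>2 + w/\<nu>\<close>. Integrated termwise it is a hypergeometric series at \<open>1\<close>; expanding the quotients
  \<open>(f\<^sub>j + m\<^sub>j)\<^sub>k / (f\<^sub>j)\<^sub>k\<close>, which are polynomials in \<open>k\<close>, in falling factorials of \<open>k\<close> brings in the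
  Stirling numbers and the \<open>A\<^sub>i\<close>, and each of the resulting series is summed by Gauss's theorem
  (\<open>mellin_kernel_transform\<close>). What remains are the integrals of the \<open>H\<close>-functions along the line
  \<open>Re w = 1/2\<close> (\<open>sum_foxH_eq\<close>).

  The value of an \<open>H\<close>-function is described by all admissible contours at once, so these have to
  agree (\<open>vertical_contour_integral_eq_line\<close>). The integrand decays exponentially in vertical strips
  since \<open>\<bar>arg z\<bar> < \<pi>/2\<close>, and all its poles can be joined to \<open>-\<infinity>\<close> off the contour. Hence the contour,
  closed up by a vertical line sufficiently far to the right, has winding number \<open>0\<close> about every
  pole, and the integral equals that along the line.

  The analytic input is elementary: Gauss's theorem comes from a contiguous relation that
  telescopes (\<open>gauss_summation\<close>), the complex Beta integral from Gauss's theorem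
  (\<open>Beta_integral_complex\<close>), the vertical decay of \<open>\<Gamma>\<close> from the reflection formula on \<open>Re w = 1/2\<close> and
  bounds on Beta values, and the Cahen--Mellin integral from moving the line of integration to the
  left across the poles of \<open>\<Gamma>\<close> (\<open>Cahen_Mellin\<close>).\<close>


section \<open>Asymptotics of Pochhammer symbols and Gauss's summation theorem\<close>

lemma Re_pos_not_nonpos_Int: "Re z > 0 \<Longrightarrow> z \<notin> \<int>\<^sub>\<le>\<^sub>0"
  by (auto elim!: nonpos_Ints_cases)

text \<open>Euler's limit \<open>(z)\<^bsub>n+1\<^esub> / (n! n\<^sup>z) \<longlonglongrightarrow> 1 / \<Gamma>(z)\<close>, shifted by one index; the factor \<open>Suc k\<close> instead of
  \<open>k\<close> keeps the quotient meaningful at \<open>k = 0\<close>, so that global bounds follow from the limit.\<close>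

lemma pochhammer_asymp:
  fixes z :: complex
  shows "(\<lambda>k. norm (pochhammer z k) / (fact k * real (Suc k) powr (Re z - 1))) \<longlonglongrightarrow> norm (rGamma z)"
proof -
  have "(\<lambda>n. norm (rGamma_series z n) * (real n powr Re z / (real (Suc n) * real (Suc (Suc n)) powr (Re z - 1))))
          \<longlonglongrightarrow> norm (rGamma z) * 1"
    by (intro tendsto_mult tendsto_norm rGamma_series_LIMSEQ) real_asymp
  moreover have "eventually (\<lambda>n. norm (rGamma_series z n) * (real n powr Re z / (real (Suc n) * real (Suc (Suc n)) powr (Re z - 1)))
     = norm (pochhammer z (Suc n)) / (fact (Suc n) * real (Suc (Suc n)) powr (Re z - 1))) sequentially"
    using eventually_gt_at_top[of 0]
  proof eventually_elim
    case (elim n)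
    have "norm (exp (z * of_real (ln (real n)))) = real n powr Re z"
      using elim by (simp add: norm_exp_eq_Re powr_def mult.commute)
    hence e: "norm (exp (z * complex_of_real (ln (real n)))) = real n powr Re z" by simp
    have "norm (rGamma_series z n) = norm (pochhammer z (Suc n)) / (fact n * real n powr Re z)"
      unfolding rGamma_series_def using e by (simp add: norm_divide norm_mult del: of_nat_Suc)
    thus ?case using elim
      by (simp add: divide_simps del: of_nat_Suc) (simp add: algebra_simps)
  qed
  ultimately have "(\<lambda>n. norm (pochhammer z (Suc n)) / (fact (Suc n) * real (Suc (Suc n)) powr (Re z - 1))) \<longlonglongrightarrow> norm (rGamma z)"
    unfolding mult_1_right by (rule Lim_transform_eventually)
  thus ?thesis by (subst (asm) filterlim_sequentially_Suc)
qed

definition gauss_term :: "complex \<Rightarrow> complex \<Rightarrow> complex \<Rightarrow> nat \<Rightarrow> complex" where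
  "gauss_term a b c k = pochhammer a k * pochhammer b k / (pochhammer c k * fact k)"

lemma gauss_term_bound:
  assumes "c \<notin> \<int>\<^sub>\<le>\<^sub>0"
  obtains K where "K > 0" "\<And>k. norm (gauss_term a b c k) \<le> K * real (Suc k) powr (Re (a + b - c) - 1)"
proof -
  define Q where "Q = (\<lambda>z k. norm (pochhammer z k) / (fact k * real (Suc k) powr (Re z - 1)))"
  have lim: "Q z \<longlonglongrightarrow> norm (rGamma z)" for z
    unfolding Q_def by (rule pochhammer_asymp)
  have "(\<lambda>k. Q a k * Q b k / Q c k) \<longlonglongrightarrow> norm (rGamma a) * norm (rGamma b) / norm (rGamma c)"
    using assms by (intro tendsto_intros lim) (auto simp: rGamma_eq_zero_iff)
  hence "Bseq (\<lambda>k. Q a k * Q b k / Q c k)"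
    by (intro convergent_imp_Bseq convergentI)
  then obtain K where K: "K > 0" "\<And>k. norm (Q a k * Q b k / Q c k) \<le> K"
    by (auto elim: BseqE)
  have "norm (gauss_term a b c k) \<le> K * real (Suc k) powr (Re (a + b - c) - 1)" for k
  proof -
    have "norm (gauss_term a b c k) = Q a k * Q b k / Q c k * real (Suc k) powr (Re (a + b - c) - 1)"
      by (simp add: gauss_term_def Q_def norm_mult norm_divide powr_diff powr_add field_simps del: of_nat_Suc)
    also have "\<dots> \<le> K * real (Suc k) powr (Re (a + b - c) - 1)"
      using order.trans[OF abs_ge_self K(2)[of k, unfolded real_norm_def]] by (intro mult_right_mono) auto
    finally show ?thesis .
  qed
  thus ?thesis using K that by blast
qed

lemma summable_Suc_powr: "s < -1 \<Longrightarrow> summable (\<lambda>k. real (Suc k) powr s)"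
  using summable_real_powr_iff[of s] by (subst summable_Suc_iff) auto

lemma summable_norm_gauss_term:
  assumes "c \<notin> \<int>\<^sub>\<le>\<^sub>0" "Re (c - a - b) > 0"
  shows "summable (\<lambda>k. norm (gauss_term a b c k))"
proof -
  obtain K where K: "K > 0" "\<And>k. norm (gauss_term a b c k) \<le> K * real (Suc k) powr (Re (a + b - c) - 1)"
    using gauss_term_bound[OF assms(1)] by blast
  have "summable (\<lambda>k. K * real (Suc k) powr (Re (a + b - c) - 1))"
    using assms by (intro summable_mult summable_Suc_powr) auto
  thus ?thesis
    by (rule summable_comparison_test') (use K in auto)
qed

text \<open>With \<open>t\<^sub>k(c)\<close> for the terms, the difference \<open>c (c - a - b) t\<^sub>k(c) - (c - a) (c - b) t\<^sub>k(c + 1)\<close> is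
  \<open>- c ((k + 1) t\<^bsub>k+1\<^esub>(c) - k t\<^sub>k(c))\<close>, which telescopes; the boundary term vanishes because
  \<open>k t\<^sub>k(c)\<close> has at most the size \<open>k\<^bsup>Re (a+b-c)\<^esup>\<close>.\<close>

lemma gauss_contiguous:
  assumes "c \<notin> \<int>\<^sub>\<le>\<^sub>0" "Re (c - a - b) > 0"
  shows "c * (c - a - b) * (\<Sum>k. gauss_term a b c k) = (c - a) * (c - b) * (\<Sum>k. gauss_term a b (c + 1) k)"
proof -
  have c1: "c + 1 \<notin> \<int>\<^sub>\<le>\<^sub>0"
    using assms(1) by (metis Ints_1 add_diff_cancel_right' plus_one_in_nonpos_Ints_imp)
  let ?t = "gauss_term a b c"
  have s0: "summable ?t"
    using summable_norm_gauss_term[OF assms] summable_norm_cancel by blast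
  have s1: "summable (gauss_term a b (c+1))"
    using assms by (intro summable_norm_cancel[OF summable_norm_gauss_term] c1) auto
  have nz: "c + of_nat k \<noteq> 0" for k
    using assms(1) by (auto simp flip: eq_neg_iff_add_eq_0)
  have pz: "pochhammer c k \<noteq> 0" for k
    using assms(1) pochhammer_eq_0_imp_nonpos_Int by blast
  have step: "c * (c - a - b) * ?t k - (c - a) * (c - b) * gauss_term a b (c+1) k
      = - c * of_nat (Suc k) * ?t (Suc k) - (- c * of_nat k * ?t k)" for k
  proof -
    have p1: "pochhammer (c+1) k = pochhammer c k * (c + of_nat k) / c"
      using nz[of 0] pochhammer_rec[of c k] by (simp add: pochhammer_Suc field_simps)
    have t1: "gauss_term a b (c+1) k = ?t k * c / (c + of_nat k)"
      using nz[of 0] nz[of k] pz[of k] by (simp add: gauss_term_def p1)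
    have t2: "of_nat (Suc k) * ?t (Suc k) = ?t k * (a + of_nat k) * (b + of_nat k) / (c + of_nat k)"
    proof -
      have "n * (p * x * (q * y) / (r * z * (n * F))) = p * q / (r * F) * x * y / z"
        if "n \<noteq> 0" for n p q r x y z F :: complex
        using that by (simp add: mult_ac)
      from this[of "of_nat (Suc k)"] show ?thesis
        unfolding gauss_term_def pochhammer_Suc fact_Suc by (simp only: of_nat_neq_0 simp_thms)
    qed
    have "- c * of_nat (Suc k) * ?t (Suc k) - (- c * of_nat k * ?t k)
        = - c * (of_nat (Suc k) * ?t (Suc k)) + c * of_nat k * ?t k" by simp
    also have "\<dots> = - c * (?t k * (a + of_nat k) * (b + of_nat k) / (c + of_nat k)) + c * of_nat k * ?t k"
      by (simp only: t2)
    finally show ?thesis unfolding t1 using nz[of k] by (simp add: field_simps)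
  qed
  obtain K where K: "K > 0" "\<And>k. norm (?t k) \<le> K * real (Suc k) powr (Re (a + b - c) - 1)"
    using gauss_term_bound[OF assms(1)] by blast
  have lim: "(\<lambda>k. - c * of_nat k * ?t k) \<longlonglongrightarrow> 0"
  proof (rule Lim_null_comparison)
    have "Re (a + b - c) < 0" using assms by simp
    hence "(\<lambda>k. real (Suc k) powr (Re (a + b - c))) \<longlonglongrightarrow> 0" by real_asymp
    thus "(\<lambda>k. norm c * K * real (Suc k) powr (Re (a + b - c))) \<longlonglongrightarrow> 0"
      by (rule tendsto_mult_right_zero)
    have "norm (- c * of_nat k * ?t k) \<le> norm c * K * real (Suc k) powr (Re (a + b - c))" for k
    proof -
      have "norm (- c * of_nat k * ?t k) = norm c * (real k * norm (?t k))" by (simp add: norm_mult)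
      also have "\<dots> \<le> norm c * (real (Suc k) * (K * real (Suc k) powr (Re (a + b - c) - 1)))"
        by (intro mult_left_mono mult_mono K) auto
      also have "\<dots> = norm c * K * real (Suc k) powr (Re (a + b - c))"
        by (simp add: powr_diff del: of_nat_Suc)
      finally show ?thesis .
    qed
    thus "\<forall>\<^sub>F k in sequentially. norm (- c * of_nat k * ?t k) \<le> norm c * K * real (Suc k) powr (Re (a + b - c))"
      by simp
  qed
  have "(\<lambda>k. c * (c - a - b) * ?t k - (c - a) * (c - b) * gauss_term a b (c+1) k)
      sums (c * (c - a - b) * suminf ?t - (c - a) * (c - b) * suminf (gauss_term a b (c+1)))"
    by (intro sums_diff sums_mult summable_sums s0 s1)
  moreover have "(\<lambda>k. c * (c - a - b) * ?t k - (c - a) * (c - b) * gauss_term a b (c+1) k) sums 0"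
    using telescope_sums[OF lim] unfolding step by (simp del: of_nat_Suc)
  ultimately show ?thesis using sums_unique2 by fastforce
qed

text \<open>Tannery's theorem: only the term \<open>k = 0\<close> survives. A series with real lower parameter
  \<open>Re c + N \<ge> 1\<close> dominates all later ones, as its Pochhammer symbols are smaller in modulus.\<close>

lemma gauss_tendsto_1:
  assumes "c \<notin> \<int>\<^sub>\<le>\<^sub>0" "Re (c - a - b) > 0"
  shows "(\<lambda>n. \<Sum>k. gauss_term a b (c + of_nat n) k) \<longlonglongrightarrow> 1"
proof -
  define N where "N = nat \<lceil>max 0 (1 - Re c)\<rceil> + nat \<lceil>max 0 (Re (a + b - c)) + 1\<rceil>"
  have N: "Re c + real N \<ge> 1" "Re c + real N > Re (a + b)"
    unfolding N_def using assms by (auto simp: max_def) linarith+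
  define d where "d = complex_of_real (Re c + real N)"
  have d: "d \<notin> \<int>\<^sub>\<le>\<^sub>0" "Re (d - a - b) > 0"
    using N by (auto simp: d_def intro!: Re_pos_not_nonpos_Int)
  have cmp: "norm (gauss_term a b (c + of_nat n) k) \<le> norm (gauss_term a b d k)" if "n \<ge> N" for n k
  proof -
    have "norm (pochhammer d k) \<le> norm (pochhammer (c + of_nat n) k)"
      unfolding pochhammer_prod prod_norm[symmetric]
    proof (intro prod_mono conjI)
      fix i assume "i \<in> {0..<k}"
      have "norm (d + of_nat i) = Re c + real N + real i"
        using N unfolding d_def by (metis abs_of_nonneg add_nonneg_nonneg dual_order.trans norm_of_real of_nat_0_le_iff of_real_add of_real_of_nat_eq zero_le_one)
      also have "\<dots> \<le> Re (c + of_nat n + of_nat i)" using that by simp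
      also have "\<dots> \<le> norm (c + of_nat n + of_nat i)" by (rule complex_Re_le_cmod)
      finally show "norm (d + of_nat i) \<le> norm (c + of_nat n + of_nat i)" .
    qed auto
    moreover have "pochhammer d k \<noteq> 0" using d pochhammer_eq_0_imp_nonpos_Int by blast
    ultimately show ?thesis unfolding gauss_term_def norm_divide norm_mult
      by (intro divide_left_mono mult_right_mono mult_pos_pos) auto
  qed
  have sd: "summable (\<lambda>k. norm (gauss_term a b d k))"
    using summable_norm_gauss_term[OF d] .
  have lim: "(\<lambda>n. gauss_term a b (c + of_nat n) k) \<longlonglongrightarrow> (if k = 0 then 1 else 0)" for k
  proof (cases "k = 0")
    case True thus ?thesis by (simp add: gauss_term_def)
  next
    case False
    have inf: "filterlim (\<lambda>n. pochhammer (c + of_nat n) k) at_infinity sequentially"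
    proof (rule filterlim_norm_at_top_imp_at_infinity)
      show "filterlim (\<lambda>n. norm (pochhammer (c + of_nat n) k)) at_top sequentially"
      proof (rule filterlim_at_top_mono)
        show "filterlim (\<lambda>n. real n + Re c) at_top sequentially" by real_asymp
        have "norm (pochhammer (c + of_nat n) k) \<ge> real n + Re c" if "n \<ge> N" for n
        proof -
          have g: "norm (c + of_nat n + of_nat i) \<ge> Re c + real n" for i
            using complex_Re_le_cmod[of "c + of_nat n + of_nat i"] by simp
          have "(\<Prod>i\<in>{0..<k}. if i = 0 then Re c + real n else 1) \<le> norm (pochhammer (c + of_nat n) k)"
            unfolding pochhammer_prod prod_norm[symmetric]
            by (intro prod_mono conjI) (use that N g g[of 0, simplified] in \<open>auto intro: order.trans[OF _ g]\<close>)
          thus ?thesis using False by (simp add: prod.delta add.commute)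
        qed
        thus "\<forall>\<^sub>F n in sequentially. real n + Re c \<le> norm (pochhammer (c + of_nat n) k)"
          by (rule eventually_mono[OF eventually_ge_at_top[of N]])
      qed
    qed
    have "(\<lambda>n. pochhammer a k * pochhammer b k / fact k * inverse (pochhammer (c + of_nat n) k)) \<longlonglongrightarrow> pochhammer a k * pochhammer b k / fact k * 0"
      by (intro tendsto_mult tendsto_const filterlim_compose[OF tendsto_inverse_0 inf])
    thus ?thesis using False by (simp add: gauss_term_def field_simps)
  qed
  have "(\<lambda>n. \<Sum>k. gauss_term a b (c + of_nat n) k) \<longlonglongrightarrow> (\<Sum>k. if k = 0 then 1 else 0)"
    by (rule tannerys_theorem[OF lim _ sd, THEN conjunct2, THEN conjunct2])
       (use cmp in \<open>auto intro!: eventually_mono[OF eventually_prodI[OF always_eventually[of "\<lambda>_. True"] eventually_ge_at_top[of N]]]\<close>)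
  also have "(\<Sum>k. if k = 0 then 1 else 0) = (1::complex)"
    using suminf_finite[of "{0::nat}" "\<lambda>k. if k = 0 then 1 else (0::complex)"] by simp
  finally show ?thesis .
qed

text \<open>Iterating the contiguous relation \<open>n\<close> times and letting \<open>n\<close> tend to infinity, the accumulated
  quotient of Pochhammer symbols becomes a quotient of Euler's limits for \<open>1/\<Gamma>\<close>, in which the powers
  of \<open>n\<close> cancel. The reciprocal Gamma functions cover the case that \<open>c - a\<close> or \<open>c - b\<close> is a pole.\<close>

theorem gauss_summation:
  assumes "c \<notin> \<int>\<^sub>\<le>\<^sub>0" "Re (c - a - b) > 0"
  shows "gauss_term a b c sums (Gamma c * Gamma (c - a - b) * rGamma (c - a) * rGamma (c - b))"
proof -
  define S where "S = (\<lambda>c. \<Sum>k. gauss_term a b c k)"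
  have iter: "S c * (pochhammer c n * pochhammer (c - a - b) n)
      = pochhammer (c - a) n * pochhammer (c - b) n * S (c + of_nat n)" for n
  proof (induction n)
    case (Suc n)
    have "c + of_nat n \<notin> \<int>\<^sub>\<le>\<^sub>0"
    proof
      assume "c + of_nat n \<in> \<int>\<^sub>\<le>\<^sub>0"
      then obtain j where "c + of_nat n = of_int j" "j \<le> 0" by (auto elim!: nonpos_Ints_cases)
      hence "c = of_int (j - int n)" "j - int n \<le> 0" by (auto simp: algebra_simps)
      thus False using assms(1) by (metis nonpos_Ints_of_int)
    qed
    hence "(c + of_nat n) * (c + of_nat n - a - b) * S (c + of_nat n)
        = (c + of_nat n - a) * (c + of_nat n - b) * S (c + of_nat (Suc n))"
      using gauss_contiguous[of "c + of_nat n" a b] assms by (simp add: S_def add_ac)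
    hence st: "(c + of_nat n) * (c - a - b + of_nat n) * S (c + of_nat n)
        = (c - a + of_nat n) * (c - b + of_nat n) * S (c + of_nat (Suc n))"
      by (simp only: diff_add_eq)
    have "S c * (pochhammer c (Suc n) * pochhammer (c - a - b) (Suc n))
        = (S c * (pochhammer c n * pochhammer (c - a - b) n)) * ((c + of_nat n) * (c - a - b + of_nat n))"
      by (simp only: pochhammer_Suc mult_ac)
    also have "\<dots> = pochhammer (c - a) n * pochhammer (c - b) n * ((c + of_nat n) * (c - a - b + of_nat n) * S (c + of_nat n))"
      unfolding Suc by (simp only: mult_ac)
    also have "\<dots> = pochhammer (c - a) (Suc n) * pochhammer (c - b) (Suc n) * S (c + of_nat (Suc n))"
      unfolding st by (simp only: pochhammer_Suc mult_ac)
    finally show ?case .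
  qed simp
  have nz: "pochhammer c n \<noteq> 0" "pochhammer (c - a - b) n \<noteq> 0" for n
    using assms Re_pos_not_nonpos_Int pochhammer_eq_0_imp_nonpos_Int by blast+
  define X where "X = (\<lambda>n. rGamma_series (c - a) n * rGamma_series (c - b) n
                         / (rGamma_series c n * rGamma_series (c - a - b) n) * S (c + of_nat (Suc n)))"
  have "X \<longlonglongrightarrow> rGamma (c - a) * rGamma (c - b) / (rGamma c * rGamma (c - a - b)) * 1"
    unfolding X_def S_def using assms Re_pos_not_nonpos_Int[OF assms(2)]
    by (intro tendsto_intros filterlim_compose[OF gauss_tendsto_1 filterlim_Suc])
       (auto simp: rGamma_eq_zero_iff)
  moreover have "X n = S c" for n
  proof -
    have cancel: "(p / (f * e1)) * (q / (f * e2)) / ((r / (f * e3)) * (s / (f * e4))) = p * q / (r * s)"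
      if "e1 * e2 = e3 * e4" "e1 \<noteq> 0" "e2 \<noteq> 0" "e3 \<noteq> 0" "e4 \<noteq> 0" "f \<noteq> 0" for p q r s e1 e2 e3 e4 f :: complex
    proof -
      have "(p / (f * e1)) * (q / (f * e2)) / ((r / (f * e3)) * (s / (f * e4)))
          = (p * q / (f * f * (e1 * e2))) / (r * s / (f * f * (e3 * e4)))" by (simp add: mult_ac)
      thus ?thesis using that by simp
    qed
    have "exp ((c - a) * of_real (ln (real n))) * exp ((c - b) * of_real (ln (real n)))
       = exp (c * of_real (ln (real n))) * exp ((c - a - b) * of_real (ln (real n)))"
      by (simp add: exp_add[symmetric] algebra_simps)
    hence "rGamma_series (c - a) n * rGamma_series (c - b) n / (rGamma_series c n * rGamma_series (c - a - b) n)
       = pochhammer (c - a) (Suc n) * pochhammer (c - b) (Suc n) / (pochhammer c (Suc n) * pochhammer (c - a - b) (Suc n))"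
      unfolding rGamma_series_def Suc_eq_plus1 by (intro cancel) auto
    thus ?thesis unfolding X_def using iter[of "Suc n"] nz[of "Suc n"]
      by (simp add: nonzero_divide_eq_eq)
  qed
  hence "X = (\<lambda>_. S c)" by (rule ext)
  ultimately have "(\<lambda>_. S c) \<longlonglongrightarrow> rGamma (c - a) * rGamma (c - b) / (rGamma c * rGamma (c - a - b)) * 1"
    by simp
  hence "S c = rGamma (c - a) * rGamma (c - b) / (rGamma c * rGamma (c - a - b))"
    by (simp add: LIMSEQ_const_iff)
  hence "S c = Gamma c * Gamma (c - a - b) * rGamma (c - a) * rGamma (c - b)"
    by (simp add: Gamma_def divide_simps)
  thus ?thesis
    using summable_norm_cancel[OF summable_norm_gauss_term[OF assms]] by (simp add: S_def sums_iff)
qed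

section \<open>The complex Beta integral\<close>

lemma measurable_ident_lebesgue [measurable]: "(\<lambda>x. x) \<in> borel_measurable lebesgue"
  by (rule measurable_completion) simp

lemma of_real_powr_pos: "t > 0 \<Longrightarrow> complex_of_real t powr a = exp (a * of_real (ln t))"
  by (simp add: powr_def Ln_of_real)

lemma norm_of_real_powr: "t > 0 \<Longrightarrow> norm (complex_of_real t powr a) = t powr Re a"
  by (simp add: norm_powr_real_powr)

lemma borel_measurable_of_real_powr [measurable (raw)]:
  assumes [measurable]: "f \<in> borel_measurable M"
  shows "(\<lambda>x. complex_of_real (f x) powr a) \<in> borel_measurable M"
proof -
  have eq: "complex_of_real t powr a = (if t = 0 then 0 else if t > 0 then exp (a * of_real (ln t))
     else exp (a * (of_real (ln (- t)) + \<i> * of_real pi)))" for t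
  proof -
    have "Ln (complex_of_real t) = of_real (ln (- t)) + \<i> * of_real pi" if "t < 0"
      using that Ln_of_real[of "- t"] Ln_minus[of "complex_of_real (- t)"] by (simp add: algebra_simps)
    thus ?thesis by (auto simp: powr_def Ln_of_real)
  qed
  show ?thesis unfolding eq by measurable
qed

lemma
  assumes "x > (0::real)"
  shows set_integrable_powr_01: "set_integrable lebesgue {0<..<1} (\<lambda>t. t powr (x - 1))"
    and set_integral_powr_01: "(LINT t:{0<..<1}|lebesgue. t powr (x - 1)) = 1 / x"
proof -
  have h: "((\<lambda>t. t powr (x - 1)) has_integral 1 / x) {0<..<1::real}"
    using has_integral_powr_from_0[of "x - 1" 1] assms by (simp add: has_integral_Icc_iff_Ioo)
  thus s: "set_integrable lebesgue {0<..<1} (\<lambda>t. t powr (x - 1))"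
    by (subst absolutely_integrable_on_iff_nonneg) (auto simp: integrable_on_def)
  show "(LINT t:{0<..<1}|lebesgue. t powr (x - 1)) = 1 / x"
    using set_lebesgue_integral_eq_integral(2)[OF s] h by (simp add: integral_unique)
qed

lemma
  assumes "Re a > 0"
  shows set_integrable_cpowr_01: "set_integrable lebesgue {0<..<1} (\<lambda>t. complex_of_real t powr (a - 1))"
    and set_integral_cpowr_01: "(LINT t:{0<..<1}|lebesgue. complex_of_real t powr (a - 1)) = 1 / a"
proof -
  show s: "set_integrable lebesgue {0<..<1} (\<lambda>t. complex_of_real t powr (a - 1))"
    by (rule set_integrable_bound[OF set_integrable_powr_01[OF assms]])
       (auto simp: set_borel_measurable_def norm_of_real_powr)
  have "((\<lambda>t. complex_of_real t powr (a - 1)) has_integral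
          (of_real 1 powr a / a - of_real 0 powr a / a)) {0..1}" using assms
    by (intro fundamental_theorem_of_calculus_interior)
       (auto intro!: continuous_intros derivative_eq_intros has_vector_derivative_real_field)
  hence "((\<lambda>t. complex_of_real t powr (a - 1)) has_integral 1 / a) {0<..<1}"
    by (simp add: has_integral_Icc_iff_Ioo)
  thus "(LINT t:{0<..<1}|lebesgue. complex_of_real t powr (a - 1)) = 1 / a"
    using set_lebesgue_integral_eq_integral(2)[OF s] by (simp add: integral_unique)
qed

lemma binomial_series_powr:
  assumes "0 < t" "t < 1"
  shows "(\<lambda>k. pochhammer (1 - b) k / fact k * of_real t ^ k) sums (complex_of_real (1 - t) powr (b - 1))"
proof -
  have "(\<lambda>k. ((b - 1) gchoose k) * (- of_real t) ^ k) sums ((1 + (- of_real t)) powr (b - 1))"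
    using assms by (intro gen_binomial_complex) auto
  moreover have "((b - 1) gchoose k) * (- of_real t) ^ k = pochhammer (1 - b) k / fact k * of_real t ^ k" for k
    by (simp add: gbinomial_pochhammer power_mult_distrib[symmetric] flip: mult.assoc)
  ultimately show ?thesis by simp
qed

lemma set_integral_sums:
  fixes f :: "nat \<Rightarrow> real \<Rightarrow> complex"
  assumes "\<And>k. set_integrable lebesgue S (f k)"
    and "\<And>x. x \<in> S \<Longrightarrow> summable (\<lambda>k. norm (f k x))"
    and "summable (\<lambda>k. LINT x:S|lebesgue. norm (f k x))"
  shows "set_integrable lebesgue S (\<lambda>x. \<Sum>k. f k x)"
    and "(\<lambda>k. LINT x:S|lebesgue. f k x) sums (LINT x:S|lebesgue. (\<Sum>k. f k x))"
proof -
  have eq: "(\<lambda>x. indicator S x *\<^sub>R (\<Sum>k. f k x)) = (\<lambda>x. \<Sum>k. indicator S x *\<^sub>R f k x)"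
    by (auto simp: indicator_def)
  have s: "AE x in lebesgue. summable (\<lambda>k. norm (indicator S x *\<^sub>R f k x))"
    using assms(2) by (intro AE_I2) (auto simp: indicator_def)
  have i: "summable (\<lambda>k. \<integral>x. norm (indicator S x *\<^sub>R f k x) \<partial>lebesgue)"
    using assms(3) by (simp add: set_lebesgue_integral_def)
  show "set_integrable lebesgue S (\<lambda>x. \<Sum>k. f k x)"
    unfolding set_integrable_def eq
    by (rule integrable_suminf[OF assms(1)[unfolded set_integrable_def] s i])
  show "(\<lambda>k. LINT x:S|lebesgue. f k x) sums (LINT x:S|lebesgue. (\<Sum>k. f k x))"
    unfolding set_lebesgue_integral_def eq
    by (rule sums_integral[OF assms(1)[unfolded set_integrable_def] s i])
qed

text \<open>Expanding \<open>(1 - t)\<^bsup>b-1\<^esup>\<close> binomially and integrating termwise gives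
  \<open>\<Sum>\<^sub>k (1 - b)\<^sub>k / (k! (a + k))\<close>, which is \<open>1/a\<close> times the Gauss series with parameters
  \<open>a\<close>, \<open>1 - b\<close> and \<open>a + 1\<close>.\<close>

theorem Beta_integral_complex:
  assumes a: "Re a > 0" and b: "Re b > 0"
  shows "set_integrable lebesgue {0<..<1} (\<lambda>t. complex_of_real t powr (a - 1) * complex_of_real (1 - t) powr (b - 1))"
    and "(LINT t:{0<..<1}|lebesgue. complex_of_real t powr (a - 1) * complex_of_real (1 - t) powr (b - 1)) = Beta a b"
proof -
  define c where "c = (\<lambda>k. pochhammer (1 - b) k / fact k)"
  define f where "f = (\<lambda>k t. c k * (complex_of_real t powr (a + of_nat k - 1)))"
  have ak: "Re (a + of_nat k) > 0" for k using a by simp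
  have f_eq: "f k t = complex_of_real t powr (a - 1) * (c k * of_real t ^ k)" if "t > 0" for k t
    using that by (simp add: f_def powr_add powr_diff powr_nat' flip: powr_nat)
  have int: "set_integrable lebesgue {0<..<1} (f k)" for k
    unfolding f_def by (intro set_integrable_mult_right set_integrable_cpowr_01 ak)
  have sums: "(\<lambda>k. c k * of_real t ^ k) sums (complex_of_real (1 - t) powr (b - 1))" if "t \<in> {0<..<1}" for t
    using that unfolding c_def by (intro binomial_series_powr) auto
  have abs: "summable (\<lambda>k. norm (f k t))" if "t \<in> {0<..<1}" for t
  proof -
    \<comment> \<open>a point of convergence strictly beyond \<open>t\<close>, where the series therefore converges absolutely\<close>
    define u where "u = (1 + t) / 2"
    have "summable (\<lambda>k. c k * of_real u ^ k)"
      using sums[of u] that by (auto simp: u_def sums_iff)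
    hence "summable (\<lambda>k. norm (c k * of_real t ^ k))"
      using that by (intro powser_insidea) (auto simp: u_def simp del: of_real_add of_real_divide)
    hence "summable (\<lambda>k. norm (complex_of_real t powr (a - 1)) * norm (c k * of_real t ^ k))"
      by (rule summable_mult)
    thus ?thesis using that by (simp add: f_eq norm_mult)
  qed
  have nint: "(LINT t:{0<..<1}|lebesgue. norm (f k t)) = norm (c k) / (Re a + real k)" for k
  proof -
    have "(LINT t:{0<..<1}|lebesgue. norm (f k t)) = (LINT t:{0<..<1}|lebesgue. norm (c k) * t powr (Re a + real k - 1))"
      by (intro set_lebesgue_integral_cong) (auto simp: f_def norm_mult norm_of_real_powr)
    also have "\<dots> = norm (c k) * (LINT t:{0<..<1}|lebesgue. t powr (Re a + real k - 1))"
      by simp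
    also have "\<dots> = norm (c k) / (Re a + real k)"
      using a by (subst set_integral_powr_01) auto
    finally show ?thesis .
  qed
  have a1: "a + 1 \<notin> \<int>\<^sub>\<le>\<^sub>0" "a \<notin> \<int>\<^sub>\<le>\<^sub>0" "b \<notin> \<int>\<^sub>\<le>\<^sub>0" using a b by (auto intro!: Re_pos_not_nonpos_Int)
  have ak0: "a + of_nat k \<noteq> 0" for k
    using ak[of k] by (metis less_irrefl zero_complex.sel(1))
  have g: "gauss_term a (1 - b) (a + 1) k = a * (c k / (a + of_nat k))" for k
  proof -
    have nz: "pochhammer (a + 1) k \<noteq> 0" "a \<noteq> 0" "a + of_nat k \<noteq> 0"
      using a1(1) pochhammer_eq_0_imp_nonpos_Int apply blast
      using a ak0 by force+
    have "pochhammer a k * (a + of_nat k) = a * pochhammer (a + 1) k"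
      by (metis pochhammer_Suc pochhammer_rec)
    thus ?thesis using nz unfolding gauss_term_def c_def
      by (simp add: divide_simps)
  qed
  have Rg: "Re (a + 1 - a - (1 - b)) > 0" using b by simp
  have sn: "summable (\<lambda>k. LINT t:{0<..<1}|lebesgue. norm (f k t))"
    unfolding nint
  proof (rule summable_comparison_test')
    \<comment> \<open>\<open>\<bar>a + k\<bar> \<le> (1 + \<bar>Im a\<bar> / Re a) (Re a + k)\<close> compares the integrated norms with Gauss terms\<close>
    define L where "L = (1 + \<bar>Im a\<bar> / Re a) / norm a"
    show "summable (\<lambda>k. L * norm (gauss_term a (1 - b) (a + 1) k))"
      by (intro summable_mult summable_norm_gauss_term a1 Rg)
    show "norm (norm (c k) / (Re a + real k)) \<le> L * norm (gauss_term a (1 - b) (a + 1) k)" for k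
    proof -
      have na: "norm a > 0" "norm (a + of_nat k) > 0" using a ak0[of k] by auto
      have "norm (a + of_nat k) \<le> \<bar>Re a + real k\<bar> + \<bar>Im a\<bar>"
        using cmod_le[of "a + of_nat k"] by simp
      also have "\<dots> \<le> (1 + \<bar>Im a\<bar> / Re a) * (Re a + real k)"
      proof -
        have "\<bar>Im a\<bar> / Re a * Re a \<le> \<bar>Im a\<bar> / Re a * (Re a + real k)"
          using a by (intro mult_left_mono) auto
        thus ?thesis using a by (simp add: distrib_right)
      qed
      finally have "norm (a + of_nat k) / (Re a + real k) \<le> 1 + \<bar>Im a\<bar> / Re a"
        using a by (subst pos_divide_le_eq) auto
      hence "norm (c k) / norm (a + of_nat k) * (norm (a + of_nat k) / (Re a + real k))
           \<le> norm (c k) / norm (a + of_nat k) * (1 + \<bar>Im a\<bar> / Re a)"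
        by (rule mult_left_mono) auto
      thus ?thesis using na a by (simp add: g L_def norm_mult norm_divide mult_ac)
    qed
  qed
  have ev: "set_integrable lebesgue {0<..<1} (\<lambda>x. \<Sum>k. f k x)"
    "(\<lambda>k. LINT x:{0<..<1}|lebesgue. f k x) sums (LINT x:{0<..<1}|lebesgue. (\<Sum>k. f k x))"
    by (rule set_integral_sums[OF int abs sn]; simp)+
  have fs: "(\<Sum>k. f k t) = complex_of_real t powr (a - 1) * complex_of_real (1 - t) powr (b - 1)"
    if "t \<in> {0<..<1}" for t
    using sums_mult[OF sums[OF that], of "complex_of_real t powr (a - 1)"] that
    by (simp add: f_eq sums_iff)
  show "set_integrable lebesgue {0<..<1} (\<lambda>t. complex_of_real t powr (a - 1) * complex_of_real (1 - t) powr (b - 1))"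
    using ev(1) by (rule set_integrable_cong[THEN iffD1, rotated -1]) (auto simp: fs)
  have "(\<lambda>k. LINT x:{0<..<1}|lebesgue. f k x) = (\<lambda>k. c k / (a + of_nat k))"
  proof
    fix k show "(LINT x:{0<..<1}|lebesgue. f k x) = c k / (a + of_nat k)"
      unfolding f_def using set_integral_cpowr_01[OF ak[of k]] by simp
  qed
  moreover have "(\<lambda>k. c k / (a + of_nat k)) sums (Beta a b)"
  proof -
    have "gauss_term a (1 - b) (a + 1) sums (a * Beta a b)"
      using gauss_summation[OF a1(1) Rg] a1 Gamma_plus1[of a]
      by (simp add: Beta_altdef algebra_simps)
    hence "(\<lambda>k. a * (c k / (a + of_nat k))) sums (a * Beta a b)"
      by (simp add: g[abs_def])
    thus ?thesis using a1 by (subst (asm) sums_mult_iff) auto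
  qed
  ultimately have "(LINT x:{0<..<1}|lebesgue. (\<Sum>k. f k x)) = Beta a b"
    using ev(2) sums_unique2 by metis
  moreover have "(LINT x:{0<..<1}|lebesgue. (\<Sum>k. f k x)) =
     (LINT t:{0<..<1}|lebesgue. complex_of_real t powr (a - 1) * complex_of_real (1 - t) powr (b - 1))"
    by (intro set_lebesgue_integral_cong) (auto simp: fs)
  ultimately show "(LINT t:{0<..<1}|lebesgue. complex_of_real t powr (a - 1) * complex_of_real (1 - t) powr (b - 1)) = Beta a b"
    by simp
qed

section \<open>Growth of the Gamma function in vertical strips\<close>

lemma norm_Beta_le:
  assumes "Re u > 0" "Re d > 0"
  shows "norm (Beta u d) \<le> Beta (Re u) (Re d)"
proof -
  let ?f = "\<lambda>t. complex_of_real t powr (u - 1) * complex_of_real (1 - t) powr (d - 1)"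
  have h: "((\<lambda>t. t powr (Re u - 1) * (1 - t) powr (Re d - 1)) has_integral Beta (Re u) (Re d)) {0<..<1}"
    using has_integral_Beta_real[OF assms] by (simp add: has_integral_Icc_iff_Ioo)
  have "norm (LINT t:{0<..<1}|lebesgue. ?f t) \<le> (LINT t:{0<..<1}|lebesgue. norm (?f t))"
    by (intro set_integral_norm_bound Beta_integral_complex assms)
  also have "\<dots> = (LINT t:{0<..<1}|lebesgue. t powr (Re u - 1) * (1 - t) powr (Re d - 1))"
    by (intro set_lebesgue_integral_cong) (auto simp: norm_mult norm_of_real_powr simp del: of_real_diff)
  also have "\<dots> = Beta (Re u) (Re d)"
  proof -
    have "set_integrable lebesgue {0<..<1} (\<lambda>t. t powr (Re u - 1) * (1 - t) powr (Re d - 1))"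
      by (subst absolutely_integrable_on_iff_nonneg) (use h in \<open>auto simp: integrable_on_def\<close>)
    from set_lebesgue_integral_eq_integral(2)[OF this] h show ?thesis by (simp add: integral_unique)
  qed
  finally show ?thesis using Beta_integral_complex(2)[OF assms] by simp
qed

text \<open>The left-hand side is \<open>\<bar>B(u, d)\<bar> / \<bar>\<Gamma>(d)\<bar>\<close>, and \<open>\<bar>B(u, d)\<bar> \<le> B(Re u, Re d) \<le> B(1, 1) = 1\<close>.\<close>

lemma norm_Gamma_ratio_le:
  assumes "Re u \<ge> 1" "Re d \<ge> 1"
  shows "norm (Gamma u * rGamma (u + d)) \<le> norm (rGamma d)"
proof -
  have "norm (Beta u d) \<le> Beta (Re u) (Re d)" using assms by (intro norm_Beta_le) auto
  also have "\<dots> \<le> Beta 1 1" using assms by (intro Beta_real_mono) auto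
  also have "\<dots> = (1::real)" by (simp add: Beta_def Gamma_numeral)
  finally have *: "norm (Gamma u * rGamma (u + d)) * norm (Gamma d) \<le> 1"
    by (simp add: Beta_altdef norm_mult mult_ac)
  have "Gamma d \<noteq> 0" using assms Re_pos_not_nonpos_Int[of d] by (simp add: Gamma_eq_zero_iff)
  hence "norm (Gamma u * rGamma (u + d)) \<le> 1 / norm (Gamma d)"
    using * by (subst pos_le_divide_eq) auto
  thus ?thesis by (simp add: rGamma_inverse_Gamma norm_inverse norm_divide inverse_eq_divide)
qed

lemma norm_pochhammer_ge_1:
  assumes "\<bar>Im z\<bar> \<ge> 1"
  shows "norm (pochhammer z n) \<ge> 1"
proof -
  have "norm (z + of_nat i) \<ge> 1" for i
    using abs_Im_le_cmod[of "z + of_nat i"] assms by simp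
  hence "(\<Prod>i\<in>{0..<n}. 1) \<le> norm (pochhammer z n)"
    unfolding pochhammer_prod prod_norm[symmetric] by (intro prod_mono) auto
  thus ?thesis by simp
qed

lemma norm_pochhammer_le:
  fixes z :: complex
  shows "norm (pochhammer z n) \<le> (norm z + real n) ^ n"
proof -
  have "norm (pochhammer z n) \<le> (\<Prod>i\<in>{0..<n}. norm z + real n)"
    unfolding pochhammer_prod prod_norm[symmetric]
    by (intro prod_mono) (auto intro!: order.trans[OF norm_triangle_ineq])
  thus ?thesis by simp
qed

lemma norm_Gamma_le_shift:
  fixes u :: complex
  assumes "\<bar>Im u\<bar> \<ge> 1"
  shows "norm (Gamma u) \<le> norm (Gamma (u + of_nat n))"
proof -
  have un: "u \<notin> \<int>\<^sub>\<le>\<^sub>0" using assms by (auto elim!: nonpos_Ints_cases)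
  have "Gamma (u + of_nat n) = pochhammer u n * Gamma u"
    using pochhammer_Gamma[OF un, of n] un by (simp add: Gamma_eq_zero_iff)
  moreover have "1 * norm (Gamma u) \<le> norm (pochhammer u n) * norm (Gamma u)"
    by (intro mult_right_mono norm_pochhammer_ge_1 assms) auto
  ultimately show ?thesis by (simp add: norm_mult)
qed

text \<open>Exponential decay and polynomial growth as \<open>\<bar>Im w\<bar> \<longlongrightarrow> \<infinity>\<close>, uniformly in every vertical strip; the height
  \<open>T\<close> may depend on the strip, so that poles of bounded imaginary part do no harm.\<close>

definition vert_decay :: "(complex \<Rightarrow> complex) \<Rightarrow> bool" where
  "vert_decay f \<longleftrightarrow> (\<forall>x1 x2. \<exists>C e T. e > 0 \<and>
     (\<forall>w. x1 \<le> Re w \<longrightarrow> Re w \<le> x2 \<longrightarrow> \<bar>Im w\<bar> \<ge> T \<longrightarrow> norm (f w) \<le> C * exp (- e * \<bar>Im w\<bar>)))"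

definition vert_poly :: "(complex \<Rightarrow> complex) \<Rightarrow> bool" where
  "vert_poly f \<longleftrightarrow> (\<forall>x1 x2. \<exists>C n T.
     (\<forall>w. x1 \<le> Re w \<longrightarrow> Re w \<le> x2 \<longrightarrow> \<bar>Im w\<bar> \<ge> T \<longrightarrow> norm (f w) \<le> C * (1 + \<bar>Im w\<bar>) ^ n))"

lemma power_le_exp:
  assumes "(e::real) > 0"
  obtains C where "C > 0" "\<And>t. t \<ge> 0 \<Longrightarrow> (1 + t) ^ n \<le> C * exp (e * t)"
proof -
  \<comment> \<open>chosen so that \<open>1 + t \<le> exp (h t) / h\<close> and \<open>n h \<le> e\<close>\<close>
  define h where "h = min 1 (e / (real n + 1))"
  have h: "h > 0" "h \<le> 1" using assms by (auto simp: h_def)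
  have "h * real n \<le> e / (real n + 1) * (real n + 1)"
    unfolding h_def using assms by (intro mult_mono) auto
  hence hn: "real n * h \<le> e" by (simp add: mult.commute)
  have "(1 + t) ^ n \<le> (1 / h) ^ n * exp (e * t)" if "t \<ge> 0" for t
  proof -
    have "h * (1 + t) \<le> 1 + h * t" using h by (simp add: algebra_simps)
    also have "\<dots> \<le> exp (h * t)" by (rule exp_ge_add_one_self)
    finally have "1 + t \<le> 1 / h * exp (h * t)" using h by (simp add: field_simps)
    hence "(1 + t) ^ n \<le> (1 / h * exp (h * t)) ^ n" using that by (intro power_mono) auto
    also have "\<dots> = (1 / h) ^ n * exp (real n * h * t)"
      by (simp add: power_mult_distrib exp_of_nat_mult[symmetric] mult_ac power_divide)
    also have "\<dots> \<le> (1 / h) ^ n * exp (e * t)"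
      using h that hn by (intro mult_left_mono) (auto intro: mult_right_mono)
    finally show ?thesis .
  qed
  thus ?thesis using h by (intro that[of "(1 / h) ^ n"]) auto
qed

lemma vert_decay_mult_poly:
  assumes f: "vert_decay f" and g: "vert_poly g"
  shows "vert_decay (\<lambda>w. f w * g w)"
  unfolding vert_decay_def
proof (intro allI)
  fix x1 x2
  obtain C e T where 1: "e > 0" "\<And>w. x1 \<le> Re w \<Longrightarrow> Re w \<le> x2 \<Longrightarrow> \<bar>Im w\<bar> \<ge> T \<Longrightarrow> norm (f w) \<le> C * exp (- e * \<bar>Im w\<bar>)"
    using f unfolding vert_decay_def by blast
  obtain D n S where 2: "\<And>w. x1 \<le> Re w \<Longrightarrow> Re w \<le> x2 \<Longrightarrow> \<bar>Im w\<bar> \<ge> S \<Longrightarrow> norm (g w) \<le> D * (1 + \<bar>Im w\<bar>) ^ n"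
    using g unfolding vert_poly_def by blast
  obtain K where K: "K > 0" "\<And>t. t \<ge> 0 \<Longrightarrow> (1 + t) ^ n \<le> K * exp (e / 2 * t)"
    using power_le_exp[of "e / 2"] 1(1) by (metis half_gt_zero_iff)
  show "\<exists>C e T. e > 0 \<and> (\<forall>w. x1 \<le> Re w \<longrightarrow> Re w \<le> x2 \<longrightarrow> \<bar>Im w\<bar> \<ge> T \<longrightarrow> norm (f w * g w) \<le> C * exp (- e * \<bar>Im w\<bar>))"
  proof (rule exI[of _ "\<bar>C\<bar> * (\<bar>D\<bar> * K)"], rule exI[of _ "e / 2"], rule exI[of _ "max S T"], intro conjI allI impI)
    fix w assume w: "x1 \<le> Re w" "Re w \<le> x2" "max S T \<le> \<bar>Im w\<bar>"
    have "norm (f w) \<le> \<bar>C\<bar> * exp (- e * \<bar>Im w\<bar>)"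
      using 1(2)[of w] w by (intro order.trans[OF 1(2)] mult_right_mono) auto
    moreover have "norm (g w) \<le> \<bar>D\<bar> * (K * exp (e / 2 * \<bar>Im w\<bar>))"
      using w K by (intro order.trans[OF 2] mult_mono) auto
    ultimately have "norm (f w * g w) \<le> \<bar>C\<bar> * exp (- e * \<bar>Im w\<bar>) * (\<bar>D\<bar> * (K * exp (e / 2 * \<bar>Im w\<bar>)))"
      unfolding norm_mult by (intro mult_mono) auto
    also have "\<dots> = \<bar>C\<bar> * (\<bar>D\<bar> * K) * (exp (- e * \<bar>Im w\<bar>) * exp (e / 2 * \<bar>Im w\<bar>))" by (simp only: mult_ac)
    also have "exp (- e * \<bar>Im w\<bar>) * exp (e / 2 * \<bar>Im w\<bar>) = exp (- (e / 2) * \<bar>Im w\<bar>)"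
      by (simp add: exp_add[symmetric] algebra_simps)
    finally show "norm (f w * g w) \<le> \<bar>C\<bar> * (\<bar>D\<bar> * K) * exp (- (e / 2) * \<bar>Im w\<bar>)" .
  qed (use 1 in auto)
qed

text \<open>Shifting the two arguments up by \<open>N\<close> and \<open>M\<close> costs Pochhammer symbols only, of modulus at least \<open>1\<close>
  in the denominator and polynomially bounded in the numerator. \<open>N\<close> moves the upper argument into
  \<open>Re \<ge> 1\<close>, and \<open>M\<close> makes the difference \<open>d\<close> of the shifted arguments satisfy \<open>Re d \<ge> 1\<close>.\<close>

lemma vert_poly_Gamma_ratio:
  assumes B: "B > 0"
  shows "vert_poly (\<lambda>w. Gamma (of_real B * w + a) * rGamma (of_real B * w + b))"
  unfolding vert_poly_def
proof (intro allI)
  fix x1 x2 :: real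
  define N where "N = nat \<lceil>1 - B * x1 - Re a\<rceil>"
  define M where "M = N + nat \<lceil>1 + Re a - Re b\<rceil>"
  define d where "d = b - a + of_nat M - of_nat N"
  define S where "S = B * (\<bar>x1\<bar> + \<bar>x2\<bar>) + norm b + real M + B + 1"
  have N: "real N \<ge> 1 - B * x1 - Re a" unfolding N_def by linarith
  have d: "Re d \<ge> 1" unfolding d_def M_def by (simp, linarith)
  show "\<exists>C n T. \<forall>w. x1 \<le> Re w \<longrightarrow> Re w \<le> x2 \<longrightarrow> T \<le> \<bar>Im w\<bar> \<longrightarrow>
      norm (Gamma (of_real B * w + a) * rGamma (of_real B * w + b)) \<le> C * (1 + \<bar>Im w\<bar>) ^ n"
  proof (rule exI[of _ "norm (rGamma d) * S ^ M"], rule exI[of _ M], rule exI[of _ "(1 + \<bar>Im a\<bar>) / B"], intro allI impI)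
    fix w assume w: "x1 \<le> Re w" "Re w \<le> x2" "(1 + \<bar>Im a\<bar>) / B \<le> \<bar>Im w\<bar>"
    define u where "u = of_real B * w + a"
    define v where "v = of_real B * w + b"
    have "1 + \<bar>Im a\<bar> \<le> B * \<bar>Im w\<bar>" using w(3) B by (simp add: field_simps)
    moreover have "\<bar>Im u\<bar> \<ge> \<bar>B * Im w\<bar> - \<bar>Im a\<bar>" unfolding u_def by simp
    ultimately have Imu: "\<bar>Im u\<bar> \<ge> 1" using B by (simp add: abs_mult)
    have "norm (Gamma u) \<le> norm (Gamma (u + of_nat N))" by (rule norm_Gamma_le_shift[OF Imu])
    moreover have "norm (rGamma v) = norm (pochhammer v M) * norm (rGamma (v + of_nat M))"
      by (subst pochhammer_rGamma[of v M]) (simp add: norm_mult)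
    ultimately have "norm (Gamma u * rGamma v) \<le> norm (Gamma (u + of_nat N)) * (norm (pochhammer v M) * norm (rGamma (v + of_nat M)))"
      unfolding norm_mult by (metis mult_right_mono norm_ge_zero)
    also have "\<dots> = norm (pochhammer v M) * norm (Gamma (u + of_nat N) * rGamma (v + of_nat M))"
      by (simp only: norm_mult mult_ac)
    also have "v + of_nat M = u + of_nat N + d" by (simp add: u_def v_def d_def)
    also have "norm (pochhammer v M) * norm (Gamma (u + of_nat N) * rGamma (u + of_nat N + d)) \<le> (S * (1 + \<bar>Im w\<bar>)) ^ M * norm (rGamma d)"
    proof (intro mult_mono)
      have "B * x1 \<le> B * Re w" using w B by simp
      hence "Re (u + of_nat N) \<ge> 1" using N by (simp add: u_def)
      thus "norm (Gamma (u + of_nat N) * rGamma (u + of_nat N + d)) \<le> norm (rGamma d)"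
        using d by (rule norm_Gamma_ratio_le)
      have "norm v \<le> B * norm w + norm b"
        unfolding v_def by (rule order.trans[OF norm_triangle_ineq]) (use B in \<open>simp add: norm_mult\<close>)
      also have "B * norm w \<le> B * (\<bar>x1\<bar> + \<bar>x2\<bar> + \<bar>Im w\<bar>)"
        using B w cmod_le[of w] by (intro mult_left_mono) auto
      finally have "norm v + real M \<le> (B * (\<bar>x1\<bar> + \<bar>x2\<bar>) + norm b + real M) + B * \<bar>Im w\<bar>"
        by (simp add: algebra_simps)
      also have "\<dots> \<le> S + S * \<bar>Im w\<bar>"
      proof (rule add_mono)
        show "B * (\<bar>x1\<bar> + \<bar>x2\<bar>) + norm b + real M \<le> S" using B unfolding S_def by simp
        have "0 \<le> B * (\<bar>x1\<bar> + \<bar>x2\<bar>)" using B by simp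
        hence "B \<le> S" unfolding S_def using norm_ge_zero[of b] by linarith
        thus "B * \<bar>Im w\<bar> \<le> S * \<bar>Im w\<bar>" by (rule mult_right_mono) simp
      qed
      finally have "norm v + real M \<le> S * (1 + \<bar>Im w\<bar>)" by (simp add: algebra_simps)
      thus "norm (pochhammer v M) \<le> (S * (1 + \<bar>Im w\<bar>)) ^ M"
        by (intro order.trans[OF norm_pochhammer_le] power_mono) auto
      show "0 \<le> (S * (1 + \<bar>Im w\<bar>)) ^ M" using B unfolding S_def by auto
    qed auto
    finally show "norm (Gamma (of_real B * w + a) * rGamma (of_real B * w + b)) \<le> norm (rGamma d) * S ^ M * (1 + \<bar>Im w\<bar>) ^ M"
      by (simp add: u_def v_def power_mult_distrib mult_ac)
  qed
qed

text \<open>By the reflection formula \<open>\<bar>\<Gamma>(1/2 + it)\<bar>\<^sup>2 = \<pi> / cosh(\<pi> t)\<close>.\<close>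

lemma norm_Gamma_half_le: "norm (Gamma (Complex (1/2) t)) \<le> sqrt (2 * pi) * exp (- pi / 2 * \<bar>t\<bar>)"
proof -
  let ?w = "Complex (1/2) t"
  have "1 - ?w = cnj ?w" by (simp add: complex_eq_iff)
  hence "Gamma ?w * cnj (Gamma ?w) = of_real pi / sin (of_real pi * ?w)"
    using Gamma_reflection_complex[of ?w] by (simp add: cnj_Gamma)
  also have "of_real pi * ?w = of_real (pi / 2) + \<i> * of_real (pi * t)"
    by (simp add: complex_eq_iff)
  also have "sin (of_real (pi / 2) + \<i> * of_real (pi * t)) = complex_of_real (cosh (pi * t))"
  proof -
    have "sin (complex_of_real (pi / 2)) = 1" "cos (complex_of_real (pi / 2)) = 0"
      by (simp_all add: sin_of_real cos_of_real del: of_real_divide)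
    hence "sin (of_real (pi / 2) + \<i> * of_real (pi * t)) = cos (\<i> * of_real (pi * t))"
      by (simp add: sin_add del: of_real_divide of_real_mult)
    also have "\<dots> = complex_of_real (cosh (pi * t))"
      by (simp add: cos_exp_eq cosh_def exp_of_real[symmetric] scaleR_conv_of_real
            flip: mult.assoc del: of_real_mult)
    finally show ?thesis .
  qed
  finally have "of_real ((norm (Gamma ?w))\<^sup>2) = complex_of_real (pi / cosh (pi * t))"
    by (simp only: complex_norm_square of_real_divide)
  hence "(norm (Gamma ?w))\<^sup>2 = pi / cosh (pi * t)" by (simp only: of_real_eq_iff)
  also have "\<dots> \<le> pi / (exp (pi * \<bar>t\<bar>) / 2)"
  proof (intro divide_left_mono)
    have "exp \<bar>x\<bar> / 2 \<le> cosh x" for x :: real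
      by (cases "x \<ge> 0") (auto simp: cosh_def)
    from this[of "pi * t"] show "exp (pi * \<bar>t\<bar>) / 2 \<le> cosh (pi * t)" by (simp add: abs_mult)
  qed auto
  also have "\<dots> = (sqrt (2 * pi) * exp (- pi / 2 * \<bar>t\<bar>))\<^sup>2"
    by (simp add: power_mult_distrib exp_double[symmetric] exp_minus field_simps)
  finally show ?thesis by (rule power2_le_imp_le) auto
qed

text \<open>The decay on \<open>Re w = 1/2\<close> is carried to a strip by comparing \<open>w + N\<close> with \<open>1/2 + i Im w + K\<close>: their
  difference \<open>d \<ge> 1\<close> is real and ranges over a compact interval, on which \<open>1/\<Gamma>\<close> is bounded.\<close>

lemma norm_Gamma_strip_le:
  "\<exists>C n. \<forall>w. x1 \<le> Re w \<longrightarrow> Re w \<le> x2 \<longrightarrow> \<bar>Im w\<bar> \<ge> 1 \<longrightarrow>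
     norm (Gamma w) \<le> C * (1 + \<bar>Im w\<bar>) ^ n * exp (- pi / 2 * \<bar>Im w\<bar>)"
proof -
  define N where "N = nat \<lceil>1 - x1\<rceil>"
  define K where "K = N + nat \<lceil>1 + x2\<rceil>"
  have N: "real N \<ge> 1 - x1" unfolding N_def by linarith
  have K: "real K \<ge> real N + 1 + x2" unfolding K_def by (simp, linarith)
  have "bounded ((rGamma :: real \<Rightarrow> real) ` {1..real K + 1/2 - x1 - real N})"
    by (rule compact_imp_bounded, rule compact_continuous_image[OF continuous_on_rGamma]) auto
  then obtain R where R: "R > 0" "\<And>x. x \<in> {1..real K + 1/2 - x1 - real N} \<Longrightarrow> \<bar>rGamma x\<bar> \<le> R"
    unfolding bounded_pos by auto
  show ?thesis
  proof (rule exI[of _ "R * (1 + real K) ^ K * sqrt (2 * pi)"], rule exI[of _ K], intro allI impI)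
    fix w assume w: "x1 \<le> Re w" "Re w \<le> x2" "\<bar>Im w\<bar> \<ge> 1"
    define h where "h = Complex (1/2) (Im w)"
    define d where "d = real K + 1/2 - Re w - real N"
    have wn: "w \<notin> \<int>\<^sub>\<le>\<^sub>0" "h \<notin> \<int>\<^sub>\<le>\<^sub>0"
      using w Re_pos_not_nonpos_Int[of h] by (auto elim!: nonpos_Ints_cases simp: h_def)
    have d: "d \<ge> 1" "d \<le> real K + 1/2 - x1 - real N" using w N K by (auto simp: d_def)
    have eq: "w + of_nat N + of_real d = h + of_nat K" by (simp add: complex_eq_iff h_def d_def)
    have hK: "h + of_nat K \<notin> \<int>\<^sub>\<le>\<^sub>0" by (intro Re_pos_not_nonpos_Int) (auto simp: h_def)
    have "norm (Gamma w) \<le> norm (Gamma (w + of_nat N))" by (rule norm_Gamma_le_shift[OF w(3)])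
    also have "Gamma (w + of_nat N) = Gamma (w + of_nat N) * rGamma (h + of_nat K) * Gamma (h + of_nat K)"
      using hK by (simp add: rGamma_inverse_Gamma Gamma_eq_zero_iff)
    also have "norm \<dots> \<le> R * norm (Gamma (h + of_nat K))"
      unfolding norm_mult[of _ "Gamma (h + of_nat K)"]
    proof (intro mult_right_mono)
      have "norm (Gamma (w + of_nat N) * rGamma (w + of_nat N + of_real d)) \<le> norm (rGamma (complex_of_real d))"
        using N w d by (intro norm_Gamma_ratio_le) auto
      also have "\<dots> \<le> R" using R(2)[of d] d by (simp add: rGamma_complex_of_real)
      finally show "norm (Gamma (w + of_nat N) * rGamma (h + of_nat K)) \<le> R" by (simp add: eq)
    qed auto
    also have "Gamma (h + of_nat K) = pochhammer h K * Gamma h"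
      using pochhammer_Gamma[OF wn(2), of K] wn(2) by (simp add: Gamma_eq_zero_iff)
    also have "R * norm (pochhammer h K * Gamma h) \<le> R * (((1 + real K) * (1 + \<bar>Im w\<bar>)) ^ K * (sqrt (2 * pi) * exp (- pi / 2 * \<bar>Im w\<bar>)))"
      unfolding norm_mult
    proof (intro mult_left_mono mult_mono)
      have "norm h \<le> 1 / 2 + \<bar>Im w\<bar>" using cmod_le[of h] by (simp add: h_def)
      moreover have "0 \<le> real K * \<bar>Im w\<bar>" by simp
      moreover have "(1 + real K) * (1 + \<bar>Im w\<bar>) = 1 + \<bar>Im w\<bar> + real K + real K * \<bar>Im w\<bar>"
        by (simp add: algebra_simps)
      ultimately have "norm h + real K \<le> (1 + real K) * (1 + \<bar>Im w\<bar>)" by linarith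
      thus "norm (pochhammer h K) \<le> ((1 + real K) * (1 + \<bar>Im w\<bar>)) ^ K"
        by (intro order.trans[OF norm_pochhammer_le] power_mono) auto
    qed (use R norm_Gamma_half_le in \<open>auto simp: h_def\<close>)
    finally show "norm (Gamma w) \<le> R * (1 + real K) ^ K * sqrt (2 * pi) * (1 + \<bar>Im w\<bar>) ^ K * exp (- pi / 2 * \<bar>Im w\<bar>)"
      by (simp add: power_mult_distrib mult_ac)
  qed
qed

text \<open>The factor \<open>z\<^bsup>-w\<^esup>\<close> grows at most like \<open>e\<^bsup>\<bar>arg z\<bar> \<bar>Im w\<bar>\<^esup>\<close>, and \<open>\<bar>arg z\<bar> < \<pi>/2\<close>, which leaves an
  exponential rate \<open>e\<close>; half of it absorbs the polynomial factor.\<close>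

lemma vert_decay_Gamma_powr:
  assumes z: "Re z > 0"
  shows "vert_decay (\<lambda>w. Gamma w * z powr (- w))"
  unfolding vert_decay_def
proof (intro allI)
  fix x1 x2 :: real
  obtain C n where C: "\<And>w. x1 \<le> Re w \<Longrightarrow> Re w \<le> x2 \<Longrightarrow> \<bar>Im w\<bar> \<ge> 1 \<Longrightarrow>
     norm (Gamma w) \<le> C * (1 + \<bar>Im w\<bar>) ^ n * exp (- pi / 2 * \<bar>Im w\<bar>)"
    using norm_Gamma_strip_le[of x1 x2] by blast
  define e where "e = pi / 2 - \<bar>Im (Ln z)\<bar>"
  have e: "e > 0" using Re_Ln_pos_lt_imp[OF z] by (simp add: e_def)
  obtain K where K: "K > 0" "\<And>t. t \<ge> 0 \<Longrightarrow> (1 + t) ^ n \<le> K * exp (e / 2 * t)"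
    using power_le_exp[of "e / 2"] e by (metis half_gt_zero_iff)
  define L where "L = (\<bar>x1\<bar> + \<bar>x2\<bar>) * \<bar>ln (norm z)\<bar>"
  have znz: "z \<noteq> 0" using z by auto
  show "\<exists>C e T. e > 0 \<and> (\<forall>w. x1 \<le> Re w \<longrightarrow> Re w \<le> x2 \<longrightarrow> \<bar>Im w\<bar> \<ge> T \<longrightarrow>
          norm (Gamma w * z powr (- w)) \<le> C * exp (- e * \<bar>Im w\<bar>))"
  proof (rule exI[of _ "\<bar>C\<bar> * K * exp L"], rule exI[of _ "e / 2"], rule exI[of _ 1], intro conjI allI impI)
    fix w assume w: "x1 \<le> Re w" "Re w \<le> x2" "1 \<le> \<bar>Im w\<bar>"
    have "norm (Gamma w) \<le> C * (1 + \<bar>Im w\<bar>) ^ n * exp (- pi / 2 * \<bar>Im w\<bar>)" by (intro C w)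
    also have "\<dots> \<le> \<bar>C\<bar> * (K * exp (e / 2 * \<bar>Im w\<bar>)) * exp (- pi / 2 * \<bar>Im w\<bar>)"
      using K by (intro mult_right_mono mult_mono) auto
    finally have 1: "norm (Gamma w) \<le> \<bar>C\<bar> * (K * exp (e / 2 * \<bar>Im w\<bar>)) * exp (- pi / 2 * \<bar>Im w\<bar>)" .
    have "norm (z powr (- w)) = exp (Re (- w * Ln z))"
      using znz by (simp add: powr_def)
    also have "Re (- w * Ln z) \<le> L + \<bar>Im w\<bar> * (pi / 2 - e)"
    proof -
      have "Re (- w * Ln z) = - (Re w * ln (norm z)) + Im w * Im (Ln z)" using znz by simp
      also have "\<dots> \<le> \<bar>Re w\<bar> * \<bar>ln (norm z)\<bar> + \<bar>Im w\<bar> * \<bar>Im (Ln z)\<bar>"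
        using abs_ge_self[of "Im w * Im (Ln z)"] abs_ge_minus_self[of "Re w * ln (norm z)"] by (simp add: abs_mult)
      also have "\<dots> \<le> L + \<bar>Im w\<bar> * \<bar>Im (Ln z)\<bar>"
        unfolding L_def using w by (intro add_right_mono mult_right_mono) auto
      finally show ?thesis by (simp add: e_def)
    qed
    finally have 2: "norm (z powr (- w)) \<le> exp (L + \<bar>Im w\<bar> * (pi / 2 - e))" by simp
    have "norm (Gamma w * z powr (- w)) \<le> \<bar>C\<bar> * (K * exp (e / 2 * \<bar>Im w\<bar>)) * exp (- pi / 2 * \<bar>Im w\<bar>) * exp (L + \<bar>Im w\<bar> * (pi / 2 - e))"
      unfolding norm_mult using 1 2 K(1) by (intro mult_mono) auto
    also have "\<dots> = \<bar>C\<bar> * K * exp (e / 2 * \<bar>Im w\<bar> + - pi / 2 * \<bar>Im w\<bar> + (L + \<bar>Im w\<bar> * (pi / 2 - e)))"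
      by (simp only: exp_add mult_ac)
    also have "e / 2 * \<bar>Im w\<bar> + - pi / 2 * \<bar>Im w\<bar> + (L + \<bar>Im w\<bar> * (pi / 2 - e)) = L + - (e / 2) * \<bar>Im w\<bar>"
      by (simp add: algebra_simps)
    also have "\<bar>C\<bar> * K * exp (L + - (e / 2) * \<bar>Im w\<bar>) = \<bar>C\<bar> * K * exp L * exp (- (e / 2) * \<bar>Im w\<bar>)"
      by (simp only: exp_add mult_ac)
    finally show "norm (Gamma w * z powr (- w)) \<le> \<bar>C\<bar> * K * exp L * exp (- (e / 2) * \<bar>Im w\<bar>)" .
  qed (use e in auto)
qed

section \<open>Integrals along vertical lines and the Cahen--Mellin integral\<close>

lemma integrable_exp_abs:
  assumes "(e::real) > 0"
  shows "integrable lebesgue (\<lambda>t. exp (- e * \<bar>t\<bar>))"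
proof -
  define g where "g = (\<lambda>t. indicator {0..} t *\<^sub>R exp (- e * t))"
  have gb [measurable]: "g \<in> borel_measurable borel" unfolding g_def by measurable
  have "(\<lambda>t. exp (- e * t)) absolutely_integrable_on {0..}"
    using integrable_on_exp_minus_to_infinity[OF assms] by (subst absolutely_integrable_on_iff_nonneg) auto
  hence g: "integrable lborel g"
    unfolding set_integrable_def g_def[symmetric] by (subst (asm) integrable_completion) auto
  have "integrable lborel (\<lambda>t. g (0 + (- 1) * t))"
    by (rule lborel_integrable_real_affine[OF g]) simp
  hence "integrable lborel (\<lambda>t. g t + g (- t))" using g by auto
  hence "integrable lborel (\<lambda>t. exp (- e * \<bar>t\<bar>))"
    by (rule Bochner_Integration.integrable_bound) (auto intro!: AE_I2 simp: g_def indicator_def)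
  thus ?thesis by (subst integrable_completion) auto
qed

lemma measurable_vertical_line:
  assumes "continuous_on {w. Re w = c} f"
  shows "(\<lambda>t. f (Complex c t)) \<in> borel_measurable borel"
proof (rule borel_measurable_continuous_onI)
  have "continuous_on UNIV (Complex c)"
    by (intro continuous_on_Complex continuous_intros)
  thus "continuous_on UNIV (\<lambda>t. f (Complex c t))"
    by (rule continuous_on_compose2[OF assms]) auto
qed

lemma integrable_vertical_line:
  assumes f: "continuous_on {w. Re w = c} f" and d: "vert_decay f"
  shows "integrable lebesgue (\<lambda>t. f (Complex c t))"
proof -
  obtain C e T where 1: "e > 0" "\<And>w. c \<le> Re w \<Longrightarrow> Re w \<le> c \<Longrightarrow> \<bar>Im w\<bar> \<ge> T \<Longrightarrow> norm (f w) \<le> C * exp (- e * \<bar>Im w\<bar>)"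
    using d unfolding vert_decay_def by blast
  have "continuous_on {-\<bar>T\<bar>..\<bar>T\<bar>} (\<lambda>t. f (Complex c t))"
    by (rule continuous_on_compose2[OF f]) (auto intro!: continuous_on_Complex continuous_intros)
  hence "bounded ((\<lambda>t. f (Complex c t)) ` {-\<bar>T\<bar>..\<bar>T\<bar>})"
    by (intro compact_imp_bounded compact_continuous_image) auto
  then obtain M where M: "M > 0" "\<And>t. \<bar>t\<bar> \<le> \<bar>T\<bar> \<Longrightarrow> norm (f (Complex c t)) \<le> M"
    unfolding bounded_pos by (auto simp: abs_le_iff)
  have "norm (f (Complex c t)) \<le> norm ((\<bar>C\<bar> + M * exp (e * \<bar>T\<bar>)) * exp (- e * \<bar>t\<bar>))" for t
  proof (cases "\<bar>t\<bar> \<le> \<bar>T\<bar>")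
    case True
    have "norm (f (Complex c t)) \<le> M * 1" using M(2)[OF True] by simp
    also have "\<dots> \<le> M * (exp (e * \<bar>T\<bar>) * exp (- e * \<bar>t\<bar>))"
      using M True 1 by (intro mult_left_mono) (auto simp: exp_add[symmetric] mult_left_mono)
    also have "\<dots> \<le> (\<bar>C\<bar> + M * exp (e * \<bar>T\<bar>)) * exp (- e * \<bar>t\<bar>)" by (simp add: distrib_right)
    finally show ?thesis using M by simp
  next
    case False
    have "norm (f (Complex c t)) \<le> C * exp (- e * \<bar>t\<bar>)" using 1(2)[of "Complex c t"] False by simp
    also have "\<dots> \<le> (\<bar>C\<bar> + M * exp (e * \<bar>T\<bar>)) * exp (- e * \<bar>t\<bar>)"
      using M by (intro mult_right_mono) (auto intro: add_increasing2)
    finally show ?thesis using M by simp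
  qed
  thus ?thesis
    using measurable_vertical_line[OF f]
    by (intro Bochner_Integration.integrable_bound[OF integrable_mult_right[OF integrable_exp_abs[OF 1(1)]], of _ "\<bar>C\<bar> + M * exp (e * \<bar>T\<bar>)"])
       (auto intro: measurable_completion)
qed

lemma has_integral_UNIV_tendsto:
  fixes g :: "real \<Rightarrow> complex"
  assumes "(g has_integral I) UNIV"
  shows "((\<lambda>T. integral {-T..T} g) \<longlongrightarrow> I) at_top"
proof (rule tendstoI)
  fix e :: real assume "e > 0"
  then obtain B where B: "B > 0" "\<And>a b. ball 0 B \<subseteq> cbox a b \<Longrightarrow> norm (integral (cbox a b) g - I) < e"
    using assms unfolding has_integral_alt'[of g] by auto
  show "\<forall>\<^sub>F T in at_top. dist (integral {-T..T} g) I < e"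
    using eventually_ge_at_top[of B]
  proof eventually_elim
    case (elim T)
    have "ball 0 B \<subseteq> cbox (-T) T" using elim by (auto simp: dist_real_def)
    from B(2)[OF this] show ?case by (simp add: dist_norm)
  qed
qed

lemma contour_integral_horizontal_tendsto_0:
  assumes d: "vert_decay f" and g: "filterlim g at_infinity at_top"
  shows "((\<lambda>T. contour_integral (linepath (Complex x1 (g T)) (Complex x2 (g T))) f) \<longlongrightarrow> 0) at_top"
proof -
  define y1 where "y1 = min x1 x2"
  define y2 where "y2 = max x1 x2"
  obtain C e T where 1: "e > 0" "\<And>w. y1 \<le> Re w \<Longrightarrow> Re w \<le> y2 \<Longrightarrow> \<bar>Im w\<bar> \<ge> T \<Longrightarrow> norm (f w) \<le> C * exp (- e * \<bar>Im w\<bar>)"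
    using d unfolding vert_decay_def by blast
  have gt: "filterlim (\<lambda>T. \<bar>g T\<bar>) at_top at_top"
    using g filterlim_at_infinity_imp_norm_at_top by fastforce
  show ?thesis
  proof (rule Lim_null_comparison)
    have "((\<lambda>t. exp (- e * t)) \<longlongrightarrow> 0) at_top" using 1(1) by real_asymp
    hence "((\<lambda>t. exp (- e * \<bar>g t\<bar>)) \<longlongrightarrow> 0) at_top" by (rule filterlim_compose[OF _ gt])
    hence "((\<lambda>t. (\<bar>C\<bar> * \<bar>x2 - x1\<bar>) * exp (- e * \<bar>g t\<bar>)) \<longlongrightarrow> 0) at_top" by (rule tendsto_mult_right_zero)
    thus "((\<lambda>t. \<bar>C\<bar> * exp (- e * \<bar>g t\<bar>) * \<bar>x2 - x1\<bar>) \<longlongrightarrow> 0) at_top" by (simp only: mult_ac)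
    have "\<forall>\<^sub>F t in at_top. \<bar>g t\<bar> \<ge> T" using gt by (simp add: filterlim_at_top)
    thus "\<forall>\<^sub>F t in at_top. norm (contour_integral (linepath (Complex x1 (g t)) (Complex x2 (g t))) f) \<le> \<bar>C\<bar> * exp (- e * \<bar>g t\<bar>) * \<bar>x2 - x1\<bar>"
    proof eventually_elim
      case (elim t)
      show ?case
      proof (cases "f contour_integrable_on (linepath (Complex x1 (g t)) (Complex x2 (g t)))")
        case True
        have "norm (contour_integral (linepath (Complex x1 (g t)) (Complex x2 (g t))) f) \<le> (\<bar>C\<bar> * exp (- e * \<bar>g t\<bar>)) * norm (Complex x2 (g t) - Complex x1 (g t))"
        proof (rule contour_integral_bound_linepath[OF True])
          fix w assume "w \<in> closed_segment (Complex x1 (g t)) (Complex x2 (g t))"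
          hence w: "Im w = g t" "Re w \<in> closed_segment x1 x2" by (auto simp: closed_segment_same_Im)
          hence "y1 \<le> Re w" "Re w \<le> y2" by (auto simp: y1_def y2_def closed_segment_eq_real_ivl split: if_splits)
          hence "norm (f w) \<le> C * exp (- e * \<bar>Im w\<bar>)" using elim w by (intro 1(2)) auto
          also have "\<dots> \<le> \<bar>C\<bar> * exp (- e * \<bar>Im w\<bar>)" by (intro mult_right_mono) auto
          finally show "norm (f w) \<le> \<bar>C\<bar> * exp (- e * \<bar>g t\<bar>)" by (simp add: w)
        qed auto
        also have "norm (Complex x2 (g t) - Complex x1 (g t)) = \<bar>x2 - x1\<bar>"
          by (simp add: complex_diff cmod_def)
        finally show ?thesis .
      qed (auto simp: not_integrable_contour_integral)
    qed
  qed
qed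

lemma contour_integral_vertical:
  assumes f: "continuous_on {w. Re w = c} f" and T: "T > 0"
  shows "contour_integral (linepath (Complex c (-T)) (Complex c T)) f = \<i> * integral {-T..T} (\<lambda>t. f (Complex c t))"
proof -
  have "(\<lambda>t. f (Complex c t)) integrable_on {-T..T}"
    by (rule integrable_continuous_interval, rule continuous_on_compose2[OF f])
       (auto intro!: continuous_on_Complex continuous_intros)
  hence "((\<lambda>t. f (Complex c t)) has_integral - \<i> * (\<i> * integral {-T..T} (\<lambda>t. f (Complex c t)))) {-T..T}"
    by (simp add: has_integral_iff flip: mult.assoc)
  hence "(f has_contour_integral \<i> * integral {-T..T} (\<lambda>t. f (Complex c t))) (linepath (Complex c (-T)) (Complex c T))"
    using T by (subst has_contour_integral_linepath_same_Re_iff[where c = c and a = "-T" and b = T]) auto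
  thus ?thesis by (rule contour_integral_unique)
qed

lemma contour_integral_vertical_tendsto:
  assumes f: "continuous_on {w. Re w = c} f" and d: "vert_decay f"
  shows "((\<lambda>T. contour_integral (linepath (Complex c (-T)) (Complex c T)) f) \<longlongrightarrow> \<i> * (\<integral>t. f (Complex c t) \<partial>lebesgue)) at_top"
proof (rule Lim_transform_eventually)
  show "((\<lambda>T. \<i> * integral {-T..T} (\<lambda>t. f (Complex c t))) \<longlongrightarrow> \<i> * (\<integral>t. f (Complex c t) \<partial>lebesgue)) at_top"
    by (intro tendsto_intros has_integral_UNIV_tendsto has_integral_integral_lebesgue integrable_vertical_line f d)
  show "\<forall>\<^sub>F T in at_top. \<i> * integral {-T..T} (\<lambda>t. f (Complex c t)) = contour_integral (linepath (Complex c (-T)) (Complex c T)) f"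
    using eventually_gt_at_top[of 0] by eventually_elim (simp add: contour_integral_vertical[OF f])
qed

text \<open>Cauchy's integral formula on the rectangles between the two lines, whose horizontal sides
  contribute nothing in the limit.\<close>

lemma vertical_line_cross_pole:
  assumes h: "h holomorphic_on {w. a < Re w \<and> Re w < b}"
    and ab: "a < x1" "x1 < Re p" "Re p < x2" "x2 < b"
    and d: "vert_decay f" and fh: "\<And>w. w \<noteq> p \<Longrightarrow> a < Re w \<Longrightarrow> Re w < b \<Longrightarrow> f w = h w / (w - p)"
  shows "(\<integral>t. f (Complex x2 t) \<partial>lebesgue) - (\<integral>t. f (Complex x1 t) \<partial>lebesgue) = 2 * of_real pi * h p"
proof -
  let ?S = "{w. a < Re w \<and> Re w < b}"
  have S: "convex ?S" "open ?S"
    by (auto simp: convex_halfspace_Re_lt convex_halfspace_Re_gt Collect_conj_eq open_halfspace_Re_gt open_halfspace_Re_lt intro!: convex_Int)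
  have cf: "continuous_on A f" if "A \<subseteq> ?S - {p}" for A
  proof -
    have "continuous_on A h" using holomorphic_on_imp_continuous_on[OF h] that continuous_on_subset by blast
    hence "continuous_on A (\<lambda>w. h w / (w - p))" using that by (intro continuous_intros) auto
    thus ?thesis by (rule continuous_on_eq, subst fh) (use that in auto)
  qed
  have c1: "continuous_on {w. Re w = x1} f" "continuous_on {w. Re w = x2} f" by (rule cf, use ab in auto)+
  define R where "R = (\<lambda>T. rectpath (Complex x1 (-T)) (Complex x2 T))"
  have ev: "\<forall>\<^sub>F T in at_top. contour_integral (linepath (Complex x1 (-T)) (Complex x2 (-T))) f
      + (contour_integral (linepath (Complex x2 (-T)) (Complex x2 T)) f
      + (- contour_integral (linepath (Complex x1 T) (Complex x2 T)) f
      - contour_integral (linepath (Complex x1 (-T)) (Complex x1 T)) f)) = 2 * pi * \<i> * h p"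
    using eventually_gt_at_top[of "\<bar>Im p\<bar>"]
  proof eventually_elim
    case (elim T)
    have box: "p \<in> box (Complex x1 (-T)) (Complex x2 T)" using elim ab by (auto simp: in_box_complex_iff)
    have img: "path_image (R T) \<subseteq> ?S - {p}"
    proof -
      have "path_image (R T) \<subseteq> cbox (Complex x1 (-T)) (Complex x2 T)"
        unfolding R_def using ab elim by (intro path_image_rectpath_subset_cbox) auto
      moreover have "p \<notin> path_image (R T)"
        unfolding R_def using path_image_rectpath_inter_box[of "Complex x1 (-T)" "Complex x2 T"] box ab elim abs_ge_zero[of "Im p"] by auto
      ultimately show ?thesis using ab by (auto simp: in_cbox_complex_iff)
    qed
    have "((\<lambda>w. h w / (w - p)) has_contour_integral (2 * pi * \<i> * winding_number (R T) p * h p)) (R T)"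
      using S img h ab by (intro Cauchy_integral_formula_convex_simple[of ?S]) (auto simp: R_def interior_open)
    hence "(f has_contour_integral (2 * pi * \<i> * winding_number (R T) p * h p)) (R T)"
      by (rule has_contour_integral_eq, subst fh) (use img in auto)
    moreover have "winding_number (R T) p = 1" unfolding R_def by (rule winding_number_rectpath[OF box])
    ultimately have 1: "contour_integral (R T) f = 2 * pi * \<i> * h p" by (simp add: contour_integral_unique)
    have seg: "closed_segment (Complex x1 (-T)) (Complex x2 (-T)) \<subseteq> ?S - {p}"
      "closed_segment (Complex x2 (-T)) (Complex x2 T) \<subseteq> ?S - {p}"
      "closed_segment (Complex x2 T) (Complex x1 T) \<subseteq> ?S - {p}"
      "closed_segment (Complex x1 T) (Complex x1 (-T)) \<subseteq> ?S - {p}"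
      using img unfolding R_def rectpath_def by (auto simp: Let_def path_image_join)
    have i: "f contour_integrable_on linepath u v" if "closed_segment u v \<subseteq> ?S - {p}" for u v
      by (rule contour_integrable_continuous_linepath[OF cf[OF that]])
    have 2: "contour_integral (R T) f = contour_integral (linepath (Complex x1 (-T)) (Complex x2 (-T))) f
      + (contour_integral (linepath (Complex x2 (-T)) (Complex x2 T)) f
      + (contour_integral (linepath (Complex x2 T) (Complex x1 T)) f
      + contour_integral (linepath (Complex x1 T) (Complex x1 (-T))) f))"
      unfolding R_def rectpath_def using seg[THEN i] by (simp add: Let_def contour_integrable_joinI valid_path_join)
    have rev: "contour_integral (linepath (Complex x2 T) (Complex x1 T)) f = - contour_integral (linepath (Complex x1 T) (Complex x2 T)) f"
      "contour_integral (linepath (Complex x1 T) (Complex x1 (-T))) f = - contour_integral (linepath (Complex x1 (-T)) (Complex x1 T)) f"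
      using seg by (auto intro!: contour_integral_reverse_linepath cf)
    show ?case using 1 unfolding 2 rev by simp
  qed
  have inf: "filterlim (\<lambda>T::real. - T) at_infinity at_top" "filterlim (\<lambda>T::real. T) at_infinity at_top"
    by real_asymp+
  have "((\<lambda>T. contour_integral (linepath (Complex x1 (-T)) (Complex x2 (-T))) f
      + (contour_integral (linepath (Complex x2 (-T)) (Complex x2 T)) f
      + (- contour_integral (linepath (Complex x1 T) (Complex x2 T)) f
      - contour_integral (linepath (Complex x1 (-T)) (Complex x1 T)) f))) \<longlongrightarrow>
      0 + (\<i> * (\<integral>t. f (Complex x2 t) \<partial>lebesgue) + (- 0 - \<i> * (\<integral>t. f (Complex x1 t) \<partial>lebesgue)))) at_top"
    by (intro tendsto_intros contour_integral_horizontal_tendsto_0[OF d inf(1)]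
        contour_integral_horizontal_tendsto_0[OF d inf(2)] contour_integral_vertical_tendsto c1 d)
  hence "((\<lambda>T::real. 2 * pi * \<i> * h p) \<longlongrightarrow> 0 + (\<i> * (\<integral>t. f (Complex x2 t) \<partial>lebesgue) + (- 0 - \<i> * (\<integral>t. f (Complex x1 t) \<partial>lebesgue)))) at_top"
    by (rule Lim_transform_eventually[OF _ ev])
  hence "2 * pi * \<i> * h p = \<i> * ((\<integral>t. f (Complex x2 t) \<partial>lebesgue) - (\<integral>t. f (Complex x1 t) \<partial>lebesgue))"
    by (simp add: tendsto_const_iff algebra_simps)
  thus ?thesis by (simp add: mult_ac)
qed

text \<open>Moving the line \<open>Re w = 1/2 - n\<close> one unit to the left crosses the pole of \<open>\<Gamma>\<close> at \<open>-n\<close>, which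
  contributes the \<open>n\<close>-th term of the exponential series of \<open>-z\<close>. By the functional equation, the integral
  along \<open>Re w = 1/2 - n\<close> is at most \<open>(2 \<bar>z\<bar>)\<^sup>n / n!\<close> times an integral along \<open>Re w = 1/2\<close>, so nothing
  is left in the limit.\<close>

theorem Cahen_Mellin:
  assumes z: "Re z > 0"
  shows "integrable lebesgue (\<lambda>t. Gamma (Complex (1/2) t) * z powr (- Complex (1/2) t))"
    and "(\<integral>t. Gamma (Complex (1/2) t) * z powr (- Complex (1/2) t) \<partial>lebesgue) = 2 * of_real pi * exp (- z)"
proof -
  define f where "f = (\<lambda>w. Gamma w * z powr (- w))"
  have znz: "z \<noteq> 0" using z by auto
  have d: "vert_decay f" unfolding f_def by (rule vert_decay_Gamma_powr[OF z])
  define E where "E = (\<lambda>n::nat. \<integral>t. f (Complex (1/2 - real n) t) \<partial>lebesgue)"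
  have nonint: "Complex (1/2 - real n) t \<notin> \<int>\<^sub>\<le>\<^sub>0" for n t
  proof
    assume "Complex (1/2 - real n) t \<in> \<int>\<^sub>\<le>\<^sub>0"
    then obtain j where "Complex (1/2 - real n) t = of_int j" by (auto elim!: nonpos_Ints_cases)
    hence "1/2 - real n = of_int j" by (simp add: complex_eq_iff)
    hence "real_of_int (2 * j + 2 * int n) = 1" by simp
    hence "2 * j + 2 * int n = 1" by linarith
    thus False by presburger
  qed
  have cf: "continuous_on {w. Re w = 1/2 - real n} f" for n
    unfolding f_def using z nonint
    by (intro continuous_intros) (auto, metis complex.collapse)
  have int: "integrable lebesgue (\<lambda>t. f (Complex (1/2 - real n) t))" for n
    by (rule integrable_vertical_line[OF cf d])
  have step: "E n - E (Suc n) = 2 * of_real pi * ((- z) ^ n / fact n)" for n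
  proof -
    \<comment> \<open>\<open>(w + n) \<Gamma>(w) z\<^bsup>-w\<^esup>\<close>, written so as to be holomorphic at \<open>w = -n\<close>\<close>
    define h where "h = (\<lambda>w. Gamma (w + of_nat n + 1) * z powr (- w) / pochhammer w n)"
    have pnz: "pochhammer w n \<noteq> 0" if "Re w < - real n + 1" for w
    proof
      assume "pochhammer w n = 0"
      then obtain k where "k < n" "w = - of_nat k" by (auto simp: pochhammer_eq_0_iff)
      thus False using that by simp
    qed
    have hol: "h holomorphic_on {w. - real n - 1 < Re w \<and> Re w < - real n + 1}"
      unfolding h_def using znz pnz Re_pos_not_nonpos_Int unfolding pochhammer_prod
      by (intro holomorphic_intros) auto
    have fh: "f w = h w / (w - (- of_nat n))" if "w \<noteq> - of_nat n" "- real n - 1 < Re w" "Re w < - real n + 1" for w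
    proof -
      have wn: "w \<notin> \<int>\<^sub>\<le>\<^sub>0"
      proof
        assume "w \<in> \<int>\<^sub>\<le>\<^sub>0"
        then obtain j where "w = of_int j" by (auto elim!: nonpos_Ints_cases)
        hence "- int n - 1 < j \<and> j < - int n + 1" using that by simp
        hence "j = - int n" by simp
        thus False using that \<open>w = of_int j\<close> by simp
      qed
      have G: "Gamma (w + of_nat n + 1) = pochhammer w n * (w + of_nat n) * Gamma w"
        using pochhammer_Gamma[OF wn, of "Suc n"] wn by (simp add: Gamma_eq_zero_iff pochhammer_Suc add_ac)
      moreover have "w + of_nat n \<noteq> 0" using that(1) by (simp add: eq_neg_iff_add_eq_0)
      ultimately show ?thesis unfolding f_def h_def G using pnz[OF that(3)] by simp
    qed
    have "E n - E (Suc n) = 2 * of_real pi * h (- of_nat n)"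
      unfolding E_def by (rule vertical_line_cross_pole[OF hol _ _ _ _ d fh]) simp_all
    also have "h (- of_nat n) = (- z) ^ n / fact n"
      using znz by (cases "even n") (simp_all add: h_def pochhammer_same powr_nat' power_minus_even power_minus_odd)
    finally show ?thesis .
  qed
  define b where "b = (\<integral>t. norm (f (Complex (1/2) t)) \<partial>lebesgue)"
  have int0: "integrable lebesgue (\<lambda>t. f (Complex (1/2) t))" using int[of 0] by simp
  have bound: "norm (E n) \<le> b * ((2 * norm z) ^ n / fact n)" for n
  proof -
    have le: "norm (f (Complex (1/2 - real n) t)) \<le> norm (f (Complex (1/2) t)) * ((2 * norm z) ^ n / fact n)" for t
    proof -
      define w where "w = Complex (1/2 - real n) t"
      have wn: "w + of_nat n = Complex (1/2) t" by (simp add: w_def complex_eq_iff)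
      have "fact n / 2 ^ n = (\<Prod>i = 0..<n. real (n - i) / 2)"
        by (simp add: fact_prod_rev prod_dividef)
      also have "\<dots> \<le> norm (pochhammer w n)"
        unfolding pochhammer_prod prod_norm[symmetric]
      proof (intro prod_mono conjI)
        fix i assume i: "i \<in> {0..<n}"
        have "real (n - i) / 2 \<le> \<bar>Re (w + of_nat i)\<bar>" using i by (simp add: w_def of_nat_diff)
        also have "\<dots> \<le> norm (w + of_nat i)" by (rule abs_Re_le_cmod)
        finally show "real (n - i) / 2 \<le> norm (w + of_nat i)" .
      qed auto
      finally have p: "fact n / 2 ^ n \<le> norm (pochhammer w n)" .
      have "w \<notin> \<int>\<^sub>\<le>\<^sub>0" unfolding w_def by (rule nonint)
      hence "Gamma (w + of_nat n) = pochhammer w n * Gamma w"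
        using pochhammer_Gamma[of w n] by (simp add: Gamma_eq_zero_iff)
      moreover have "z powr (- w) = z powr (- (w + of_nat n)) * z ^ n"
        using znz by (simp add: powr_diff powr_minus powr_nat' field_simps)
      ultimately have "norm (f (w + of_nat n)) * norm z ^ n = norm (pochhammer w n) * norm (f w)"
        by (simp add: f_def norm_mult norm_power)
      moreover have "fact n / 2 ^ n * norm (f w) \<le> norm (pochhammer w n) * norm (f w)"
        by (intro mult_right_mono p) auto
      ultimately have "fact n / 2 ^ n * norm (f w) \<le> norm (f (Complex (1/2) t)) * norm z ^ n"
        by (simp only: wn)
      thus ?thesis by (simp add: w_def field_simps)
    qed
    have "norm (E n) \<le> (\<integral>t. norm (f (Complex (1/2 - real n) t)) \<partial>lebesgue)"
      unfolding E_def by (rule integral_norm_bound)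
    also have "\<dots> \<le> (\<integral>t. norm (f (Complex (1/2) t)) * ((2 * norm z) ^ n / fact n) \<partial>lebesgue)"
      using int int0 by (intro integral_mono le integrable_norm integrable_mult_left) auto
    finally show ?thesis by (simp add: b_def)
  qed
  have E0: "E \<longlonglongrightarrow> 0"
  proof (rule Lim_null_comparison)
    have "(\<lambda>n. (2 * norm z) ^ n / fact n) \<longlonglongrightarrow> 0"
      using summable_LIMSEQ_zero[OF summable_exp[of "2 * norm z"]] by (simp add: field_simps)
    thus "(\<lambda>n. b * ((2 * norm z) ^ n / fact n)) \<longlonglongrightarrow> 0" by (rule tendsto_mult_right_zero)
  qed (use bound in auto)
  have "(\<lambda>n. E n - E (Suc n)) sums (E 0 - 0)" by (rule telescope_sums'[OF E0])
  moreover have "(\<lambda>n. 2 * of_real pi * ((- z) ^ n / fact n)) sums (2 * of_real pi * exp (- z))"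
    using exp_converges[of "- z"] by (intro sums_mult) (simp add: scaleR_conv_of_real field_simps)
  ultimately have "E 0 = 2 * of_real pi * exp (- z)"
    unfolding step using sums_unique2 by fastforce
  thus "(\<integral>t. Gamma (Complex (1/2) t) * z powr (- Complex (1/2) t) \<partial>lebesgue) = 2 * of_real pi * exp (- z)"
    by (simp add: E_def f_def)
  show "integrable lebesgue (\<lambda>t. Gamma (Complex (1/2) t) * z powr (- Complex (1/2) t))"
    using int0 by (simp add: f_def)
qed

section \<open>Contours that are eventually vertical lines\<close>

lemma vertical_contour_piecewise_C1:
  assumes "\<gamma> piecewise_C1_differentiable_on {-T0..T0}" "T0 \<ge> 0"
    and line: "\<And>t. T0 \<le> \<bar>t\<bar> \<Longrightarrow> \<gamma> t = Complex c t" and T: "T0 \<le> T"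
  shows "\<gamma> piecewise_C1_differentiable_on {-T..T}"
proof -
  obtain S where S: "finite S" "\<gamma> C1_differentiable_on ({-T0..T0} - S)" "continuous_on {-T0..T0} \<gamma>"
    using assms(1) by (auto simp: piecewise_C1_differentiable_on_def)
  have cl: "continuous_on A (Complex c)" for A :: "real set"
    by (intro continuous_on_Complex continuous_intros)
  have "continuous_on ({-T..-T0} \<union> ({-T0..T0} \<union> {T0..T})) \<gamma>"
    by (intro continuous_on_closed_Un S closed_Un) (auto intro!: continuous_on_eq[OF cl] simp: line assms(2))
  moreover have "{-T..-T0} \<union> ({-T0..T0} \<union> {T0..T}) = {-T..T}" using assms by auto
  ultimately have cont: "continuous_on {-T..T} \<gamma>" by simp
  obtain D where D: "\<And>x. x \<in> {-T0..T0} - S \<Longrightarrow> (\<gamma> has_vector_derivative D x) (at x)" "continuous_on ({-T0..T0} - S) D"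
    using S(2) unfolding C1_differentiable_on_def by blast
  define S' where "S' = S \<union> {-T0, T0}"
  define D' where "D' = (\<lambda>x. if \<bar>x\<bar> < T0 then D x else \<i>)"
  have "\<gamma> C1_differentiable_on ({-T..T} - S')"
    unfolding C1_differentiable_on_def
  proof (intro exI[of _ D'] conjI ballI)
    fix x assume x: "x \<in> {-T..T} - S'"
    show "(\<gamma> has_vector_derivative D' x) (at x)"
    proof (cases "\<bar>x\<bar> < T0")
      case True
      thus ?thesis using x D(1)[of x] by (auto simp: D'_def S'_def abs_less_iff)
    next
      case False
      hence x': "\<bar>x\<bar> > T0" using x by (auto simp: S'_def)
      have "((\<lambda>t. of_real c + of_real t * \<i>) has_vector_derivative \<i>) (at x)"
        by (auto intro!: derivative_eq_intros)
      hence "(Complex c has_vector_derivative \<i>) (at x)"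
        by (rule has_vector_derivative_transform_within_open[of _ _ _ UNIV]) (auto simp: complex_eq_iff)
      moreover have "open {t. T0 < \<bar>t\<bar>}" by (intro open_Collect_less continuous_intros)
      ultimately have "(\<gamma> has_vector_derivative \<i>) (at x)"
        by (rule has_vector_derivative_transform_within_open) (use x' in \<open>auto simp: line\<close>)
      thus ?thesis using False by (simp add: D'_def)
    qed
  next
    have "continuous (at x within ({-T..T} - S')) D'" if x: "x \<in> {-T..T} - S'" for x
    proof (cases "\<bar>x\<bar> < T0")
      case True
      have o: "open {t. \<bar>t\<bar> < T0}" by (intro open_Collect_less continuous_intros)
      have "continuous_on (({-T..T} - S') \<inter> {t. \<bar>t\<bar> < T0}) D'"
        by (rule continuous_on_eq[OF continuous_on_subset[OF D(2)]]) (auto simp: D'_def S'_def)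
      hence "continuous (at x within (({-T..T} - S') \<inter> {t. \<bar>t\<bar> < T0})) D'"
        using x True by (auto simp: continuous_on_eq_continuous_within)
      moreover have "at x within (({-T..T} - S') \<inter> {t. \<bar>t\<bar> < T0}) = at x within ({-T..T} - S')"
        using True o by (intro at_within_nhd[of x "{t. \<bar>t\<bar> < T0}"]) auto
      ultimately show ?thesis by simp
    next
      case False
      hence x': "\<bar>x\<bar> > T0" using x by (auto simp: S'_def)
      have o: "open {t. T0 < \<bar>t\<bar>}" by (intro open_Collect_less continuous_intros)
      have "continuous_on (({-T..T} - S') \<inter> {t. T0 < \<bar>t\<bar>}) D'"
        by (rule continuous_on_eq[of _ "\<lambda>_. \<i>"]) (auto simp: D'_def)
      hence "continuous (at x within (({-T..T} - S') \<inter> {t. T0 < \<bar>t\<bar>})) D'"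
        using x x' by (auto simp: continuous_on_eq_continuous_within)
      moreover have "at x within (({-T..T} - S') \<inter> {t. T0 < \<bar>t\<bar>}) = at x within ({-T..T} - S')"
        using x' o by (intro at_within_nhd[of x "{t. T0 < \<bar>t\<bar>}"]) auto
      ultimately show ?thesis by simp
    qed
    thus "continuous_on ({-T..T} - S') D'" by (simp add: continuous_on_eq_continuous_within)
  qed
  thus ?thesis using cont S by (auto simp: piecewise_C1_differentiable_on_def S'_def intro!: exI[of _ "S \<union> {-T0, T0}"])
qed

text \<open>The part of a curve over the window \<open>[-T, T]\<close>, reparametrised over \<open>[0, 1]\<close>, the
  parameter interval of paths.\<close>

definition stretch :: "(real \<Rightarrow> complex) \<Rightarrow> real \<Rightarrow> real \<Rightarrow> complex" where
  "stretch \<gamma> T s = \<gamma> (2 * T * s - T)"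

lemma stretch_image: "(T::real) > 0 \<Longrightarrow> (\<lambda>s. 2 * T * s - T) ` {0..1} = {-T..T}"
proof -
  assume T: "(T::real) > 0"
  have "(\<lambda>s. 2 * T * s + (- T)) ` {0..1} = {-T..T}"
    using T by (subst image_affinity_atLeastAtMost) auto
  thus ?thesis by simp
qed

lemma valid_path_stretch:
  assumes "\<gamma> piecewise_C1_differentiable_on {-T..T}" "T > 0"
  shows "valid_path (stretch \<gamma> T)"
proof -
  have "(\<gamma> \<circ> (\<lambda>x. (2 * T) *\<^sub>R x + (- T))) piecewise_C1_differentiable_on {0..1}"
    by (rule piecewise_C1_differentiable_affine) (use assms stretch_image[of T] in simp)
  thus ?thesis by (simp add: valid_path_def stretch_def[abs_def] o_def)
qed

lemma path_image_stretch: "T > 0 \<Longrightarrow> path_image (stretch \<gamma> T) = \<gamma> ` {-T..T}"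
  unfolding path_image_def stretch_def[abs_def] stretch_image[symmetric] by (simp only: image_image)

lemma has_contour_integral_stretch:
  assumes \<gamma>: "\<gamma> piecewise_C1_differentiable_on {-T..T}" and T: "T > 0"
    and I: "((\<lambda>t. f (\<gamma> t) * vector_derivative \<gamma> (at t)) has_integral I) {-T..T}"
  shows "(f has_contour_integral I) (stretch \<gamma> T)"
  unfolding has_contour_integral
proof -
  obtain S where S: "finite S" "\<gamma> C1_differentiable_on ({-T..T} - S)"
    using \<gamma> by (auto simp: piecewise_C1_differentiable_on_def)
  let ?l = "\<lambda>s. 2 * T * s - T"
  have "((\<lambda>s. f (\<gamma> ((2 * T) *\<^sub>R s + (- T))) * vector_derivative \<gamma> (at ((2 * T) *\<^sub>R s + (- T)))) has_integral (I /\<^sub>R (2 * T) ^ DIM(real)))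
      (cbox ((- T - - T) /\<^sub>R (2 * T)) ((T - - T) /\<^sub>R (2 * T)))"
    by (rule has_integral_affinity') (use I T in auto)
  hence "((\<lambda>s. f (\<gamma> (?l s)) * vector_derivative \<gamma> (at (?l s))) has_integral (I /\<^sub>R (2 * T))) {0..1}"
    using T by simp
  hence 1: "((\<lambda>s. (2 * T) *\<^sub>R (f (\<gamma> (?l s)) * vector_derivative \<gamma> (at (?l s)))) has_integral ((2 * T) *\<^sub>R (I /\<^sub>R (2 * T)))) {0..1}"
    by (rule has_integral_cmul)
  show "((\<lambda>s. f (stretch \<gamma> T s) * vector_derivative (stretch \<gamma> T) (at s)) has_integral I) {0..1}"
  proof (rule has_integral_spike_finite)
    show "finite ((\<lambda>t. (t + T) / (2 * T)) ` S)" using S by simp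
    show "((\<lambda>s. (2 * T) *\<^sub>R (f (\<gamma> (?l s)) * vector_derivative \<gamma> (at (?l s)))) has_integral I) {0..1}"
      using 1 T by simp
    fix s assume s: "s \<in> {0..1} - (\<lambda>t. (t + T) / (2 * T)) ` S"
    have "?l s \<notin> S"
    proof
      assume "?l s \<in> S"
      hence "(?l s + T) / (2 * T) \<in> (\<lambda>t. (t + T) / (2 * T)) ` S" by blast
      thus False using s T by simp
    qed
    moreover have "?l s \<in> {-T..T}" using s stretch_image[OF T] by blast
    ultimately have "\<gamma> differentiable at (?l s)" using S(2) by (auto simp: C1_differentiable_on_eq)
    hence "(\<gamma> has_vector_derivative vector_derivative \<gamma> (at (?l s))) (at (?l s))"
      by (simp add: vector_derivative_works)
    moreover have "(?l has_vector_derivative (2 * T)) (at s)"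
      by (auto intro!: derivative_eq_intros)
    ultimately have "((\<gamma> \<circ> ?l) has_vector_derivative (2 * T) *\<^sub>R vector_derivative \<gamma> (at (?l s))) (at s)"
      by (intro vector_diff_chain_at)
    hence "vector_derivative (stretch \<gamma> T) (at s) = (2 * T) *\<^sub>R vector_derivative \<gamma> (at (?l s))"
      by (simp add: vector_derivative_at stretch_def[abs_def] o_def)
    thus "f (stretch \<gamma> T s) * vector_derivative (stretch \<gamma> T) (at s)
        = (2 * T) *\<^sub>R (f (\<gamma> (?l s)) * vector_derivative \<gamma> (at (?l s)))"
      by (simp add: stretch_def)
  qed
qed

text \<open>In the open complement of the curve, connectedness gives a path to a point with real part below
  any prescribed \<open>y\<close>; its image is compact, hence inside every sufficiently large ball.\<close>

lemma left_of_bounded_path: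
  assumes cl: "closed (range \<gamma>)" and p: "p \<in> left_of \<gamma>"
  shows "\<forall>\<^sub>F B in at_top. \<exists>g. path g \<and> path_image g \<subseteq> - range \<gamma> \<inter> cball 0 B \<and> pathstart g = p
            \<and> pathfinish g \<in> {w. Re w < y}"
proof -
  have "\<forall>\<^sub>F x in at_bot. connected_component (- range \<gamma>) p (of_real x) \<and> x < y"
    using p unfolding left_of_def by (intro eventually_conj) (auto simp: eventually_at_bot_dense)
  then obtain x where x: "connected_component (- range \<gamma>) p (of_real x)" "x < y"
    by (metis (mono_tags, lifting) eventually_happens trivial_limit_at_bot_linorder)
  have "open (- range \<gamma>)" using cl by (rule open_Compl)
  hence "path_component (- range \<gamma>) p (of_real x)"
    using x(1) open_path_connected_component[of "- range \<gamma>"] by simp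
  then obtain g where g: "path g" "path_image g \<subseteq> - range \<gamma>" "pathstart g = p" "pathfinish g = of_real x"
    unfolding path_component_def by blast
  have "bounded (path_image g)" using g(1) by (rule bounded_path_image)
  then obtain B where B: "path_image g \<subseteq> cball 0 B"
    unfolding bounded_iff subset_iff mem_cball dist_0_norm by blast
  show ?thesis
    using eventually_ge_at_top[of B]
  proof eventually_elim
    case (elim B')
    have "cball 0 B \<subseteq> cball (0::complex) B'" using elim by auto
    thus ?case using g B x(2) by (intro exI[of _ g]) auto
  qed
qed

text \<open>The portion of the contour over \<open>[-T, T]\<close>, closed up by horizontal segments at height \<open>\<plusminus>T\<close> and the
  line \<open>Re w = x\<close>, has winding number \<open>0\<close> about each singularity \<open>p\<close>. If \<open>p\<close> lies to the left of the
  whole contour, this is clear. The finitely many other \<open>p\<close> can be joined to such points by paths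
  that avoid the contour and remain in a ball of radius \<open>B\<close>; taking \<open>x\<close> and \<open>T\<close> larger than \<open>B\<close>, these
  paths avoid the added sides too. Cauchy's theorem applies, and the horizontal sides vanish as
  \<open>T \<longlongrightarrow> \<infinity>\<close>.\<close>

theorem vertical_contour_integral_eq_line:
  assumes \<gamma>: "vertical_contour c \<gamma>" and hol: "f holomorphic_on - P" and P: "closed P"
    and fin: "\<And>x. finite {p \<in> P. x \<le> Re p}" and left: "P \<subseteq> left_of \<gamma>" and d: "vert_decay f"
    and I: "((\<lambda>t. f (\<gamma> t) * vector_derivative \<gamma> (at t)) has_integral I) UNIV"
  shows "\<forall>\<^sub>F x in at_top. I = \<i> * (\<integral>t. f (Complex x t) \<partial>lebesgue)"
proof -
  obtain T0 where T0: "T0 \<ge> 0" "\<gamma> piecewise_C1_differentiable_on {-T0..T0}" "\<And>t. T0 \<le> \<bar>t\<bar> \<Longrightarrow> \<gamma> t = Complex c t"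
    using \<gamma> unfolding vertical_contour_def by blast
  have pw: "\<gamma> piecewise_C1_differentiable_on {-T..T}" if "T \<ge> T0" for T
    using vertical_contour_piecewise_C1[OF T0(2,1,3) that] by simp
  have "compact (\<gamma> ` {-T0..T0})"
    using T0(2) by (intro compact_continuous_image) (auto simp: piecewise_C1_differentiable_on_def)
  hence cpt: "bounded (\<gamma> ` {-T0..T0})" "closed (\<gamma> ` {-T0..T0})" by (auto simp: compact_imp_bounded compact_imp_closed)
  have "range \<gamma> = \<gamma> ` {-T0..T0} \<union> {w. Re w = c \<and> T0 \<le> \<bar>Im w\<bar>}"
  proof (intro equalityI subsetI)
    fix w assume "w \<in> range \<gamma>"
    then obtain t where "w = \<gamma> t" by blast
    thus "w \<in> \<gamma> ` {-T0..T0} \<union> {w. Re w = c \<and> T0 \<le> \<bar>Im w\<bar>}"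
      using T0(3)[of t] by (cases "T0 \<le> \<bar>t\<bar>") (auto intro!: imageI)
  next
    fix w assume "w \<in> \<gamma> ` {-T0..T0} \<union> {w. Re w = c \<and> T0 \<le> \<bar>Im w\<bar>}"
    thus "w \<in> range \<gamma>"
    proof
      assume "w \<in> {w. Re w = c \<and> T0 \<le> \<bar>Im w\<bar>}"
      hence "w = \<gamma> (Im w)" using T0(3)[of "Im w"] by (simp add: complex_eq_iff)
      thus ?thesis by blast
    qed auto
  qed
  moreover have "closed {w. Re w = c \<and> T0 \<le> \<bar>Im w\<bar>}"
    by (intro closed_Collect_conj closed_Collect_eq closed_Collect_le continuous_intros)
  ultimately have clr: "closed (range \<gamma>)" using cpt(2) by auto
  obtain R where R: "\<And>t. \<bar>t\<bar> \<le> T0 \<Longrightarrow> norm (\<gamma> t) \<le> R"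
  proof -
    obtain R where "\<forall>x\<in>\<gamma> ` {-T0..T0}. norm x \<le> R" using cpt(1) unfolding bounded_iff by blast
    thus ?thesis by (intro that[of R]) (auto simp: abs_le_iff)
  qed
  \<comment> \<open>the whole contour lies in \<open>Re w \<ge> y\<close>\<close>
  define y where "y = min (- R) c"
  have y: "Re (\<gamma> t) \<ge> y" for t
  proof (cases "\<bar>t\<bar> \<le> T0")
    case True
    thus ?thesis using R[OF True] abs_Re_le_cmod[of "\<gamma> t"] by (auto simp: y_def)
  qed (use T0 in \<open>auto simp: y_def\<close>)
  have "\<forall>\<^sub>F B in at_top. \<forall>p\<in>{p\<in>P. y \<le> Re p}. \<exists>g. path g \<and> path_image g \<subseteq> - range \<gamma> \<inter> cball 0 B \<and> pathstart g = p
            \<and> pathfinish g \<in> {w. Re w < y}"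
    using left by (intro eventually_ball_finite fin ballI left_of_bounded_path[OF clr]) auto
  then obtain B where B: "\<And>p. p \<in> P \<Longrightarrow> y \<le> Re p \<Longrightarrow> \<exists>g. path g \<and> path_image g \<subseteq> - range \<gamma> \<inter> cball 0 B \<and> pathstart g = p
            \<and> pathfinish g \<in> {w. Re w < y}"
    using eventually_happens'[OF trivial_limit_at_top_linorder] by blast
  have cf: "continuous_on A f" if "A \<subseteq> - P" for A
    using holomorphic_on_imp_continuous_on[OF hol] continuous_on_subset that by blast
  show ?thesis
    using eventually_gt_at_top[of B] eventually_gt_at_top[of y]
  proof eventually_elim
    case (elim x)
    have PB: "norm p \<le> B" if pP: "p \<in> P" "y \<le> Re p" for p
    proof -
      obtain g where "path_image g \<subseteq> cball 0 B" "pathstart g = p" using B[OF pP] by auto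
      thus ?thesis by (metis dist_0_norm mem_cball pathstart_in_path_image subsetD)
    qed
    have line: "{w. Re w = x} \<subseteq> - P"
    proof
      fix w assume w: "w \<in> {w. Re w = x}"
      show "w \<in> - P" using PB[of w] w elim abs_Re_le_cmod[of w] by auto
    qed
    have ev: "\<forall>\<^sub>F T in at_top. integral {-T..T} (\<lambda>t. f (\<gamma> t) * vector_derivative \<gamma> (at t))
       + (contour_integral (linepath (Complex c T) (Complex x T)) f
       + (- contour_integral (linepath (Complex x (-T)) (Complex x T)) f
       + - contour_integral (linepath (Complex c (-T)) (Complex x (-T))) f)) = 0"
      using eventually_gt_at_top[of "max 0 (max B T0)"]
    proof eventually_elim
      case (elim T)
      hence T: "T > 0" "T > B" "T > T0" by auto
      define L where "L = (linepath (Complex c T) (Complex x T) +++ (linepath (Complex x T) (Complex x (-T)) +++ linepath (Complex x (-T)) (Complex c (-T))))"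
      define G where "G = stretch \<gamma> T +++ L"
      have ends: "pathfinish (stretch \<gamma> T) = Complex c T" "pathstart (stretch \<gamma> T) = Complex c (-T)"
        using T T0(3)[of T] T0(3)[of "-T"] by (auto simp: pathfinish_def pathstart_def stretch_def)
      have vs: "valid_path (stretch \<gamma> T)" using pw[of T] T by (intro valid_path_stretch) auto
      have vG: "valid_path G" "pathfinish G = pathstart G"
        unfolding G_def L_def using vs ends by (auto intro!: valid_path_join)
      have imL: "path_image L = closed_segment (Complex c T) (Complex x T) \<union> (closed_segment (Complex x T) (Complex x (-T)) \<union> closed_segment (Complex x (-T)) (Complex c (-T)))"
        unfolding L_def by (simp add: path_image_join)
      have imG: "path_image G = \<gamma> ` {-T..T} \<union> path_image L"
        unfolding G_def using ends T by (subst path_image_join) (auto simp: L_def path_image_stretch)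
      have cy: "y \<le> c" by (simp add: y_def)
      have L1: "\<bar>Im w\<bar> = T \<or> Re w = x" "y \<le> Re w" if "w \<in> path_image L" for w
        using that cy \<open>y < x\<close> T unfolding imL
        by (auto simp: closed_segment_same_Im closed_segment_same_Re closed_segment_eq_real_ivl split: if_splits)
      have LB: "norm w > B" if "w \<in> path_image L" for w
        using L1(1)[OF that] T \<open>B < x\<close> abs_Re_le_cmod[of w] abs_Im_le_cmod[of w] by auto
      have Gy: "path_image G \<subseteq> {w. y \<le> Re w}" using imG y L1(2) by auto
      have LP: "path_image L \<subseteq> - P" using LB PB L1(2) by force
      have GP: "path_image G \<subseteq> - P"
      proof -
        have "P \<inter> range \<gamma> = {}"
        proof -
          have "left_of \<gamma> \<subseteq> - range \<gamma>"
          proof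
            fix q assume "q \<in> left_of \<gamma>"
            hence "\<exists>u. connected_component (- range \<gamma>) q (of_real u)"
              unfolding left_of_def using eventually_happens'[OF trivial_limit_at_bot_linorder] by blast
            thus "q \<in> - range \<gamma>" using connected_component_in by blast
          qed
          thus ?thesis using left by blast
        qed
        thus ?thesis using imG LP by auto
      qed
      have wy: "winding_number G w = 0" if "Re w < y" for w
        using vG Gy that
        by (intro winding_number_zero_outside[of _ "{w. y \<le> Re w}"])
           (auto simp: valid_path_imp_path convex_halfspace_Re_ge)
      have wind: "winding_number G p = 0" if pP: "p \<notin> - P" for p
      proof (cases "Re p < y")
        case False
        then obtain g where g: "path g" "path_image g \<subseteq> - range \<gamma> \<inter> cball 0 B" "pathstart g = p" "Re (pathfinish g) < y"
          using B[of p] pP by auto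
        have "winding_number G p = winding_number G (pathfinish g)"
        proof (rule winding_number_eq[of _ _ "path_image g"])
          show "path_image g \<inter> path_image G = {}" using g(2) imG LB by fastforce
        qed (use vG g in \<open>auto simp: valid_path_imp_path connected_path_image\<close>)
        thus ?thesis using wy[OF g(4)] by simp
      qed (use wy in auto)
      have G0: "(f has_contour_integral 0) G"
        using P by (intro Cauchy_theorem_global[OF _ hol vG GP wind]) auto
      have Iint: "(\<lambda>t. f (\<gamma> t) * vector_derivative \<gamma> (at t)) integrable_on {-T..T}"
        using I by (meson has_integral_integrable integrable_on_subinterval subset_UNIV)
      have cs: "(f has_contour_integral integral {-T..T} (\<lambda>t. f (\<gamma> t) * vector_derivative \<gamma> (at t))) (stretch \<gamma> T)"
        using Iint T pw[of T] by (intro has_contour_integral_stretch) (auto simp: integrable_integral)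
      have i: "f contour_integrable_on linepath u v" if "closed_segment u v \<subseteq> path_image L" for u v
        using that LP by (intro contour_integrable_continuous_linepath cf) auto
      have lint: "f contour_integrable_on linepath (Complex c T) (Complex x T)"
         "f contour_integrable_on linepath (Complex x T) (Complex x (-T))"
         "f contour_integrable_on linepath (Complex x (-T)) (Complex c (-T))"
        by (rule i, use imL in blast)+
      have "contour_integral G f = integral {-T..T} (\<lambda>t. f (\<gamma> t) * vector_derivative \<gamma> (at t))
          + (contour_integral (linepath (Complex c T) (Complex x T)) f
          + (contour_integral (linepath (Complex x T) (Complex x (-T))) f
          + contour_integral (linepath (Complex x (-T)) (Complex c (-T))) f))"
        unfolding G_def L_def using lint cs vs
        by (simp add: contour_integrable_joinI valid_path_join has_contour_integral_integrable contour_integral_unique)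
      moreover have "contour_integral (linepath (Complex x T) (Complex x (-T))) f = - contour_integral (linepath (Complex x (-T)) (Complex x T)) f"
        "contour_integral (linepath (Complex x (-T)) (Complex c (-T))) f = - contour_integral (linepath (Complex c (-T)) (Complex x (-T))) f"
        by (rule contour_integral_reverse_linepath, rule cf, use LP imL in blast)+
      ultimately show ?case using contour_integral_unique[OF G0] by simp
    qed
    have inf: "filterlim (\<lambda>T::real. - T) at_infinity at_top" "filterlim (\<lambda>T::real. T) at_infinity at_top"
      by real_asymp+
    have "((\<lambda>T. integral {-T..T} (\<lambda>t. f (\<gamma> t) * vector_derivative \<gamma> (at t))
       + (contour_integral (linepath (Complex c T) (Complex x T)) f
       + (- contour_integral (linepath (Complex x (-T)) (Complex x T)) f
       + - contour_integral (linepath (Complex c (-T)) (Complex x (-T))) f))) \<longlongrightarrow>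
       I + (0 + (- (\<i> * (\<integral>t. f (Complex x t) \<partial>lebesgue)) + - 0))) at_top"
      by (intro tendsto_intros has_integral_UNIV_tendsto I contour_integral_horizontal_tendsto_0[OF d inf(1)]
          contour_integral_horizontal_tendsto_0[OF d inf(2)] contour_integral_vertical_tendsto[OF cf[OF line] d])
    hence "((\<lambda>T::real. 0) \<longlongrightarrow> I + (0 + (- (\<i> * (\<integral>t. f (Complex x t) \<partial>lebesgue)) + - 0))) at_top"
      by (rule Lim_transform_eventually[OF _ ev])
    thus ?case by (simp add: tendsto_const_iff)
  qed
qed

section \<open>The Fox H-function and Stirling expansions\<close>

lemma finite_Gamma_poles:
  assumes B: "(B::real) > 0"
  shows "finite {w. of_real B * w + l \<in> \<int>\<^sub>\<le>\<^sub>0 \<and> x \<le> Re w}"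
proof (rule finite_subset)
  let ?N = "nat \<lceil>Re (- l) - B * x\<rceil>"
  show "{w. of_real B * w + l \<in> \<int>\<^sub>\<le>\<^sub>0 \<and> x \<le> Re w} \<subseteq> (\<lambda>n. (- of_nat n - l) / of_real B) ` {..?N}"
  proof
    fix w assume w: "w \<in> {w. of_real B * w + l \<in> \<int>\<^sub>\<le>\<^sub>0 \<and> x \<le> Re w}"
    then obtain n where n: "of_real B * w + l = - of_nat n" by (auto elim!: nonpos_Ints_cases')
    hence "w = (- of_nat n - l) / of_real B" using B by (simp add: field_simps)
    moreover have "real n = Re (- l) - B * Re w" using arg_cong[OF n, of Re] by simp
    hence "real n \<le> Re (- l) - B * x" using w B mult_left_mono[of x "Re w" B] by auto
    hence "n \<le> ?N" by linarith
    ultimately show "w \<in> (\<lambda>n. (- of_nat n - l) / of_real B) ` {..?N}" by auto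
  qed
qed simp

lemma closed_Gamma_poles: "closed {w :: complex. of_real B * w + l \<in> \<int>\<^sub>\<le>\<^sub>0}"
proof -
  have "closed ((\<lambda>w :: complex. of_real B * w + l) -` \<int>\<^sub>\<le>\<^sub>0)"
    by (intro closed_vimage closed_nonpos_Ints continuous_intros)
  thus ?thesis by (simp add: vimage_def)
qed

text \<open>The shape of the \<open>H\<close>-functions at hand: three Gamma factors above, two below, all but the first
  with the same coefficient \<open>B = 1/\<nu>\<close> of \<open>w\<close>.\<close>

locale fox =
  fixes B :: real and u1 u2 l1 l2 z :: complex
  assumes B: "B > 0" and z: "Re z > 0"
begin

abbreviation "up \<equiv> [(u1, B), (u2, B)]"
abbreviation "lo \<equiv> [(0, 1), (l1, B), (l2, B)]"

text \<open>The factors are grouped so that \<open>\<Gamma>(w) z\<^bsup>-w\<^esup>\<close> decays and the two quotients grow polynomially.\<close>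

definition integrand :: "complex \<Rightarrow> complex" where
  "integrand w = Gamma w * z powr (- w) * (Gamma (of_real B * w + l1) * rGamma (of_real B * w + u1))
                 * (Gamma (of_real B * w + l2) * rGamma (of_real B * w + u2))"

definition poles :: "complex set" where
  "poles = {w. of_real 1 * w + 0 \<in> \<int>\<^sub>\<le>\<^sub>0} \<union> {w. of_real B * w + l1 \<in> \<int>\<^sub>\<le>\<^sub>0} \<union> {w. of_real B * w + l2 \<in> \<int>\<^sub>\<le>\<^sub>0}"

lemma foxH_integrand_eq: "foxH_integrand 3 0 up lo z w = integrand w"
  by (simp add: foxH_integrand_def integrand_def rGamma_inverse_Gamma field_simps)

lemma vert_decay_integrand: "vert_decay integrand"
  unfolding integrand_def[abs_def]
  by (intro vert_decay_mult_poly vert_decay_Gamma_powr vert_poly_Gamma_ratio B z)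

lemma holomorphic_integrand: "integrand holomorphic_on - poles"
  unfolding integrand_def[abs_def] using z
  by (intro holomorphic_intros) (auto simp: poles_def)

lemma closed_poles: "closed poles"
  unfolding poles_def by (intro closed_Un closed_Gamma_poles)

lemma finite_poles: "finite {p \<in> poles. x \<le> Re p}"
proof -
  have "{p \<in> poles. x \<le> Re p} = {w. of_real 1 * w + 0 \<in> \<int>\<^sub>\<le>\<^sub>0 \<and> x \<le> Re w} \<union> ({w. of_real B * w + l1 \<in> \<int>\<^sub>\<le>\<^sub>0 \<and> x \<le> Re w} \<union> {w. of_real B * w + l2 \<in> \<int>\<^sub>\<le>\<^sub>0 \<and> x \<le> Re w})"
    by (auto simp: poles_def)
  also have "finite \<dots>"
    using B by (intro finite_UnI finite_Gamma_poles) auto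
  finally show ?thesis .
qed

lemma foxH_contour_iff: "foxH_contour 3 0 up lo \<gamma> \<longleftrightarrow> (\<exists>c. vertical_contour c \<gamma>) \<and> poles \<subseteq> left_of \<gamma>"
  unfolding foxH_contour_def poles_def by (auto simp: case_prod_unfold)

text \<open>Two admissible contours can be compared with one common vertical line far enough to the right.\<close>

lemma has_foxH_unique:
  assumes "has_foxH 3 0 up lo z v1" "has_foxH 3 0 up lo z v2"
  shows "v1 = v2"
proof -
  have ev: "\<forall>\<^sub>F x in at_top. 2 * of_real pi * \<i> * v = \<i> * (\<integral>t. integrand (Complex x t) \<partial>lebesgue)"
    if v: "has_foxH 3 0 up lo z v" for v
  proof -
    obtain \<gamma> I where \<gamma>: "foxH_contour 3 0 up lo \<gamma>"
      "((\<lambda>t. integrand (\<gamma> t) * vector_derivative \<gamma> (at t)) has_integral I) UNIV"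
      "v = I / (2 * of_real pi * \<i>)"
      using v unfolding has_foxH_def foxH_integrand_eq by blast
    obtain c where "vertical_contour c \<gamma>" "poles \<subseteq> left_of \<gamma>" using \<gamma>(1) by (auto simp: foxH_contour_iff)
    from vertical_contour_integral_eq_line[OF this(1) holomorphic_integrand closed_poles finite_poles this(2) vert_decay_integrand \<gamma>(2)]
    show ?thesis by (simp add: \<gamma>(3))
  qed
  have "\<forall>\<^sub>F x :: real in at_top. 2 * of_real pi * \<i> * v1 = 2 * of_real pi * \<i> * v2"
    using ev[OF assms(1)] ev[OF assms(2)] by eventually_elim (simp only:)
  hence "2 * of_real pi * \<i> * v1 = 2 * of_real pi * \<i> * v2" by simp
  thus ?thesis by simp
qed

context
  assumes l1: "Re l1 > 0" and l2: "Re l2 > 0"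
begin

lemma poles_left: "poles \<subseteq> {w. Re w < 1/2}"
proof -
  have "Re w < 1/2" if w: "of_real B' * w + l \<in> \<int>\<^sub>\<le>\<^sub>0" "Re l \<ge> 0" "B' > 0" for B' w l
  proof -
    obtain n where n: "of_real B' * w + l = - of_nat n" using w(1) by (rule nonpos_Ints_cases')
    have "Re (of_real B' * w + l) \<le> 0" unfolding n by simp
    hence "B' * Re w \<le> 0" using w(2) by simp
    hence "Re w \<le> 0" using w(3) by (simp add: mult_le_0_iff)
    thus ?thesis by simp
  qed
  thus ?thesis unfolding poles_def using l1 l2 B by (fastforce intro: less_imp_le)
qed

lemma integrable_integrand: "integrable lebesgue (\<lambda>t. integrand (Complex (1/2) t))"
proof (rule integrable_vertical_line[OF _ vert_decay_integrand])
  show "continuous_on {w. Re w = 1/2} integrand"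
    by (rule continuous_on_subset[OF holomorphic_on_imp_continuous_on[OF holomorphic_integrand]]) (use poles_left in auto)
qed

lemma has_foxH_line: "has_foxH 3 0 up lo z ((\<integral>t. integrand (Complex (1/2) t) \<partial>lebesgue) / (2 * of_real pi))"
  unfolding has_foxH_def foxH_integrand_eq
proof (intro exI conjI)
  have cC: "continuous_on A (Complex (1/2))" for A :: "real set"
    by (intro continuous_on_Complex continuous_intros)
  have vd: "(Complex (1/2) has_vector_derivative \<i>) (at t)" for t
  proof -
    have "((\<lambda>t. of_real (1/2) + of_real t * \<i>) has_vector_derivative \<i>) (at t)"
      by (auto intro!: derivative_eq_intros)
    thus ?thesis
      by (rule has_vector_derivative_transform_within_open[of _ _ _ UNIV]) (auto simp: complex_eq_iff)
  qed
  have "vertical_contour (1/2) (Complex (1/2))"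
    unfolding vertical_contour_def piecewise_C1_differentiable_on_def
    by (intro exI[of _ 0] conjI exI[of _ "{0}"]) (auto simp: C1_differentiable_on_def cC)
  moreover have "poles \<subseteq> left_of (Complex (1/2))"
  proof
    fix p assume "p \<in> poles"
    hence p: "Re p < 1/2" using poles_left by auto
    show "p \<in> left_of (Complex (1/2))"
      unfolding left_of_def mem_Collect_eq
      using eventually_gt_at_bot[of "1/2 :: real"]
    proof eventually_elim
      case (elim x)
      have "connected {w :: complex. Re w < 1/2}"
        by (intro convex_connected convex_halfspace_Re_lt)
      moreover have "{w :: complex. Re w < 1/2} \<subseteq> - range (Complex (1/2))" by auto
      ultimately show ?case unfolding connected_component_def using p elim by (intro exI[of _ "{w. Re w < 1/2}"]) auto
    qed
  qed
  ultimately show "foxH_contour 3 0 up lo (Complex (1/2))" by (auto simp: foxH_contour_iff)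
  have "((\<lambda>t. integrand (Complex (1/2) t) * \<i>) has_integral ((\<integral>t. integrand (Complex (1/2) t) \<partial>lebesgue) * \<i>)) UNIV"
    by (intro has_integral_mult_left has_integral_integral_lebesgue integrable_integrand)
  thus "((\<lambda>t. integrand (Complex (1/2) t) * vector_derivative (Complex (1/2)) (at t)) has_integral ((\<integral>t. integrand (Complex (1/2) t) \<partial>lebesgue) * \<i>)) UNIV"
    by (simp add: vector_derivative_at[OF vd])
qed simp

lemma foxH_eq: "foxH 3 0 up lo z = (\<integral>t. integrand (Complex (1/2) t) \<partial>lebesgue) / (2 * of_real pi)"
  unfolding foxH_def using has_foxH_line has_foxH_unique by blast

lemma has_foxH_foxH: "has_foxH 3 0 up lo z (foxH 3 0 up lo z)"
  unfolding foxH_eq by (rule has_foxH_line)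

end
end

text \<open>The falling factorial \<open>x (x - 1) \<dots> (x - k + 1)\<close> is written as \<open>k!\<close> times a binomial coefficient.\<close>

lemma power_eq_sum_Stirling:
  "(of_nat x :: complex) ^ n = (\<Sum>k\<le>n. of_nat (Stirling n k) * of_nat (fact k * (x choose k)))"
proof (induction n)
  case (Suc n)
  have st: "x * (fact k * (x choose k)) = fact (Suc k) * (x choose Suc k) + k * (fact k * (x choose k))" for k
  proof (cases "k \<le> x")
    case True
    have "Suc k * (x choose Suc k) = (x - k) * (x choose k)"
      by (simp only: binomial_absorption binomial_absorb_comp)
    moreover have "fact (Suc k) * (x choose Suc k) = fact k * (Suc k * (x choose Suc k))"
      by (simp only: fact_Suc mult_ac of_nat_id)
    ultimately have "fact (Suc k) * (x choose Suc k) = fact k * ((x - k) * (x choose k))" by simp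
    moreover have "x = (x - k) + k" using True by simp
    ultimately show ?thesis by (metis (no_types, lifting) distrib_right mult.left_commute)
  qed (simp add: binomial_eq_0)
  let ?F = "\<lambda>k. fact k * (x choose k)"
  have "(\<Sum>k\<le>Suc n. Stirling (Suc n) k * ?F k) = (\<Sum>k\<le>n. Stirling (Suc n) (Suc k) * ?F (Suc k))"
    by (subst sum.atMost_Suc_shift) simp
  also have "\<dots> = (\<Sum>k\<le>n. Suc k * Stirling n (Suc k) * ?F (Suc k)) + (\<Sum>k\<le>n. Stirling n k * ?F (Suc k))"
    by (simp only: Stirling.simps distrib_right sum.distrib)
  also have "(\<Sum>k\<le>n. Suc k * Stirling n (Suc k) * ?F (Suc k)) = (\<Sum>k\<le>Suc n. k * Stirling n k * ?F k)"
    by (simp only: sum.atMost_Suc_shift mult_0 add_0)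
  also have "\<dots> = (\<Sum>k\<le>n. k * Stirling n k * ?F k)" by simp
  also have "\<dots> + (\<Sum>k\<le>n. Stirling n k * ?F (Suc k)) = (\<Sum>k\<le>n. x * (Stirling n k * ?F k))"
    unfolding sum.distrib[symmetric]
  proof (intro sum.cong refl)
    fix k
    show "k * Stirling n k * ?F k + Stirling n k * ?F (Suc k) = x * (Stirling n k * ?F k)"
      using arg_cong[OF st[of k], of "\<lambda>y. Stirling n k * y"] by (simp add: algebra_simps)
  qed
  also have "\<dots> = x * (\<Sum>k\<le>n. Stirling n k * ?F k)" by (simp add: sum_distrib_left)
  finally have "x * (\<Sum>k\<le>n. Stirling n k * ?F k) = (\<Sum>k\<le>Suc n. Stirling (Suc n) k * ?F k)" by simp
  moreover have "(of_nat x :: complex) ^ Suc n = of_nat (x * (\<Sum>k\<le>n. Stirling n k * ?F k))"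
    using Suc by simp
  ultimately show ?case by (simp only: of_nat_sum of_nat_mult)
qed simp

text \<open>The defining polynomial identity of the \<open>\<sigma>\<^sub>i\<close>, with powers of \<open>k\<close> rewritten in falling factorials.\<close>

lemma prod_pochhammer_shift_eq:
  "(\<Prod>j=1..r. pochhammer (f j + of_nat k) (m j))
     = (\<Sum>i\<le>msum r m. A_coeff r f m i * of_nat (fact i * (k choose i)))"
proof -
  let ?M = "msum r m"
  let ?t = "\<lambda>j i. sigma r f m (?M - j) * (of_nat (Stirling j i) * of_nat (fact i * (k choose i)))"
  have "(\<Prod>j=1..r. pochhammer (f j + of_nat k) (m j)) = (\<Sum>j\<le>?M. \<Sum>i\<le>j. ?t j i)"
    unfolding sigma_identity power_eq_sum_Stirling sum_distrib_left ..
  also have "\<dots> = (\<Sum>j\<le>?M. \<Sum>i\<le>?M. ?t j i)"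
    by (intro sum.cong refl sum.mono_neutral_left) auto
  also have "\<dots> = (\<Sum>i\<le>?M. \<Sum>j\<le>?M. ?t j i)" by (rule sum.swap)
  also have "\<dots> = (\<Sum>i\<le>?M. \<Sum>j=i..?M. ?t j i)"
    by (intro sum.cong refl sum.mono_neutral_right) auto
  also have "\<dots> = (\<Sum>i\<le>?M. A_coeff r f m i * of_nat (fact i * (k choose i)))"
    unfolding A_coeff_def sum_distrib_right by (simp only: mult_ac)
  finally show ?thesis .
qed

lemma A_coeff_0: "A_coeff r f m 0 = (\<Prod>j=1..r. pochhammer (f j) (m j))"
proof -
  have "(\<Sum>i\<le>msum r m. A_coeff r f m i * of_nat (fact i * (0 choose i))) = (\<Sum>i\<in>{0}. A_coeff r f m i * of_nat (fact i * (0 choose i)))"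
    by (intro sum.mono_neutral_right) auto
  thus ?thesis using prod_pochhammer_shift_eq[of f 0 m r] by simp
qed

section \<open>The Mellin transform of the hypergeometric kernel\<close>

definition hyper_coeff ::
  "nat \<Rightarrow> (nat \<Rightarrow> complex) \<Rightarrow> (nat \<Rightarrow> nat) \<Rightarrow> complex \<Rightarrow> complex \<Rightarrow> complex \<Rightarrow> nat \<Rightarrow> complex" where
  "hyper_coeff r f m \<mu> a b k =
     pochhammer a k * pochhammer b k * (\<Prod>j=1..r. pochhammer (f j + of_nat (m j)) k)
       / (pochhammer \<mu> k * (\<Prod>j=1..r. pochhammer (f j) k)) / fact k"

lemma hypergeo_eq: "hypergeo r f m \<mu> a b z = (\<Sum>k. hyper_coeff r f m \<mu> a b k * z ^ k)"
  unfolding hypergeo_def hyper_coeff_def by (intro suminf_cong) simp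

lemma borel_measurable_hypergeo [measurable (raw)]:
  assumes [measurable]: "g \<in> borel_measurable M"
  shows "(\<lambda>x. hypergeo r f m \<mu> a b (g x)) \<in> borel_measurable M"
  unfolding hypergeo_eq by measurable

text \<open>Because \<open>(f\<^sub>j + m\<^sub>j)\<^sub>k / (f\<^sub>j)\<^sub>k = (f\<^sub>j + k)\<^bsub>m\<^sub>j\<^esub> / (f\<^sub>j)\<^bsub>m\<^sub>j\<^esub>\<close> is a polynomial in \<open>k\<close>, the series is a
  combination of Gauss series weighted by falling factorials.\<close>

lemma hyper_coeff_eq:
  assumes "\<And>j. j \<in> {1..r} \<Longrightarrow> f j \<notin> \<int>\<^sub>\<le>\<^sub>0"
  shows "hyper_coeff r f m \<mu> a b k =
     (\<Sum>i\<le>msum r m. A_coeff r f m i / A_coeff r f m 0 * of_nat (fact i * (k choose i)) * gauss_term a b \<mu> k)"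
proof -
  have nz: "pochhammer (f j) n \<noteq> 0" if "j \<in> {1..r}" for j n
    using assms[OF that] pochhammer_eq_0_imp_nonpos_Int by blast
  have sw: "pochhammer (f j + of_nat (m j)) k / pochhammer (f j) k = pochhammer (f j + of_nat k) (m j) / pochhammer (f j) (m j)"
    if "j \<in> {1..r}" for j
    using nz[OF that] pochhammer_product'[of "f j" k "m j"] pochhammer_product'[of "f j" "m j" k]
    by (simp add: divide_simps add.commute mult_ac)
  have "(\<Prod>j=1..r. pochhammer (f j + of_nat (m j)) k) / (\<Prod>j=1..r. pochhammer (f j) k)
      = (\<Prod>j=1..r. pochhammer (f j + of_nat k) (m j)) / A_coeff r f m 0"
    unfolding A_coeff_0 prod_dividef[symmetric] by (intro prod.cong refl sw)
  moreover have aux: "x * y * N / (q * D) / F = X * (x * y / (q * F))" if "N / D = X" for x y N q D F X :: complex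
    unfolding that[symmetric] by (simp add: mult_ac)
  ultimately have "hyper_coeff r f m \<mu> a b k = (\<Prod>j=1..r. pochhammer (f j + of_nat k) (m j)) / A_coeff r f m 0 * gauss_term a b \<mu> k"
    unfolding hyper_coeff_def gauss_term_def by (intro aux)
  also have "\<dots> = (\<Sum>i\<le>msum r m. A_coeff r f m i / A_coeff r f m 0 * of_nat (fact i * (k choose i)) * gauss_term a b \<mu> k)"
    unfolding prod_pochhammer_shift_eq sum_divide_distrib sum_distrib_right by (intro sum.cong) auto
  finally show ?thesis .
qed

lemma hyper_coeff_bound:
  assumes "\<And>j. j \<in> {1..r} \<Longrightarrow> f j \<notin> \<int>\<^sub>\<le>\<^sub>0" and \<mu>: "\<mu> \<notin> \<int>\<^sub>\<le>\<^sub>0"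
  obtains K where "K > 0"
    "\<And>k. norm (hyper_coeff r f m \<mu> a b k) \<le> K * real (Suc k) powr (real (msum r m) + Re (a + b - \<mu>) - 1)"
proof -
  obtain K where K: "K > 0" "\<And>k. norm (gauss_term a b \<mu> k) \<le> K * real (Suc k) powr (Re (a + b - \<mu>) - 1)"
    using gauss_term_bound[OF \<mu>] by blast
  let ?M = "msum r m"
  define S where "S = (\<Sum>i\<le>?M. norm (A_coeff r f m i / A_coeff r f m 0)) + 1"
  have S: "S > 0" unfolding S_def by (intro add_nonneg_pos sum_nonneg) auto
  have "norm (hyper_coeff r f m \<mu> a b k) \<le> (S * K) * real (Suc k) powr (real ?M + Re (a + b - \<mu>) - 1)" for k
  proof -
    have ff: "real (fact i * (k choose i)) \<le> real (Suc k) powr real ?M" if "i \<le> ?M" for i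
    proof -
      have "fact i * (k choose i) \<le> k ^ i"
        using binomial_fact_pow[of k i] by (simp add: mult.commute)
      also have "\<dots> \<le> Suc k ^ i" by (intro power_mono) auto
      also have "\<dots> \<le> Suc k ^ ?M" using that by (intro power_increasing) auto
      finally have "real (fact i * (k choose i)) \<le> real (Suc k ^ ?M)" by (rule of_nat_mono)
      thus ?thesis by (simp add: powr_realpow del: of_nat_Suc)
    qed
    have hc: "hyper_coeff r f m \<mu> a b k =
       (\<Sum>i\<le>?M. A_coeff r f m i / A_coeff r f m 0 * of_nat (fact i * (k choose i)) * gauss_term a b \<mu> k)"
      by (rule hyper_coeff_eq) (rule assms(1))
    have "norm (hyper_coeff r f m \<mu> a b k) \<le>
       (\<Sum>i\<le>?M. norm (A_coeff r f m i / A_coeff r f m 0 * of_nat (fact i * (k choose i)) * gauss_term a b \<mu> k))"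
      unfolding hc by (rule norm_sum)
    also have "\<dots> \<le> (\<Sum>i\<le>?M. norm (A_coeff r f m i / A_coeff r f m 0) * (real (Suc k) powr real ?M * (K * real (Suc k) powr (Re (a + b - \<mu>) - 1))))"
    proof (intro sum_mono)
      fix i assume i: "i \<in> {..?M}"
      have "norm (A_coeff r f m i / A_coeff r f m 0 * of_nat (fact i * (k choose i)) * gauss_term a b \<mu> k)
          = norm (A_coeff r f m i / A_coeff r f m 0) * (real (fact i * (k choose i)) * norm (gauss_term a b \<mu> k))"
        by (simp only: norm_mult norm_of_nat mult.assoc)
      also have "\<dots> \<le> norm (A_coeff r f m i / A_coeff r f m 0) * (real (Suc k) powr real ?M * (K * real (Suc k) powr (Re (a + b - \<mu>) - 1)))"
        using i by (intro mult_left_mono mult_mono ff K) auto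
      finally show "norm (A_coeff r f m i / A_coeff r f m 0 * of_nat (fact i * (k choose i)) * gauss_term a b \<mu> k) \<le> \<dots>" .
    qed
    also have "\<dots> = (S - 1) * (K * (real (Suc k) powr real ?M * real (Suc k) powr (Re (a + b - \<mu>) - 1)))"
      unfolding sum_distrib_right[symmetric] S_def by simp
    also have "real (Suc k) powr real ?M * real (Suc k) powr (Re (a + b - \<mu>) - 1) = real (Suc k) powr (real ?M + Re (a + b - \<mu>) - 1)"
      unfolding powr_add[symmetric] by (simp add: algebra_simps)
    also have "(S - 1) * (K * real (Suc k) powr (real ?M + Re (a + b - \<mu>) - 1)) \<le> S * (K * real (Suc k) powr (real ?M + Re (a + b - \<mu>) - 1))"
      using K(1) by (intro mult_right_mono) auto
    finally show ?thesis by (simp only: mult.assoc)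
  qed
  thus ?thesis using S K(1) that[of "S * K"] by simp
qed

lemma summable_powr_geometric:
  fixes x s :: real
  assumes "0 < x" "x < 1"
  shows "summable (\<lambda>k. real (Suc k) powr s * x ^ k)"
proof -
  have "(\<lambda>k. real (Suc k) powr (s + 2) * x ^ k) \<longlonglongrightarrow> 0" using assms by real_asymp
  hence "Bseq (\<lambda>k. real (Suc k) powr (s + 2) * x ^ k)" by (intro convergent_imp_Bseq convergentI)
  then obtain K where K: "K > 0" "\<And>k. norm (real (Suc k) powr (s + 2) * x ^ k) \<le> K" by (auto elim: BseqE)
  show ?thesis
  proof (rule summable_comparison_test')
    show "summable (\<lambda>k. K * real (Suc k) powr (-2))" by (intro summable_mult summable_Suc_powr) auto
    fix k
    have "real (Suc k) powr s * x ^ k = (real (Suc k) powr (s + 2) * x ^ k) * real (Suc k) powr (-2)"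
      by (simp add: powr_add powr_minus del: of_nat_Suc)
    also have "\<dots> \<le> K * real (Suc k) powr (-2)"
      using K(2)[of k] by (intro mult_right_mono) auto
    finally show "norm (real (Suc k) powr s * x ^ k) \<le> K * real (Suc k) powr (-2)"
      using assms by simp
  qed
qed

lemma gauss_term_shift:
  assumes "\<gamma> \<notin> \<int>\<^sub>\<le>\<^sub>0"
  shows "of_nat (fact i * ((k + i) choose i)) * gauss_term a b \<gamma> (k + i)
     = pochhammer a i * pochhammer b i / pochhammer \<gamma> i * gauss_term (a + of_nat i) (b + of_nat i) (\<gamma> + of_nat i) k"
proof -
  have "fact i * fact k * ((k + i) choose i) = (fact (k + i) :: nat)"
    using binomial_fact_lemma[of i "k + i"] by simp
  hence "of_nat (fact i * fact k * ((k + i) choose i)) = (of_nat (fact (k + i)) :: complex)" by (simp only:)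
  hence "of_nat (fact i * ((k + i) choose i)) / fact (k + i) = (1 / fact k :: complex)"
    by (simp add: field_simps)
  hence e: "of_nat (fact i * ((k + i) choose i)) * (X / (Y * fact (k + i))) = X / (Y * fact k)" for X Y :: complex
  proof -
    assume H: "of_nat (fact i * ((k + i) choose i)) / fact (k + i) = (1 / fact k :: complex)"
    have "n * (X / (Y * F)) = n / F * (X / Y)" for n F :: complex
      by (simp only: times_divide_eq_left times_divide_eq_right divide_divide_eq_left mult_ac)
    hence "of_nat (fact i * ((k + i) choose i)) * (X / (Y * fact (k + i))) = 1 / fact k * (X / Y)"
      by (simp only: H)
    thus ?thesis by (simp add: mult.commute)
  qed
  show ?thesis unfolding gauss_term_def e
    by (simp add: add.commute[of k i] pochhammer_product' mult_ac)
qed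

text \<open>The falling factorial cancels against \<open>k!\<close>, which turns the series, after an index shift by \<open>i\<close>,
  into the Gauss series with all parameters raised by \<open>i\<close>.\<close>

lemma gauss_term_ffact_sums:
  assumes \<gamma>: "Re \<gamma> > 0" and pos: "Re (\<gamma> - a - b - of_nat i) > 0"
  shows "(\<lambda>k. of_nat (fact i * (k choose i)) * gauss_term a b \<gamma> k) sums
     (pochhammer a i * pochhammer b i * (Gamma \<gamma> * Gamma (\<gamma> - a - b - of_nat i) * rGamma (\<gamma> - a) * rGamma (\<gamma> - b)))"
proof -
  have n: "\<gamma> \<notin> \<int>\<^sub>\<le>\<^sub>0" "\<gamma> + of_nat i \<notin> \<int>\<^sub>\<le>\<^sub>0" using \<gamma> by (auto intro!: Re_pos_not_nonpos_Int)
  have "gauss_term (a + of_nat i) (b + of_nat i) (\<gamma> + of_nat i) sums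
     (Gamma (\<gamma> + of_nat i) * Gamma (\<gamma> + of_nat i - (a + of_nat i) - (b + of_nat i))
        * rGamma (\<gamma> + of_nat i - (a + of_nat i)) * rGamma (\<gamma> + of_nat i - (b + of_nat i)))"
    using pos by (intro gauss_summation n) (simp add: algebra_simps)
  also have "\<gamma> + of_nat i - (a + of_nat i) - (b + of_nat i) = \<gamma> - a - b - of_nat i" by simp
  also have "\<gamma> + of_nat i - (a + of_nat i) = \<gamma> - a" by simp
  also have "\<gamma> + of_nat i - (b + of_nat i) = \<gamma> - b" by simp
  also have "Gamma (\<gamma> + of_nat i) = pochhammer \<gamma> i * Gamma \<gamma>"
    using pochhammer_Gamma[OF n(1), of i] n by (simp add: Gamma_eq_zero_iff)
  finally have "(\<lambda>k. pochhammer a i * pochhammer b i / pochhammer \<gamma> i * gauss_term (a + of_nat i) (b + of_nat i) (\<gamma> + of_nat i) k) sums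
      (pochhammer a i * pochhammer b i / pochhammer \<gamma> i * (pochhammer \<gamma> i * Gamma \<gamma> * Gamma (\<gamma> - a - b - of_nat i) * rGamma (\<gamma> - a) * rGamma (\<gamma> - b)))"
    by (rule sums_mult)
  moreover have "pochhammer \<gamma> i \<noteq> 0" using n(1) pochhammer_eq_0_imp_nonpos_Int by blast
  ultimately have "(\<lambda>k. of_nat (fact i * ((k + i) choose i)) * gauss_term a b \<gamma> (k + i)) sums
      (pochhammer a i * pochhammer b i * (Gamma \<gamma> * Gamma (\<gamma> - a - b - of_nat i) * rGamma (\<gamma> - a) * rGamma (\<gamma> - b)))"
    unfolding gauss_term_shift[OF n(1)] by (simp add: mult_ac)
  moreover have "(\<Sum>k<i. of_nat (fact i * (k choose i)) * gauss_term a b \<gamma> k) = 0"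
    by (rule sum.neutral) simp
  ultimately show ?thesis
    using sums_iff_shift'[of "\<lambda>k. of_nat (fact i * (k choose i)) * gauss_term a b \<gamma> k" i] by simp
qed

text \<open>Up to powers of \<open>x\<close> and \<open>t\<close>, the kernel of both integral operators in the variable
  \<open>u = (t/x)\<^sup>\<nu>\<close> respectively \<open>u = (x/t)\<^sup>\<nu>\<close>.\<close>

definition mellin_kernel ::
  "nat \<Rightarrow> (nat \<Rightarrow> complex) \<Rightarrow> (nat \<Rightarrow> nat) \<Rightarrow> complex \<Rightarrow> complex \<Rightarrow> complex \<Rightarrow> real \<Rightarrow> complex" where
  "mellin_kernel r f m \<mu> a b u = of_real (1 - u) powr (\<mu> - 1) * hypergeo r f m \<mu> a b (of_real (1 - u))"

text \<open>Each term of the series integrates to \<open>C\<^sub>k B(c, \<mu> + k)\<close>, and the Gamma quotients change the lower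
  parameter of the Gauss terms from \<open>\<mu>\<close> to \<open>c + \<mu>\<close>. Termwise integration is justified by absolute
  convergence: \<open>\<bar>C\<^sub>k\<bar>\<close> is at most of size \<open>k\<^bsup>m + Re (a+b-\<mu>) - 1\<^esup>\<close> and the Beta value of size \<open>k\<^bsup>-Re c\<^esup>\<close>, so
  the series of moments converges by the assumption on \<open>c + p\<^sub>m\<close>.\<close>

theorem mellin_kernel_transform:
  assumes f: "\<And>j. j \<in> {1..r} \<Longrightarrow> f j \<notin> \<int>\<^sub>\<le>\<^sub>0" and \<mu>: "Re \<mu> > 0" and c: "Re c > 0"
    and cp: "Re (c + frak_p \<mu> a b (msum r m)) > 0"
  shows "set_integrable lebesgue {0<..<1} (\<lambda>u. mellin_kernel r f m \<mu> a b u * of_real u powr (c - 1))"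
    and "(LINT u:{0<..<1}|lebesgue. mellin_kernel r f m \<mu> a b u * of_real u powr (c - 1)) =
      Gamma \<mu> * (\<Sum>i\<le>msum r m. A_coeff r f m i / A_coeff r f m 0 * pochhammer a i * pochhammer b i *
        (Gamma c * rGamma (c + \<mu> - a) * (Gamma (c + frak_p \<mu> a b i) * rGamma (c + \<mu> - b))))"
proof -
  define C where "C = hyper_coeff r f m \<mu> a b"
  let ?M = "msum r m"
  have \<mu>n: "\<mu> \<notin> \<int>\<^sub>\<le>\<^sub>0" using \<mu> by (rule Re_pos_not_nonpos_Int)
  obtain K where K: "K > 0" "\<And>k. norm (C k) \<le> K * real (Suc k) powr (real ?M + Re (a + b - \<mu>) - 1)"
    unfolding C_def using hyper_coeff_bound[of r f \<mu> m a b] f \<mu>n by blast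
  define g where "g = (\<lambda>k u. C k * (complex_of_real u powr (c - 1) * complex_of_real (1 - u) powr (\<mu> + of_nat k - 1)))"
  have g_eq: "g k u = of_real (1 - u) powr (\<mu> - 1) * of_real u powr (c - 1) * (C k * of_real (1 - u) ^ k)" if "u < 1" for k u
    using that by (simp add: g_def powr_add powr_diff powr_nat' mult_ac flip: powr_nat of_real_diff)
  have \<mu>k: "Re (\<mu> + of_nat k) > 0" for k using \<mu> by simp
  have int: "set_integrable lebesgue {0<..<1} (g k)" for k
    unfolding g_def by (intro set_integrable_mult_right Beta_integral_complex c \<mu>k)
  have abs: "summable (\<lambda>k. norm (C k * of_real (1 - u) ^ k))" if "u \<in> {0<..<1}" for u
  proof (rule summable_comparison_test')
    show "summable (\<lambda>k. K * (real (Suc k) powr (real ?M + Re (a + b - \<mu>) - 1) * (1 - u) ^ k))"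
      using that by (intro summable_mult summable_powr_geometric) auto
    show "norm (norm (C k * of_real (1 - u) ^ k)) \<le> K * (real (Suc k) powr (real ?M + Re (a + b - \<mu>) - 1) * (1 - u) ^ k)" for k
      using mult_right_mono[OF K(2)[of k], of "(1 - u) ^ k"] that
      by (simp add: norm_mult norm_power mult.assoc del: of_nat_Suc of_real_diff)
  qed
  have abs': "summable (\<lambda>k. norm (g k u))" if "u \<in> {0<..<1}" for u
  proof -
    have "summable (\<lambda>k. norm (of_real (1 - u) powr (\<mu> - 1) * of_real u powr (c - 1)) * norm (C k * of_real (1 - u) ^ k))"
      by (intro summable_mult abs that)
    thus ?thesis using that by (simp add: g_eq norm_mult del: of_real_diff)
  qed
  have nint: "(LINT u:{0<..<1}|lebesgue. norm (g k u)) = norm (C k) * Beta (Re c) (Re \<mu> + real k)" for k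
  proof -
    have s: "set_integrable lebesgue {0<..<1} (\<lambda>u. complex_of_real u powr (of_real (Re c) - 1) * complex_of_real (1 - u) powr (of_real (Re \<mu> + real k) - 1))"
      "(LINT u:{0<..<1}|lebesgue. complex_of_real u powr (of_real (Re c) - 1) * complex_of_real (1 - u) powr (of_real (Re \<mu> + real k) - 1)) = Beta (of_real (Re c)) (of_real (Re \<mu> + real k))"
      using c \<mu> by (auto intro!: Beta_integral_complex simp del: of_real_add of_real_diff)
    have e: "complex_of_real (Re c) - 1 = of_real (Re c - 1)"
      "complex_of_real (Re \<mu> + real k) - 1 = of_real (Re \<mu> + real k - 1)" by simp_all
    have "of_real (LINT u:{0<..<1}|lebesgue. norm (g k u)) = (LINT u:{0<..<1}|lebesgue. complex_of_real (norm (g k u)))"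
      by (simp add: set_lebesgue_integral_def scaleR_conv_of_real flip: integral_of_real of_real_mult)
    also have "\<dots> = (LINT u:{0<..<1}|lebesgue. of_real (norm (C k)) * (complex_of_real u powr (of_real (Re c) - 1) * complex_of_real (1 - u) powr (of_real (Re \<mu> + real k) - 1)))"
      unfolding e by (intro set_lebesgue_integral_cong)
         (auto simp: g_def norm_mult norm_of_real_powr powr_of_real[symmetric] simp del: of_real_diff)
    also have "\<dots> = of_real (norm (C k)) * Beta (of_real (Re c)) (of_real (Re \<mu> + real k))"
      using s(2) by simp
    also have "\<dots> = of_real (norm (C k) * Beta (Re c) (Re \<mu> + real k))"
      by (simp only: Beta_complex_of_real of_real_mult)
    finally show ?thesis by (simp only: of_real_eq_iff)
  qed
  have sn: "summable (\<lambda>k. LINT u:{0<..<1}|lebesgue. norm (g k u))"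
  proof -
    define x where "x = complex_of_real (Re c)"
    define y where "y = complex_of_real (Re \<mu>)"
    have yn: "y \<notin> \<int>\<^sub>\<le>\<^sub>0" "x + y \<notin> \<int>\<^sub>\<le>\<^sub>0" using \<mu> c by (auto simp: x_def y_def intro!: Re_pos_not_nonpos_Int)
    obtain L where L: "L > 0" "\<And>k. norm (gauss_term y 1 (x + y) k) \<le> L * real (Suc k) powr (Re (y + 1 - (x + y)) - 1)"
      using gauss_term_bound[OF yn(2)] by blast
    \<comment> \<open>\<open>(y)\<^sub>k / (x + y)\<^sub>k\<close> is a Gauss term with second parameter \<open>1\<close>, so its size is known\<close>
    have Bk: "Beta x (y + of_nat k) = Beta x y * gauss_term y 1 (x + y) k" for k
    proof -
      have p: "pochhammer (x + y) k \<noteq> 0" using yn(2) pochhammer_eq_0_imp_nonpos_Int by blast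
      have 1: "Gamma (y + of_nat k) = pochhammer y k * Gamma y"
        using pochhammer_Gamma[OF yn(1), of k] yn(1) by (simp add: Gamma_eq_zero_iff)
      have 2: "rGamma (x + y) = pochhammer (x + y) k * rGamma (x + (y + of_nat k))"
        using pochhammer_rGamma[of "x + y" k] by (simp add: add.assoc)
      show ?thesis unfolding Beta_altdef gauss_term_def 1 2 using p
        by (simp add: pochhammer_fact[symmetric])
    qed
    have le: "Beta (Re c) (Re \<mu> + real k) \<le> norm (Beta x y) * (L * real (Suc k) powr (- Re c))" for k
    proof -
      have "Beta (Re c) (Re \<mu> + real k) \<le> norm (complex_of_real (Beta (Re c) (Re \<mu> + real k)))" by simp
      also have "complex_of_real (Beta (Re c) (Re \<mu> + real k)) = Beta x (y + of_nat k)"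
        unfolding Beta_complex_of_real[symmetric] by (simp add: x_def y_def)
      also have "norm \<dots> \<le> norm (Beta x y) * (L * real (Suc k) powr (- Re c))"
        unfolding Bk norm_mult using L(2)[of k] by (intro mult_left_mono) (auto simp: x_def)
      finally show ?thesis .
    qed
    have B0: "Beta (Re c) (Re \<mu> + real k) \<ge> 0" for k
      using c \<mu> unfolding Beta_def by (intro divide_nonneg_nonneg mult_nonneg_nonneg Gamma_real_nonneg) auto
    show ?thesis unfolding nint
    proof (rule summable_comparison_test')
    show "summable (\<lambda>k. K * (norm (Beta x y) * L) * real (Suc k) powr (real ?M + Re (a + b - \<mu>) - 1 + (- Re c)))"
      using cp by (intro summable_mult summable_Suc_powr) (simp add: frak_p_def)
    fix k
    have "norm (norm (C k) * Beta (Re c) (Re \<mu> + real k)) = norm (C k) * Beta (Re c) (Re \<mu> + real k)"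
      using B0[of k] by simp
    also have "\<dots> \<le> (K * real (Suc k) powr (real ?M + Re (a + b - \<mu>) - 1)) * (norm (Beta x y) * (L * real (Suc k) powr (- Re c)))"
      using K by (intro mult_mono K le B0) auto
    also have "\<dots> = K * (norm (Beta x y) * L) * real (Suc k) powr (real ?M + Re (a + b - \<mu>) - 1 + (- Re c))"
      by (simp only: powr_add mult_ac)
    finally show "norm (norm (C k) * Beta (Re c) (Re \<mu> + real k)) \<le> K * (norm (Beta x y) * L) * real (Suc k) powr (real ?M + Re (a + b - \<mu>) - 1 + (- Re c))" .
    qed
  qed
  have ev: "set_integrable lebesgue {0<..<1} (\<lambda>x. \<Sum>k. g k x)"
    "(\<lambda>k. LINT x:{0<..<1}|lebesgue. g k x) sums (LINT x:{0<..<1}|lebesgue. (\<Sum>k. g k x))"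
    by (rule set_integral_sums[OF int abs' sn]; simp)+
  have gs: "(\<Sum>k. g k u) = mellin_kernel r f m \<mu> a b u * of_real u powr (c - 1)" if "u \<in> {0<..<1}" for u
  proof -
    have "(\<Sum>k. g k u) = (\<Sum>k. of_real (1 - u) powr (\<mu> - 1) * of_real u powr (c - 1) * (C k * of_real (1 - u) ^ k))"
      using that by (intro suminf_cong g_eq) auto
    also have "\<dots> = of_real (1 - u) powr (\<mu> - 1) * of_real u powr (c - 1) * (\<Sum>k. C k * of_real (1 - u) ^ k)"
      by (rule suminf_mult[OF summable_norm_cancel[OF abs[OF that]]])
    finally show ?thesis by (simp add: mellin_kernel_def hypergeo_eq C_def)
  qed
  show "set_integrable lebesgue {0<..<1} (\<lambda>u. mellin_kernel r f m \<mu> a b u * of_real u powr (c - 1))"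
    using ev(1) by (rule set_integrable_cong[THEN iffD1, rotated -1]) (auto simp: gs)
  have gk: "(LINT x:{0<..<1}|lebesgue. g k x) = C k * Beta c (\<mu> + of_nat k)" for k
    unfolding g_def using Beta_integral_complex(2)[OF c \<mu>k[of k]] by simp
  define \<gamma> where "\<gamma> = c + \<mu>"
  have \<gamma>: "Re \<gamma> > 0" using c \<mu> by (simp add: \<gamma>_def)
  have \<gamma>n: "\<gamma> \<notin> \<int>\<^sub>\<le>\<^sub>0" using \<gamma> by (rule Re_pos_not_nonpos_Int)
  have CB: "C k * Beta c (\<mu> + of_nat k) = (\<Sum>i\<le>?M. Gamma c * Gamma \<mu> * rGamma \<gamma> * (A_coeff r f m i / A_coeff r f m 0) * (of_nat (fact i * (k choose i)) * gauss_term a b \<gamma> k))" for k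
  proof -
    have p: "pochhammer \<mu> k \<noteq> 0" "pochhammer \<gamma> k \<noteq> 0"
      using \<mu>n \<gamma>n pochhammer_eq_0_imp_nonpos_Int by blast+
    have "Gamma (\<mu> + of_nat k) = pochhammer \<mu> k * Gamma \<mu>"
      using pochhammer_Gamma[OF \<mu>n, of k] \<mu>n by (simp add: Gamma_eq_zero_iff)
    moreover have "rGamma (\<gamma> + of_nat k) = rGamma \<gamma> / pochhammer \<gamma> k"
      using pochhammer_rGamma[of \<gamma> k] p by simp
    ultimately have "gauss_term a b \<mu> k * Beta c (\<mu> + of_nat k) = Gamma c * Gamma \<mu> * rGamma \<gamma> * gauss_term a b \<gamma> k"
      using p by (simp add: Beta_altdef gauss_term_def \<gamma>_def add.assoc mult_ac)
    hence h: "X * gauss_term a b \<mu> k * Beta c (\<mu> + of_nat k) = Gamma c * Gamma \<mu> * rGamma \<gamma> * X * gauss_term a b \<gamma> k" for X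
      by (metis (no_types, opaque_lifting) mult.assoc mult.commute)
    have Ck: "C k = (\<Sum>i\<le>?M. A_coeff r f m i / A_coeff r f m 0 * of_nat (fact i * (k choose i)) * gauss_term a b \<mu> k)"
      unfolding C_def by (rule hyper_coeff_eq) (rule f)
    show ?thesis unfolding Ck sum_distrib_right
    proof (intro sum.cong refl)
      fix i
      show "A_coeff r f m i / A_coeff r f m 0 * of_nat (fact i * (k choose i)) * gauss_term a b \<mu> k * Beta c (\<mu> + of_nat k)
          = Gamma c * Gamma \<mu> * rGamma \<gamma> * (A_coeff r f m i / A_coeff r f m 0) * (of_nat (fact i * (k choose i)) * gauss_term a b \<gamma> k)"
        using h[of "A_coeff r f m i / A_coeff r f m 0 * of_nat (fact i * (k choose i))"] by (simp only: mult.assoc)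
    qed
  qed
  have "(\<lambda>k. C k * Beta c (\<mu> + of_nat k)) sums
      (\<Sum>i\<le>?M. Gamma c * Gamma \<mu> * rGamma \<gamma> * (A_coeff r f m i / A_coeff r f m 0) *
         (pochhammer a i * pochhammer b i * (Gamma \<gamma> * Gamma (\<gamma> - a - b - of_nat i) * rGamma (\<gamma> - a) * rGamma (\<gamma> - b))))"
    unfolding CB
  proof (intro sums_sum sums_mult gauss_term_ffact_sums \<gamma>)
    fix i assume "i \<in> {..?M}"
    thus "Re (\<gamma> - a - b - of_nat i) > 0" using cp by (simp add: \<gamma>_def frak_p_def)
  qed
  hence "(LINT x:{0<..<1}|lebesgue. (\<Sum>k. g k x)) = (\<Sum>i\<le>?M. Gamma c * Gamma \<mu> * rGamma \<gamma> * (A_coeff r f m i / A_coeff r f m 0) *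
         (pochhammer a i * pochhammer b i * (Gamma \<gamma> * Gamma (\<gamma> - a - b - of_nat i) * rGamma (\<gamma> - a) * rGamma (\<gamma> - b))))"
    using ev(2) sums_unique2 unfolding gk by blast
  also have "\<dots> = (\<Sum>i\<le>?M. Gamma \<mu> * (A_coeff r f m i / A_coeff r f m 0 * pochhammer a i * pochhammer b i *
        (Gamma c * rGamma (c + \<mu> - a) * (Gamma (c + frak_p \<mu> a b i) * rGamma (c + \<mu> - b)))))"
  proof (intro sum.cong refl)
    fix i
    have g1: "rGamma \<gamma> * Gamma \<gamma> = 1" using \<gamma>n by (simp add: rGamma_inverse_Gamma Gamma_eq_zero_iff)
    have "\<gamma> - a - b - of_nat i = c + frak_p \<mu> a b i" by (simp add: \<gamma>_def frak_p_def algebra_simps)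
    hence "Gamma c * Gamma \<mu> * rGamma \<gamma> * X * (pochhammer a i * pochhammer b i * (Gamma \<gamma> * Gamma (\<gamma> - a - b - of_nat i) * rGamma (\<gamma> - a) * rGamma (\<gamma> - b)))
        = (rGamma \<gamma> * Gamma \<gamma>) * (Gamma \<mu> * (X * pochhammer a i * pochhammer b i * (Gamma c * rGamma (c + \<mu> - a) * (Gamma (c + frak_p \<mu> a b i) * rGamma (c + \<mu> - b)))))" for X
      by (simp only: \<gamma>_def mult_ac)
    thus "Gamma c * Gamma \<mu> * rGamma \<gamma> * (A_coeff r f m i / A_coeff r f m 0) *
         (pochhammer a i * pochhammer b i * (Gamma \<gamma> * Gamma (\<gamma> - a - b - of_nat i) * rGamma (\<gamma> - a) * rGamma (\<gamma> - b)))
        = Gamma \<mu> * (A_coeff r f m i / A_coeff r f m 0 * pochhammer a i * pochhammer b i *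
        (Gamma c * rGamma (c + \<mu> - a) * (Gamma (c + frak_p \<mu> a b i) * rGamma (c + \<mu> - b))))"
      unfolding g1 by simp
  qed
  also have "\<dots> = Gamma \<mu> * (\<Sum>i\<le>?M. A_coeff r f m i / A_coeff r f m 0 * pochhammer a i * pochhammer b i *
        (Gamma c * rGamma (c + \<mu> - a) * (Gamma (c + frak_p \<mu> a b i) * rGamma (c + \<mu> - b))))"
    by (simp only: sum_distrib_left)
  also have "(LINT x:{0<..<1}|lebesgue. (\<Sum>k. g k x)) = (LINT u:{0<..<1}|lebesgue. mellin_kernel r f m \<mu> a b u * of_real u powr (c - 1))"
    by (intro set_lebesgue_integral_cong) (auto simp: gs)
  finally show "(LINT u:{0<..<1}|lebesgue. mellin_kernel r f m \<mu> a b u * of_real u powr (c - 1)) =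
      Gamma \<mu> * (\<Sum>i\<le>?M. A_coeff r f m i / A_coeff r f m 0 * pochhammer a i * pochhammer b i *
        (Gamma c * rGamma (c + \<mu> - a) * (Gamma (c + frak_p \<mu> a b i) * rGamma (c + \<mu> - b))))" .
qed

section \<open>The kernel as a sum of H-functions\<close>

text \<open>Working with Fubini's theorem on the completed measure allows \<open>\<phi>\<close> to be merely Lebesgue measurable.\<close>

lemma sigma_finite_lebesgue: "sigma_finite_measure (lebesgue :: 'a :: euclidean_space measure)"
proof
  obtain A :: "'a set set" where A: "countable A" "A \<subseteq> sets lborel" "\<Union> A = space lborel" "\<forall>a\<in>A. emeasure lborel a \<noteq> \<infinity>"
    using lborel.sigma_finite_countable by blast
  have "emeasure lebesgue a = emeasure lborel a" if "a \<in> A" for a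
    using A(2) that by (simp add: subset_iff sets_completionI_sets)
  thus "\<exists>A :: 'a set set. countable A \<and> A \<subseteq> sets lebesgue \<and> \<Union> A = space lebesgue \<and> (\<forall>a\<in>A. emeasure lebesgue a \<noteq> \<infinity>)"
    using A by (intro exI[of _ A]) (auto intro: sets_completionI_sets)
qed

interpretation lebesgue: sigma_finite_measure "lebesgue :: real measure"
  by (rule sigma_finite_lebesgue)
interpretation lebesgue_pair: pair_sigma_finite "lebesgue :: real measure" "lebesgue :: real measure" ..

lemma measurable_fst_lebesgue [measurable]: "fst \<in> borel_measurable (lebesgue \<Otimes>\<^sub>M lebesgue)"
  and measurable_snd_lebesgue [measurable]: "snd \<in> borel_measurable (lebesgue \<Otimes>\<^sub>M lebesgue)"
  by (rule measurable_compose[OF measurable_fst measurable_ident_lebesgue]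
           measurable_compose[OF measurable_snd measurable_ident_lebesgue])+

lemma powr_mult_of_real:
  assumes "y > 0" "z \<noteq> 0"
  shows "(z * complex_of_real y) powr w = z powr w * exp (w * of_real (ln y))"
  using assms by (simp add: powr_def Ln_times_of_real Ln_of_real mult.commute[of z] exp_add distrib_left)

text \<open>In the application \<open>c\<close> is \<open>c\<^sub>2(l)\<close>; the assumption on it makes the Mellin moments finite.\<close>

locale kernel_params =
  fixes r :: nat and f :: "nat \<Rightarrow> complex" and m :: "nat \<Rightarrow> nat" and \<mu> a b c :: complex and \<nu> :: real
  assumes f: "\<And>j. j \<in> {1..r} \<Longrightarrow> f j \<notin> \<int>\<^sub>\<le>\<^sub>0" and \<mu>: "Re \<mu> > 0" and \<nu>: "\<nu> > 0"
    and c_gt: "Re c > - min 0 (Re (frak_p \<mu> a b (msum r m)))"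
begin

lemma c_pos: "Re c > 0" and cp_pos: "Re (c + frak_p \<mu> a b (msum r m)) > 0"
  using c_gt by (auto simp: min_def split: if_splits)

lemma cpi_pos: "i \<le> msum r m \<Longrightarrow> Re (c + frak_p \<mu> a b i) > 0"
  using cp_pos by (auto simp: frak_p_def intro: less_le_trans)

definition G :: "real \<Rightarrow> complex" where
  "G u = mellin_kernel r f m \<mu> a b u * of_real u powr (c - 1)"

lemma G_measurable [measurable]: "(\<lambda>x. G (g x)) \<in> borel_measurable M" if [measurable]: "g \<in> borel_measurable M"
  unfolding G_def mellin_kernel_def by measurable

lemma G_integrable: "set_integrable lebesgue {0<..<1} G"
  unfolding G_def by (rule mellin_kernel_transform(1)[OF f \<mu> c_pos cp_pos])

lemma
  assumes w: "Re w \<ge> 0"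
  shows G_mellin_integrable: "set_integrable lebesgue {0<..<1} (\<lambda>u. G u * exp (w / of_real \<nu> * of_real (ln u)))"
    and G_mellin: "(LINT u:{0<..<1}|lebesgue. G u * exp (w / of_real \<nu> * of_real (ln u))) =
      Gamma \<mu> * (\<Sum>i\<le>msum r m. A_coeff r f m i / A_coeff r f m 0 * pochhammer a i * pochhammer b i *
        (Gamma (of_real (1 / \<nu>) * w + c) * rGamma (of_real (1 / \<nu>) * w + (c + \<mu> - a))
         * (Gamma (of_real (1 / \<nu>) * w + (c + frak_p \<mu> a b i)) * rGamma (of_real (1 / \<nu>) * w + (c + \<mu> - b)))))"
proof -
  define c' where "c' = of_real (1 / \<nu>) * w + c"
  have "Re (of_real (1 / \<nu>) * w) \<ge> 0" using w \<nu> by simp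
  hence c': "Re c' > 0" "Re (c' + frak_p \<mu> a b (msum r m)) > 0"
    using c_pos cp_pos by (auto simp: c'_def simp del: of_real_divide)
  have eq: "G u * exp (w / of_real \<nu> * of_real (ln u)) = mellin_kernel r f m \<mu> a b u * of_real u powr (c' - 1)"
    if "u \<in> {0<..<1}" for u
  proof -
    have "complex_of_real u powr (c' - 1) = exp ((c - 1) * of_real (ln u) + w / of_real \<nu> * of_real (ln u))"
      using that by (subst of_real_powr_pos) (auto simp: c'_def algebra_simps)
    thus ?thesis using that by (simp add: G_def exp_add of_real_powr_pos)
  qed
  show "set_integrable lebesgue {0<..<1} (\<lambda>u. G u * exp (w / of_real \<nu> * of_real (ln u)))"
  proof -
    have "set_integrable lebesgue {0<..<1} (\<lambda>u. G u * exp (w / of_real \<nu> * of_real (ln u)))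
        = set_integrable lebesgue {0<..<1} (\<lambda>u. mellin_kernel r f m \<mu> a b u * of_real u powr (c' - 1))"
      by (rule set_integrable_cong[OF refl refl eq])
    moreover have "set_integrable lebesgue {0<..<1} (\<lambda>u. mellin_kernel r f m \<mu> a b u * of_real u powr (c' - 1))"
      by (rule mellin_kernel_transform(1)[OF f \<mu> c'])
    ultimately show ?thesis by (simp only:)
  qed
  have "(LINT u:{0<..<1}|lebesgue. G u * exp (w / of_real \<nu> * of_real (ln u)))
      = (LINT u:{0<..<1}|lebesgue. mellin_kernel r f m \<mu> a b u * of_real u powr (c' - 1))"
    by (intro set_lebesgue_integral_cong allI impI eq) auto
  also have "\<dots> = Gamma \<mu> * (\<Sum>i\<le>msum r m. A_coeff r f m i / A_coeff r f m 0 * pochhammer a i * pochhammer b i *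
        (Gamma c' * rGamma (c' + \<mu> - a) * (Gamma (c' + frak_p \<mu> a b i) * rGamma (c' + \<mu> - b))))"
    by (rule mellin_kernel_transform(2)[OF f \<mu> c'])
  finally show "(LINT u:{0<..<1}|lebesgue. G u * exp (w / of_real \<nu> * of_real (ln u))) =
      Gamma \<mu> * (\<Sum>i\<le>msum r m. A_coeff r f m i / A_coeff r f m 0 * pochhammer a i * pochhammer b i *
        (Gamma (of_real (1 / \<nu>) * w + c) * rGamma (of_real (1 / \<nu>) * w + (c + \<mu> - a))
         * (Gamma (of_real (1 / \<nu>) * w + (c + frak_p \<mu> a b i)) * rGamma (of_real (1 / \<nu>) * w + (c + \<mu> - b)))))"
    by (simp only: c'_def add.assoc add_diff_eq)
qed

text \<open>For \<open>u \<in> (0, 1)\<close> the Cahen--Mellin integral of \<open>exp(- z u\<^bsup>-1/\<nu>\<^esup>)\<close> contains \<open>u\<close> only through \<open>u\<^bsup>w/\<nu>\<^esup>\<close>. On the line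
  \<open>Re w = 1/2\<close> the absolute values of the double integrand split into a function of \<open>u\<close> times one of
  \<open>Im w\<close>, so the order of integration may be exchanged, and the integral over \<open>u\<close> is the Mellin
  transform at \<open>c + w/\<nu>\<close>.\<close>

theorem sum_foxH_eq:
  assumes z: "Re z > 0"
  defines "up \<equiv> [(c + \<mu> - a, 1 / \<nu>), (c + \<mu> - b, 1 / \<nu>)]"
    and "lo \<equiv> \<lambda>i. [(0, 1), (c, 1 / \<nu>), (c + frak_p \<mu> a b i, 1 / \<nu>)]"
  shows "i \<le> msum r m \<Longrightarrow> has_foxH 3 0 up (lo i) z (foxH 3 0 up (lo i) z)"
    and "(\<Sum>i\<le>msum r m. A_coeff r f m i / A_coeff r f m 0 * pochhammer a i * pochhammer b i * foxH 3 0 up (lo i) z)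
       = (LINT u:{0<..<1}|lebesgue. G u * exp (- z * of_real (u powr (- (1 / \<nu>))))) / Gamma \<mu>"
proof -
  let ?M = "msum r m"
  define k where "k = (\<lambda>i. A_coeff r f m i / A_coeff r f m 0 * pochhammer a i * pochhammer b i)"
  interpret fox "1 / \<nu>" "c + \<mu> - a" "c + \<mu> - b" c "c + frak_p \<mu> a b i" z for i
    by unfold_locales (use z \<nu> in auto)
  have znz: "z \<noteq> 0" using z by auto
  show "has_foxH 3 0 up (lo i) z (foxH 3 0 up (lo i) z)" if "i \<le> msum r m"
    unfolding up_def lo_def using has_foxH_foxH[OF c_pos cpi_pos[OF that]] .
  define w where "w = (\<lambda>t. Complex (1/2) t)"
  define E where "E = (\<lambda>t. Gamma (w t) * z powr (- w t))"
  have CM: "integrable lebesgue E" unfolding E_def w_def by (rule Cahen_Mellin(1)[OF z])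
  have E_meas [measurable]: "E \<in> borel_measurable lebesgue" using CM by simp
  \<comment> \<open>\<open>1/2 + i t\<close> instead of \<open>Complex (1/2) t\<close> makes joint measurability evident\<close>
  define F where "F = (\<lambda>u t. (indicator {0<..<1} u *\<^sub>R G u) * (E t * exp ((1/2 + \<i> * of_real t) / of_real \<nu> * of_real (ln u))))"
  have w_eq: "1/2 + \<i> * of_real t = w t" for t by (simp add: w_def complex_eq_iff)
  have F_eq: "F u t = (indicator {0<..<1} u *\<^sub>R G u) * (E t * exp (w t / of_real \<nu> * of_real (ln u)))" for u t
    unfolding F_def w_eq ..
  have nF: "norm (F u t) = norm (indicator {0<..<1} u *\<^sub>R (G u * exp ((1/2) / of_real \<nu> * of_real (ln u)))) * norm (E t)" for u t
    unfolding F_eq by (simp add: norm_mult w_def)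
  have Fint: "integrable (lebesgue \<Otimes>\<^sub>M lebesgue) (case_prod F)"
  proof (rule lebesgue_pair.Fubini_integrable)
    show "case_prod F \<in> borel_measurable (lebesgue \<Otimes>\<^sub>M lebesgue)"
      unfolding F_def case_prod_unfold by measurable
    have "integrable lebesgue (\<lambda>u. indicator {0<..<1} u *\<^sub>R (G u * exp ((1/2) / of_real \<nu> * of_real (ln u))))"
      using G_mellin_integrable[of "1/2"] by (simp add: set_integrable_def)
    hence "integrable lebesgue (\<lambda>u. norm (indicator {0<..<1} u *\<^sub>R (G u * exp ((1/2) / of_real \<nu> * of_real (ln u)))) * (\<integral>t. norm (E t) \<partial>lebesgue))"
      by (intro integrable_mult_left integrable_norm)
    thus "integrable lebesgue (\<lambda>u. \<integral>t. norm (case (u, t) of (x, y) \<Rightarrow> F x y) \<partial>lebesgue)"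
      by (simp only: prod.case nF integral_mult_right_zero)
    show "AE u in lebesgue. integrable lebesgue (\<lambda>t. case (u, t) of (x, y) \<Rightarrow> F x y)"
    proof (rule AE_I2)
      fix u
      have "integrable lebesgue (\<lambda>t. F u t)"
      proof (rule Bochner_Integration.integrable_bound)
        show "integrable lebesgue (\<lambda>t. norm (indicator {0<..<1} u *\<^sub>R (G u * exp ((1/2) / of_real \<nu> * of_real (ln u)))) * norm (E t))"
          using CM by (intro integrable_mult_right integrable_norm)
        show "(\<lambda>t. F u t) \<in> borel_measurable lebesgue" unfolding F_def by measurable
      qed (simp add: nF)
      thus "integrable lebesgue (\<lambda>t. case (u, t) of (x, y) \<Rightarrow> F x y)" by simp
    qed
  qed
  have inner_t: "(\<integral>t. F u t \<partial>lebesgue) = indicator {0<..<1} u *\<^sub>R (2 * of_real pi * (G u * exp (- z * of_real (u powr (- (1 / \<nu>))))))" for u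
  proof (cases "u \<in> {0<..<1}")
    case True
    define y where "y = u powr (- (1 / \<nu>))"
    have y: "y > 0" using True by (simp add: y_def)
    have "E t * exp (w t / of_real \<nu> * of_real (ln u)) = Gamma (w t) * (z * of_real y) powr (- w t)" for t
      using True y znz by (simp add: powr_mult_of_real E_def y_def ln_powr)
    hence "(\<integral>t. F u t \<partial>lebesgue) = (\<integral>t. G u * (Gamma (w t) * (z * of_real y) powr (- w t)) \<partial>lebesgue)"
      unfolding F_eq using True by simp
    also have "\<dots> = G u * (2 * of_real pi * exp (- (z * of_real y)))"
      using Cahen_Mellin(2)[of "z * of_real y"] z y by (simp add: w_def)
    finally show ?thesis using True by (simp add: y_def)
  qed (simp add: F_eq)
  have inner_u: "(\<integral>u. F u t \<partial>lebesgue) = Gamma \<mu> * (\<Sum>i\<le>?M. k i * integrand i (w t))" for t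
  proof -
    have "(\<integral>u. F u t \<partial>lebesgue) = (\<integral>u. E t * (indicator {0<..<1} u *\<^sub>R (G u * exp (w t / of_real \<nu> * of_real (ln u)))) \<partial>lebesgue)"
      unfolding F_eq by (intro Bochner_Integration.integral_cong refl) (simp add: scaleR_conv_of_real mult_ac)
    also have "\<dots> = E t * (LINT u:{0<..<1}|lebesgue. G u * exp (w t / of_real \<nu> * of_real (ln u)))"
      unfolding set_lebesgue_integral_def by (rule integral_mult_right_zero)
    also have "\<dots> = Gamma \<mu> * (\<Sum>i\<le>?M. k i * integrand i (w t))"
      by (subst G_mellin) (auto simp: w_def E_def k_def integrand_def sum_distrib_left mult_ac intro!: sum.cong)
    finally show ?thesis .
  qed
  have ii: "integrable lebesgue (\<lambda>t. integrand i (w t))" if "i \<le> ?M" for i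
    unfolding w_def by (rule integrable_integrand[OF c_pos cpi_pos[OF that]])
  have "(\<integral>u. (\<integral>t. F u t \<partial>lebesgue) \<partial>lebesgue) = (\<integral>t. (\<integral>u. F u t \<partial>lebesgue) \<partial>lebesgue)"
    by (rule lebesgue_pair.Fubini_integral[OF Fint, symmetric])
  also have "(\<integral>u. (\<integral>t. F u t \<partial>lebesgue) \<partial>lebesgue) = 2 * of_real pi * (LINT u:{0<..<1}|lebesgue. G u * exp (- z * of_real (u powr (- (1 / \<nu>)))))"
    unfolding inner_t set_lebesgue_integral_def[symmetric] by simp
  also have "(\<integral>t. (\<integral>u. F u t \<partial>lebesgue) \<partial>lebesgue) = Gamma \<mu> * (\<Sum>i\<le>?M. k i * (\<integral>t. integrand i (w t) \<partial>lebesgue))"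
    unfolding inner_u using ii by (subst integral_mult_right_zero) (simp add: Bochner_Integration.integral_sum)
  also have "\<dots> = Gamma \<mu> * (\<Sum>i\<le>?M. k i * (2 * of_real pi * foxH 3 0 up (lo i) z))"
    unfolding up_def lo_def w_def by (intro arg_cong2[of _ _ _ _ "(*)"] sum.cong refl)
       (use foxH_eq[OF c_pos cpi_pos] in simp)
  also have "\<dots> = 2 * of_real pi * (Gamma \<mu> * (\<Sum>i\<le>?M. k i * foxH 3 0 up (lo i) z))"
    by (simp add: sum_distrib_left mult_ac)
  finally have "(LINT u:{0<..<1}|lebesgue. G u * exp (- z * of_real (u powr (- (1 / \<nu>))))) = Gamma \<mu> * (\<Sum>i\<le>?M. k i * foxH 3 0 up (lo i) z)"
    by simp
  moreover have "Gamma \<mu> \<noteq> 0" using Re_pos_not_nonpos_Int[OF \<mu>] by (simp add: Gamma_eq_zero_iff)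
  ultimately show "(\<Sum>i\<le>?M. A_coeff r f m i / A_coeff r f m 0 * pochhammer a i * pochhammer b i * foxH 3 0 up (lo i) z)
       = (LINT u:{0<..<1}|lebesgue. G u * exp (- z * of_real (u powr (- (1 / \<nu>))))) / Gamma \<mu>"
    by (simp add: k_def)
qed

end

lemma
  fixes F :: "real \<Rightarrow> 'a :: euclidean_space"
  assumes x: "x > 0" and \<nu>: "\<nu> > 0"
  shows substitution_integrable_iff: "set_integrable lebesgue {x<..} F \<longleftrightarrow>
      set_integrable lebesgue {0<..<1} (\<lambda>u. (x / \<nu> * u powr (- (1 / \<nu>) - 1)) *\<^sub>R F (x * u powr (- (1 / \<nu>))))"
    and substitution_integral: "set_integrable lebesgue {x<..} F \<Longrightarrow>
      (LINT t:{x<..}|lebesgue. F t) = (LINT u:{0<..<1}|lebesgue. (x / \<nu> * u powr (- (1 / \<nu>) - 1)) *\<^sub>R F (x * u powr (- (1 / \<nu>))))"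
proof -
  define g where "g = (\<lambda>u. x * u powr (- (1 / \<nu>)))"
  define g' where "g' = (\<lambda>u. - (x / \<nu> * u powr (- (1 / \<nu>) - 1)))"
  have deriv: "(g has_field_derivative g' u) (at u within {0<..<1})" if "u \<in> {0<..<1}" for u
    using that unfolding g_def g'_def by (auto intro!: derivative_eq_intros)
  have inj: "inj_on g {0<..<1}"
  proof (rule inj_onI)
    fix u v assume uv: "u \<in> {0<..<1}" "v \<in> {0<..<1}" "g u = g v"
    hence "(u powr (- (1 / \<nu>))) powr (- \<nu>) = (v powr (- (1 / \<nu>))) powr (- \<nu>)" using x by (simp add: g_def)
    thus "u = v" using uv \<nu> by (simp add: powr_powr)
  qed
  have img: "g ` {0<..<1} = {x<..}"
  proof (intro equalityI subsetI)
    fix t assume "t \<in> g ` {0<..<1}"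
    then obtain u where u: "u \<in> {0<..<1}" "t = g u" by blast
    have "u powr (1 / \<nu>) < 1 powr (1 / \<nu>)" using u \<nu> by (intro powr_less_mono2) auto
    hence "1 < u powr (- (1 / \<nu>))" using u by (simp add: powr_minus one_less_inverse)
    thus "t \<in> {x<..}" using u x by (simp add: g_def)
  next
    fix t assume t: "t \<in> {x<..}"
    have "(x / t) powr \<nu> < 1 powr \<nu>" using t x \<nu> by (intro powr_less_mono2) auto
    hence "(x / t) powr \<nu> \<in> {0<..<1}" using t x by auto
    moreover have "g ((x / t) powr \<nu>) = t" using t x \<nu> by (simp add: g_def powr_powr powr_minus)
    ultimately show "t \<in> g ` {0<..<1}" by (metis image_eqI)
  qed
  have abs: "\<bar>g' u\<bar> = x / \<nu> * u powr (- (1 / \<nu>) - 1)" for u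
    using x \<nu> by (simp add: g'_def abs_mult)
  note cov = has_absolute_integral_change_of_variables_real[of "{0<..<1}" g g' F, OF _ deriv inj, unfolded img abs]
  show iff: "set_integrable lebesgue {x<..} F \<longleftrightarrow>
      set_integrable lebesgue {0<..<1} (\<lambda>u. (x / \<nu> * u powr (- (1 / \<nu>) - 1)) *\<^sub>R F (x * u powr (- (1 / \<nu>))))"
    using cov unfolding g_def by auto
  assume F: "set_integrable lebesgue {x<..} F"
  have "integral {0<..<1} (\<lambda>u. (x / \<nu> * u powr (- (1 / \<nu>) - 1)) *\<^sub>R F (x * u powr (- (1 / \<nu>)))) = integral {x<..} F"
    using cov[of "integral {x<..} F"] F unfolding g_def by auto
  thus "(LINT t:{x<..}|lebesgue. F t) = (LINT u:{0<..<1}|lebesgue. (x / \<nu> * u powr (- (1 / \<nu>) - 1)) *\<^sub>R F (x * u powr (- (1 / \<nu>))))"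
    using F iff by (simp add: set_lebesgue_integral_eq_integral)
qed

text \<open>All bases are positive, so every power is the exponential of a multiple of \<open>ln x\<close>, \<open>ln u\<close> or
  \<open>ln (1 - u)\<close>, and the identity reduces to comparing exponents.\<close>

lemma J_integrand_substitution:
  assumes x: "x > 0" and \<nu>: "\<nu> > 0" and u: "u \<in> {0<..<1}"
  shows "(x / \<nu> * u powr (- (1 / \<nu>) - 1)) *\<^sub>R J_integrand h \<nu> \<mu> \<delta> a b r f m (pow_exp l s) x (x * u powr (- (1 / \<nu>)))
    = of_real x powr (l - \<delta>) / (of_real \<nu> * of_real (x powr (\<nu> * h + \<nu> - 1))) *
        (mellin_kernel r f m \<mu> a b u * of_real u powr (frak_c2 h \<nu> \<delta> l - 1) * exp (- (s * of_real x) * of_real (u powr (- (1 / \<nu>)))))"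
proof -
  define X where "X = ln x"
  define U where "U = ln u"
  define V where "V = ln (1 - u)"
  define t where "t = x * u powr (- (1 / \<nu>))"
  have t: "t > 0" "ln t = X - U / \<nu>" using x u by (auto simp: t_def X_def U_def ln_mult ln_powr)
  have "(u powr (- (1 / \<nu>))) powr \<nu> = u powr (- 1)" unfolding powr_powr using \<nu> by simp
  moreover have "t powr \<nu> = x powr \<nu> * (u powr (- (1 / \<nu>))) powr \<nu>"
    unfolding t_def by (rule powr_mult)
  ultimately have tv: "t powr \<nu> = x powr \<nu> / u" using u by (simp add: powr_minus_divide del: powr_powr)
  have q: "x powr \<nu> / t powr \<nu> = u" using x u by (simp add: tv)
  have d: "t powr \<nu> - x powr \<nu> = x powr \<nu> * ((1 - u) / u)" using u by (simp add: tv field_simps)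
  have dpos: "x powr \<nu> * ((1 - u) / u) > 0" using x u by auto
  have dln: "ln (x powr \<nu> * ((1 - u) / u)) = \<nu> * X + V - U"
    using x u by (simp add: ln_mult ln_div ln_powr X_def V_def U_def)
  have r1: "complex_of_real (x / \<nu> * u powr (- (1 / \<nu>) - 1)) = exp (of_real X + (- (1 / of_real \<nu>) - 1) * of_real U) / of_real \<nu>"
  proof -
    have "x / \<nu> * u powr (- (1 / \<nu>) - 1) = exp (X + (- (1 / \<nu>) - 1) * U) / \<nu>"
      using x u by (simp add: exp_add powr_def X_def U_def)
    thus ?thesis
      by (simp only: of_real_divide exp_of_real[symmetric] of_real_add of_real_mult of_real_diff of_real_minus of_real_1)
  qed
  have r2: "complex_of_real (x powr (\<nu> * h + \<nu> - 1)) = exp ((of_real \<nu> * of_real h + of_real \<nu> - 1) * of_real X)"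
    using x by (simp add: powr_def X_def exp_of_real[symmetric])
  let ?H = "hypergeo r f m \<mu> a b (of_real (1 - u))"
  let ?e = "exp (- s * of_real t)"
  have "(x / \<nu> * u powr (- (1 / \<nu>) - 1)) *\<^sub>R J_integrand h \<nu> \<mu> \<delta> a b r f m (pow_exp l s) x t
     = exp (of_real X + (- (1 / of_real \<nu>) - 1) * of_real U) / of_real \<nu> * (exp ((\<mu> - 1) * of_real (\<nu> * X + V - U)) * ?H
        * (exp (l * of_real (X - U / \<nu>)) * ?e) * exp ((- \<delta> - of_real \<nu> * (\<mu> + of_real h)) * of_real (X - U / \<nu>)))"
    unfolding scaleR_conv_of_real r1 J_integrand_def pow_exp_def q d of_real_powr_pos[OF t(1)] of_real_powr_pos[OF dpos] dln t(2) ..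
  also have "\<dots> = ?H * ?e / of_real \<nu> * (exp (of_real X + (- (1 / of_real \<nu>) - 1) * of_real U) * exp ((\<mu> - 1) * of_real (\<nu> * X + V - U))
        * exp (l * of_real (X - U / \<nu>)) * exp ((- \<delta> - of_real \<nu> * (\<mu> + of_real h)) * of_real (X - U / \<nu>)))"
    by simp
  also have "exp (of_real X + (- (1 / of_real \<nu>) - 1) * of_real U) * exp ((\<mu> - 1) * of_real (\<nu> * X + V - U))
        * exp (l * of_real (X - U / \<nu>)) * exp ((- \<delta> - of_real \<nu> * (\<mu> + of_real h)) * of_real (X - U / \<nu>))
     = exp ((l - \<delta>) * of_real X) * exp (- ((of_real \<nu> * of_real h + of_real \<nu> - 1) * of_real X)) * exp ((\<mu> - 1) * of_real V) * exp ((frak_c2 h \<nu> \<delta> l - 1) * of_real U)"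
    unfolding exp_add[symmetric]
    by (rule arg_cong[of _ _ exp]) (use \<nu> in \<open>simp add: frak_c2_def frak_c1_def field_simps\<close>)
  also have "?H * ?e / of_real \<nu> * \<dots> = exp ((l - \<delta>) * of_real X) / (of_real \<nu> * exp ((of_real \<nu> * of_real h + of_real \<nu> - 1) * of_real X)) *
       (exp ((\<mu> - 1) * of_real V) * ?H * exp ((frak_c2 h \<nu> \<delta> l - 1) * of_real U) * ?e)"
    by (simp add: exp_minus divide_inverse mult_ac)
  also have "?e = exp (- (s * of_real x) * of_real (u powr (- (1 / \<nu>))))" by (simp add: t_def mult.assoc)
  finally show ?thesis using x u
    by (simp add: mellin_kernel_def r2 of_real_powr_pos X_def U_def V_def t_def del: of_real_diff)
qed

section \<open>The Laplace transform of the fractional integral\<close>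

locale theorem_params =
  fixes h \<nu> :: real and r :: nat and \<mu> \<delta> l a b s :: complex
    and f :: "nat \<Rightarrow> complex" and m :: "nat \<Rightarrow> nat"
  assumes \<nu>: "\<nu> > 0" and \<mu>: "Re \<mu> > 0"
    and f: "\<And>j. j \<in> {1..r} \<Longrightarrow> f j \<notin> \<int>\<^sub>\<le>\<^sub>0"
    and c2: "Re (frak_c2 h \<nu> \<delta> l) > - min 0 (Re (frak_p \<mu> a b (msum r m)))"
    and s: "Re s > 0"
begin

sublocale kernel_params r f m \<mu> a b "frak_c2 h \<nu> \<delta> l" \<nu>
  by unfold_locales (use \<nu> \<mu> f c2 in auto)

abbreviation "J \<equiv> J_integrand h \<nu> \<mu> \<delta> a b r f m (pow_exp l s)"

text \<open>The factor that the substitution \<open>t = x u\<^bsup>-1/\<nu>\<^esup>\<close> takes out of the integral; the prefactor of the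
  operator reduces it to \<open>x\<^bsup>l-\<delta>\<^esup> / \<Gamma>(\<mu>)\<close>.\<close>

abbreviation "Jscale x \<equiv> of_real x powr (l - \<delta>) / (of_real \<nu> * of_real (x powr (\<nu> * h + \<nu> - 1)) :: complex)"

abbreviation "GE z u \<equiv> G u * exp (- z * of_real (u powr (- (1 / \<nu>))))"

lemma GE_integrable: "Re z \<ge> 0 \<Longrightarrow> set_integrable lebesgue {0<..<1} (GE z)"
  by (rule set_integrable_bound[OF G_integrable])
     (auto simp: set_borel_measurable_def norm_mult mult_left_le intro!: AE_I2)

lemma norm_GE_le: "Re z \<ge> 0 \<Longrightarrow> norm (GE z u) \<le> norm (G u)"
  by (auto simp: norm_mult mult_left_le)

lemma Re_s_mult_pos: "x > 0 \<Longrightarrow> Re (s * of_real x) > 0"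
  using s by simp

lemma J_subst: "x > 0 \<Longrightarrow> u \<in> {0<..<1} \<Longrightarrow>
   (x / \<nu> * u powr (- (1 / \<nu>) - 1)) *\<^sub>R J x (x * u powr (- (1 / \<nu>))) = Jscale x * GE (s * of_real x) u"
  unfolding G_def by (rule J_integrand_substitution[OF _ \<nu>])

lemma J_integrable:
  assumes x: "x > 0"
  shows "set_integrable lebesgue {x<..} (J x)"
proof -
  have "set_integrable lebesgue {0<..<1} (\<lambda>u. Jscale x * GE (s * of_real x) u)"
    using Re_s_mult_pos[OF x] by (intro set_integrable_mult_right GE_integrable) auto
  moreover have "set_integrable lebesgue {0<..<1} (\<lambda>u. (x / \<nu> * u powr (- (1 / \<nu>) - 1)) *\<^sub>R J x (x * u powr (- (1 / \<nu>))))
     = set_integrable lebesgue {0<..<1} (\<lambda>u. Jscale x * GE (s * of_real x) u)"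
    by (rule set_integrable_cong[OF refl refl J_subst[OF x]])
  ultimately show ?thesis by (simp only: substitution_integrable_iff[OF x \<nu>])
qed

lemma J_integral:
  assumes x: "x > 0"
  shows "(LINT t:{x<..}|lebesgue. J x t) = Jscale x * (LINT u:{0<..<1}|lebesgue. GE (s * of_real x) u)"
proof -
  have "(LINT t:{x<..}|lebesgue. J x t) = (LINT u:{0<..<1}|lebesgue. (x / \<nu> * u powr (- (1 / \<nu>) - 1)) *\<^sub>R J x (x * u powr (- (1 / \<nu>))))"
    by (rule substitution_integral[OF x \<nu> J_integrable[OF x]])
  also have "\<dots> = (LINT u:{0<..<1}|lebesgue. Jscale x * GE (s * of_real x) u)"
    by (intro set_lebesgue_integral_cong allI impI J_subst[OF x]) auto
  finally show ?thesis by simp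
qed

lemma J_norm_integral_le:
  assumes x: "x > 0"
  shows "(LINT t:{x<..}|lebesgue. norm (J x t)) \<le> norm (Jscale x) * (LINT u:{0<..<1}|lebesgue. norm (G u))"
proof -
  have "(LINT t:{x<..}|lebesgue. norm (J x t)) = (LINT u:{0<..<1}|lebesgue. (x / \<nu> * u powr (- (1 / \<nu>) - 1)) *\<^sub>R norm (J x (x * u powr (- (1 / \<nu>)))))"
    by (rule substitution_integral[OF x \<nu> set_integrable_norm[OF J_integrable[OF x]]])
  also have "\<dots> = (LINT u:{0<..<1}|lebesgue. norm (Jscale x * GE (s * of_real x) u))"
  proof (intro set_lebesgue_integral_cong allI impI)
    fix u :: real assume u: "u \<in> {0<..<1}"
    have "(x / \<nu> * u powr (- (1 / \<nu>) - 1)) *\<^sub>R norm (J x (x * u powr (- (1 / \<nu>))))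
       = norm ((x / \<nu> * u powr (- (1 / \<nu>) - 1)) *\<^sub>R J x (x * u powr (- (1 / \<nu>))))"
      using x \<nu> by simp
    thus "(x / \<nu> * u powr (- (1 / \<nu>) - 1)) *\<^sub>R norm (J x (x * u powr (- (1 / \<nu>)))) = norm (Jscale x * GE (s * of_real x) u)"
      unfolding J_subst[OF x u] .
  qed auto
  also have "\<dots> = norm (Jscale x) * (LINT u:{0<..<1}|lebesgue. norm (GE (s * of_real x) u))"
    unfolding norm_mult[of "Jscale x"] by (rule set_integral_mult_right)
  also have "\<dots> \<le> norm (Jscale x) * (LINT u:{0<..<1}|lebesgue. norm (G u))"
    using Re_s_mult_pos[OF x]
    by (intro mult_left_mono set_integral_mono set_integrable_norm GE_integrable G_integrable norm_GE_le) auto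
  finally show ?thesis .
qed

lemma frac_J_eq:
  assumes x: "x > 0"
  shows "frac_J h \<nu> \<mu> \<delta> a b r f m (pow_exp l s) x
     = of_real x powr (l - \<delta>) * ((LINT u:{0<..<1}|lebesgue. GE (s * of_real x) u) / Gamma \<mu>)"
proof -
  have "complex_of_real (x powr (\<nu> * h + \<nu> - 1)) \<noteq> 0" "complex_of_real \<nu> \<noteq> 0" using x \<nu> by auto
  thus ?thesis unfolding frac_J_def J_integral[OF x] by simp
qed

end

locale theorem_params_phi = theorem_params +
  fixes \<phi> :: "real \<Rightarrow> complex"
  assumes \<phi>: "set_integrable lebesgue {0<..} (\<lambda>x. of_real x powr (l - \<delta>) * \<phi> x)"
begin

definition wphi :: "real \<Rightarrow> complex" where
  "wphi t = indicator {0<..} t *\<^sub>R (of_real t powr (l - \<delta>) * \<phi> t)"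

text \<open>The prefactor of \<open>J\<close>, with the weight that makes \<open>\<phi>\<close> integrable taken out again.\<close>

definition weight :: "real \<Rightarrow> complex" where
  "weight t = of_real \<nu> * of_real (t powr (\<nu> * h + \<nu> - 1)) / Gamma \<mu> * of_real t powr (\<delta> - l)"

text \<open>The integrand over \<open>0 < t < x\<close> common to both iterated integrals. It uses \<open>\<phi>\<close> through its integrable
  multiple \<open>wphi\<close>, so that it is measurable on the product space.\<close>

definition joint :: "real \<Rightarrow> real \<Rightarrow> complex" where
  "joint t x = indicator {0<..} t *\<^sub>R indicator {0<..} (x - t) *\<^sub>R (weight t * wphi t * J t x)"

lemma wphi_integrable: "integrable lebesgue wphi"
  using \<phi> by (simp add: set_integrable_def wphi_def[abs_def])

lemma wphi_measurable [measurable]: "wphi \<in> borel_measurable lebesgue"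
  using wphi_integrable by simp

lemma weight_mult_wphi: "t > 0 \<Longrightarrow> weight t * wphi t = of_real \<nu> * of_real (t powr (\<nu> * h + \<nu> - 1)) / Gamma \<mu> * \<phi> t"
proof -
  assume t: "t > 0"
  have "complex_of_real t powr (\<delta> - l) * of_real t powr (l - \<delta>) = 1"
    using t by (simp flip: powr_add)
  thus ?thesis using t by (simp add: weight_def wphi_def mult_ac)
qed

lemma norm_weight_mult_Jscale: "t > 0 \<Longrightarrow> norm (weight t) * norm (Jscale t) = 1 / norm (Gamma \<mu>)"
  using \<nu> by (simp add: weight_def norm_mult norm_divide norm_of_real_powr flip: powr_add)

lemma joint_measurable: "case_prod joint \<in> borel_measurable (lebesgue \<Otimes>\<^sub>M lebesgue)"
  unfolding joint_def weight_def J_integrand_def pow_exp_def case_prod_unfold by measurable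

lemma joint_fst: "joint t = (\<lambda>x. indicator {0<..} t *\<^sub>R (weight t * wphi t * (indicator {t<..} x *\<^sub>R J t x)))"
  by (auto simp: joint_def fun_eq_iff indicator_def)

text \<open>Integrating absolute values over \<open>x\<close> first leaves at most a constant times \<open>\<bar>wphi t\<bar>\<close>, as the powers
  of \<open>t\<close> cancel.\<close>

lemma joint_integrable: "integrable (lebesgue \<Otimes>\<^sub>M lebesgue) (case_prod joint)"
proof (rule lebesgue_pair.Fubini_integrable[OF joint_measurable])
  have Hi: "integrable lebesgue (joint t)" for t
  proof (cases "t > 0")
    case True
    thus ?thesis unfolding joint_fst using J_integrable[OF True]
      by (intro integrable_scaleR_right integrable_mult_right) (auto simp: set_integrable_def)
  qed (simp add: joint_fst)
  thus "AE t in lebesgue. integrable lebesgue (\<lambda>x. case (t, x) of (t, x) \<Rightarrow> joint t x)" by simp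
  define N where "N = (LINT u:{0<..<1}|lebesgue. norm (G u)) / norm (Gamma \<mu>)"
  show "integrable lebesgue (\<lambda>t. \<integral>x. norm (case (t, x) of (t, x) \<Rightarrow> joint t x) \<partial>lebesgue)"
  proof (rule Bochner_Integration.integrable_bound)
    show "integrable lebesgue (\<lambda>t. N * norm (wphi t))"
      using wphi_integrable by simp
    have [measurable]: "case_prod joint \<in> borel_measurable (lebesgue \<Otimes>\<^sub>M lebesgue)" by (rule joint_measurable)
    show "(\<lambda>t. \<integral>x. norm (case (t, x) of (t, x) \<Rightarrow> joint t x) \<partial>lebesgue) \<in> borel_measurable lebesgue"
      by measurable
    have "norm (\<integral>x. norm (joint t x) \<partial>lebesgue) \<le> norm (N * norm (wphi t))" for t
    proof (cases "t > 0")
      case True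
      have "(\<integral>x. norm (joint t x) \<partial>lebesgue) = (\<integral>x. norm (weight t) * norm (wphi t) * (indicator {t<..} x *\<^sub>R norm (J t x)) \<partial>lebesgue)"
        unfolding joint_fst using True by (intro Bochner_Integration.integral_cong) (auto simp: norm_mult)
      also have "\<dots> = norm (weight t) * norm (wphi t) * (LINT x:{t<..}|lebesgue. norm (J t x))"
        unfolding set_lebesgue_integral_def by (rule integral_mult_right_zero)
      also have "\<dots> \<le> norm (weight t) * norm (wphi t) * (norm (Jscale t) * (LINT u:{0<..<1}|lebesgue. norm (G u)))"
        by (intro mult_left_mono J_norm_integral_le True) auto
      also have "\<dots> = (norm (weight t) * norm (Jscale t)) * (norm (wphi t) * (LINT u:{0<..<1}|lebesgue. norm (G u)))"
        by (simp only: mult_ac)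
      also have "\<dots> = N * norm (wphi t)" unfolding norm_weight_mult_Jscale[OF True] by (simp add: N_def)
      finally have "(\<integral>x. norm (joint t x) \<partial>lebesgue) \<le> N * norm (wphi t)" .
      thus ?thesis by (simp add: order.trans[OF _ abs_ge_self])
    qed (simp add: joint_fst)
    thus "AE t in lebesgue. norm (\<integral>x. norm (case (t, x) of (t, x) \<Rightarrow> joint t x) \<partial>lebesgue) \<le> norm (N * norm (wphi t))"
      by simp
  qed
qed

text \<open>Everything in the Laplace integrand that does not depend on the inner variable \<open>t\<close>.\<close>

definition outer :: "real \<Rightarrow> complex" where
  "outer x = exp (- s * of_real x) * (of_real x powr l * (of_real \<nu> * of_real x powr (- \<delta> - of_real \<nu> * (\<mu> + of_real h)) / Gamma \<mu>))"

lemma joint_snd: "x > 0 \<Longrightarrow> joint t x = outer x * (indicator {0<..<x} t *\<^sub>R I_integrand h \<nu> \<mu> a b r f m \<phi> x t)"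
proof (cases "0 < t \<and> t < x")
  case True
  hence "joint t x = weight t * wphi t * J t x" by (simp add: joint_def)
  also have "\<dots> = outer x * I_integrand h \<nu> \<mu> a b r f m \<phi> x t"
    using True weight_mult_wphi[of t] by (simp add: outer_def I_integrand_def J_integrand_def pow_exp_def mult_ac)
  finally show ?thesis using True by simp
qed (auto simp: joint_def indicator_def)

lemma joint_snd_0: "x \<le> 0 \<Longrightarrow> joint t x = 0"
  by (simp add: joint_def indicator_def)

lemma joint_int_snd: "(\<integral>t. joint t x \<partial>lebesgue) = indicator {0<..} x *\<^sub>R
    laplace_integrand (\<lambda>x. of_real x powr l * frac_I h \<nu> \<mu> \<delta> a b r f m \<phi> x) s x"
proof (cases "x > 0")
  case True
  have "(\<integral>t. joint t x \<partial>lebesgue) = outer x * (LINT t:{0<..<x}|lebesgue. I_integrand h \<nu> \<mu> a b r f m \<phi> x t)"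
    unfolding joint_snd[OF True] set_lebesgue_integral_def by (rule integral_mult_right_zero)
  thus ?thesis using True by (simp add: laplace_integrand_def frac_I_def outer_def mult_ac)
qed (simp add: joint_snd_0)

lemma joint_int_fst: "(\<integral>x. joint t x \<partial>lebesgue) = indicator {0<..} t *\<^sub>R (frac_J h \<nu> \<mu> \<delta> a b r f m (pow_exp l s) t * \<phi> t)"
proof (cases "t > 0")
  case True
  have "(\<integral>x. joint t x \<partial>lebesgue) = (\<integral>x. weight t * wphi t * (indicator {t<..} x *\<^sub>R J t x) \<partial>lebesgue)"
    unfolding joint_fst using True by (intro Bochner_Integration.integral_cong) auto
  also have "\<dots> = weight t * wphi t * (LINT x:{t<..}|lebesgue. J t x)"
    unfolding set_lebesgue_integral_def by (rule integral_mult_right_zero)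
  finally have "(\<integral>x. joint t x \<partial>lebesgue) = weight t * wphi t * (LINT x:{t<..}|lebesgue. J t x)" .
  thus ?thesis using True unfolding weight_mult_wphi[OF True] by (simp add: frac_J_def mult_ac)
qed (simp add: joint_fst)

lemma I_integrable:
  "AE x in lebesgue. x > 0 \<longrightarrow> set_integrable lebesgue {0<..<x} (I_integrand h \<nu> \<mu> a b r f m \<phi> x)"
  using lebesgue_pair.AE_integrable_snd[OF joint_integrable]
proof eventually_elim
  case (elim x)
  show ?case
  proof
    assume x: "x > 0"
    have "outer x \<noteq> 0" using x \<nu> Re_pos_not_nonpos_Int[OF \<mu>] by (simp add: outer_def Gamma_eq_zero_iff)
    moreover have "integrable lebesgue (\<lambda>t. inverse (outer x) * joint t x)" using elim by simp
    ultimately show "set_integrable lebesgue {0<..<x} (I_integrand h \<nu> \<mu> a b r f m \<phi> x)"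
      by (simp add: joint_snd[OF x] set_integrable_def flip: mult.assoc)
  qed
qed

lemma laplace_integrable:
  "set_integrable lebesgue {0<..} (laplace_integrand (\<lambda>x. of_real x powr l * frac_I h \<nu> \<mu> \<delta> a b r f m \<phi> x) s)"
  using lebesgue_pair.integrable_snd[OF joint_integrable] by (simp add: joint_int_snd set_integrable_def)

lemma frac_J_integrable:
  "set_integrable lebesgue {0<..} (\<lambda>x. frac_J h \<nu> \<mu> \<delta> a b r f m (pow_exp l s) x * \<phi> x)"
  using lebesgue_pair.integrable_fst[OF joint_integrable] by (simp add: joint_int_fst set_integrable_def)

lemma laplace_eq:
  "laplace (\<lambda>x. of_real x powr l * frac_I h \<nu> \<mu> \<delta> a b r f m \<phi> x) s
         = (LINT x:{0<..}|lebesgue. frac_J h \<nu> \<mu> \<delta> a b r f m (pow_exp l s) x * \<phi> x)"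
  using lebesgue_pair.Fubini_integral[OF joint_integrable]
  by (simp add: joint_int_fst joint_int_snd laplace_def set_lebesgue_integral_def)

end

theorem theorem3p1:
  fixes h \<nu> :: real and r :: nat
    and \<mu> \<delta> l a b s :: complex
    and f :: "nat \<Rightarrow> complex" and m :: "nat \<Rightarrow> nat"
    and \<phi> :: "real \<Rightarrow> complex"
  assumes "h > 0" and "\<nu> > 0"
    and "Re \<mu> > 0" and "\<mu> \<notin> \<int>\<^sub>\<le>\<^sub>0"
    and "\<And>j. j \<in> {1..r} \<Longrightarrow> f j \<notin> \<int>\<^sub>\<le>\<^sub>0"
    and "Re (frak_c2 h \<nu> \<delta> l) > - min 0 (Re (frak_p \<mu> a b (msum r m)))"
    and "set_integrable lebesgue {0<..} (\<lambda>x. of_real x powr (l - \<delta>) * \<phi> x)"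
    and "Re s > 0"
  shows
    "(AE x in lebesgue. x > 0 \<longrightarrow> set_integrable lebesgue {0<..<x} (I_integrand h \<nu> \<mu> a b r f m \<phi> x))
     \<and> set_integrable lebesgue {0<..}
         (laplace_integrand (\<lambda>x. of_real x powr l * frac_I h \<nu> \<mu> \<delta> a b r f m \<phi> x) s)
     \<and> (\<forall>x>0. set_integrable lebesgue {x<..} (J_integrand h \<nu> \<mu> \<delta> a b r f m (pow_exp l s) x))
     \<and> set_integrable lebesgue {0<..} (\<lambda>x. frac_J h \<nu> \<mu> \<delta> a b r f m (pow_exp l s) x * \<phi> x)
     \<and> laplace (\<lambda>x. of_real x powr l * frac_I h \<nu> \<mu> \<delta> a b r f m \<phi> x) s
         = (LINT x:{0<..}|lebesgue. frac_J h \<nu> \<mu> \<delta> a b r f m (pow_exp l s) x * \<phi> x)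
     \<and> (let c2 = frak_c2 h \<nu> \<delta> l;
            up = [(c2 + \<mu> - a, 1 / \<nu>), (c2 + \<mu> - b, 1 / \<nu>)];
            lo = (\<lambda>k. [(0, 1), (c2, 1 / \<nu>), (c2 + frak_p \<mu> a b k, 1 / \<nu>)])
        in \<forall>x>0.
             (\<forall>k\<le>msum r m. has_foxH 3 0 up (lo k) (s * of_real x) (foxH 3 0 up (lo k) (s * of_real x)))
             \<and> frac_J h \<nu> \<mu> \<delta> a b r f m (pow_exp l s) x
                 = of_real x powr (l - \<delta>) *
                   (\<Sum>k\<le>msum r m. A_coeff r f m k / A_coeff r f m 0 * pochhammer a k * pochhammer b k
                      * foxH 3 0 up (lo k) (s * of_real x)))"
proof -
  interpret theorem_params_phi h \<nu> r \<mu> \<delta> l a b s f m \<phi>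
    by unfold_locales (use assms in auto)
  show ?thesis
    unfolding Let_def
    by (intro conjI allI impI I_integrable laplace_integrable J_integrable frac_J_integrable laplace_eq
          sum_foxH_eq(1) Re_s_mult_pos)
       (simp_all only: frac_J_eq sum_foxH_eq(2)[OF Re_s_mult_pos])
qed

end
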